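(* Let $g$ be a totally positive function of Gaussian type. Let $\Lambda\subseteq\mathbb{R}$ be a separated set and let $m_\Lambda:\Lambda\to\mathbb{N}$ be a multiplicity function such that $\sup_{\lambda\in\Lambda} m_\Lambda(\lambda)<\infty$. (i) If $D^-(\Lambda,m_\Lambda)>1$, then $(\Lambda,m_\Lambda)$ is a sampling set for $V^p(g)$ for every $1\le p\le\infty$. (ii) Conversely, if $(\Lambda,m_\Lambda)$ is a sampling set for $V^2(g)$, then $D^-(\Lambda,m_\Lambda)\ge 1$.
   Context: A function $g:\mathbb{R}\to\mathbb{C}$ is called totally positive of Gaussian type if its Fourier transform (with $\hat g(\xi)=\int g(x)e^{-2\pi i x\xi}\,dx$) factors as $\hat g(\xi)=\prod_{j=1}^n(1+2\pi i\delta_j\xi)^{-1}e^{-c\xi^2}$ with $\delta_1,\dots,\delta_n\in\mathbb{R}$, $c>0$, $n\in\mathbb{N}\cup\{0\}$. For $1\le p\le\infty$, $V^p(g)=\{f\in L^p(\mathbb{R}): f=\sum_{k\in\mathbb{Z}}c_k g(\cdot-k),\ c\in\ell^p(\mathbb{Z})\}$. A set $\Lambda\subseteq\mathbb{R}$ is separated if $\inf\{|\lambda-\lambda'|:\lambda\ne\lambda'\in\Lambda\}>0$. For a set $\Lambda$ with multiplicity function $m_\Lambda:\Lambda\to\mathbb{N}$, $(\Lambda,m_\Lambda)$ is a sampling set for $V^p(g)$, $1\le p<\infty$, if there are $A,B>0$ with $A\|f\|_p^p\le\sum_{\lambda\in\Lambda}\sum_{j=0}^{m_\Lambda(\lambda)-1}|f^{(j)}(\lambda)|^p\le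 B\|f\|_p^p$ for all $f\in V^p(g)$; for $p=\infty$ the condition is $A\|f\|_\infty\le\sup_{\lambda\in\Lambda}\max_{0\le j\le m_\Lambda(\lambda)-1}|f^{(j)}(\lambda)|\le B\|f\|_\infty$ for all $f\in V^\infty(g)$. The weighted lower Beurling density is $D^-(\Lambda,m_\Lambda)=\liminf_{r\to\infty}\inf_{x\in\mathbb{R}}\frac{1}{2r}\sum_{\lambda\in\Lambda\cap[x-r,x+r]}m_\Lambda(\lambda)$. *)

theory Defs
  imports "HOL-Analysis.Analysis" "HOL-Probability.Essential_Supremum"
begin

definition fourier_transform :: "(real \<Rightarrow> complex) \<Rightarrow> real \<Rightarrow> complex" where
  "fourier_transform g \<xi> = (LINT x|lborel. g x * exp (- (2 * pi * \<i> * complex_of_real (x * \<xi>))))"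

text \<open>Totally positive function of Gaussian type (continuous representative).\<close>
definition tp_gaussian :: "(real \<Rightarrow> complex) \<Rightarrow> bool" where
  "tp_gaussian g \<longleftrightarrow> integrable lborel g \<and> continuous_on UNIV g \<and>
     (\<exists>(n::nat) (\<delta>::nat \<Rightarrow> real) (c::real). c > 0 \<and>
        (\<forall>\<xi>. fourier_transform g \<xi> =
           (\<Prod>j<n. inverse (1 + 2 * pi * \<i> * complex_of_real (\<delta> j * \<xi>)))
           * complex_of_real (exp (- c * \<xi>\<^sup>2))))"

definition in_Lp :: "real \<Rightarrow> (real \<Rightarrow> complex) \<Rightarrow> bool" where
  "in_Lp p f \<longleftrightarrow> f \<in> borel_measurable lborel \<and> integrable lborel (\<lambda>x. norm (f x) powr p)"

definition Lp_norm_pow :: "real \<Rightarrow> (real \<Rightarrow> complex) \<Rightarrow> real" where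
  "Lp_norm_pow p f = (LINT x|lborel. norm (f x) powr p)"

definition Linf_norm :: "(real \<Rightarrow> complex) \<Rightarrow> ereal" where
  "Linf_norm f = esssup lborel (\<lambda>x. ereal (norm (f x)))"

definition in_Linf :: "(real \<Rightarrow> complex) \<Rightarrow> bool" where
  "in_Linf f \<longleftrightarrow> f \<in> borel_measurable lborel \<and> Linf_norm f < \<infinity>"

definition in_lp :: "real \<Rightarrow> (int \<Rightarrow> complex) \<Rightarrow> bool" where
  "in_lp p c \<longleftrightarrow> (\<lambda>k. norm (c k) powr p) summable_on UNIV"

definition in_linf :: "(int \<Rightarrow> complex) \<Rightarrow> bool" where
  "in_linf c \<longleftrightarrow> bounded (range c)"

definition shift_series :: "(real \<Rightarrow> complex) \<Rightarrow> (int \<Rightarrow> complex) \<Rightarrow> (real \<Rightarrow> complex) \<Rightarrow> bool" where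
  "shift_series g c f \<longleftrightarrow> (\<forall>x. (\<lambda>k. c k * g (x - of_int k)) summable_on UNIV \<and>
      f x = (\<Sum>\<^sub>\<infinity>k. c k * g (x - of_int k)))"

definition Vp :: "real \<Rightarrow> (real \<Rightarrow> complex) \<Rightarrow> (real \<Rightarrow> complex) set" where
  "Vp p g = {f. in_Lp p f \<and> (\<exists>c. in_lp p c \<and> shift_series g c f)}"

definition Vinf :: "(real \<Rightarrow> complex) \<Rightarrow> (real \<Rightarrow> complex) set" where
  "Vinf g = {f. in_Linf f \<and> (\<exists>c. in_linf c \<and> shift_series g c f)}"

definition nderiv :: "nat \<Rightarrow> (real \<Rightarrow> complex) \<Rightarrow> real \<Rightarrow> complex" where
  "nderiv j f = ((\<lambda>h x. vector_derivative h (at x)) ^^ j) f"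

definition separated :: "real set \<Rightarrow> bool" where
  "separated \<Lambda> \<longleftrightarrow> (\<exists>\<delta>>0. \<forall>a\<in>\<Lambda>. \<forall>b\<in>\<Lambda>. a \<noteq> b \<longrightarrow> \<delta> \<le> \<bar>a - b\<bar>)"

definition sampling_set_p :: "real \<Rightarrow> (real \<Rightarrow> complex) \<Rightarrow> real set \<Rightarrow> (real \<Rightarrow> nat) \<Rightarrow> bool" where
  "sampling_set_p p g \<Lambda> m \<longleftrightarrow> (\<exists>A>0. \<exists>B>0. \<forall>f\<in>Vp p g.
     (\<lambda>l. \<Sum>j<m l. norm (nderiv j f l) powr p) summable_on \<Lambda> \<and>
     A * Lp_norm_pow p f \<le> (\<Sum>\<^sub>\<infinity>l\<in>\<Lambda>. \<Sum>j<m l. norm (nderiv j f l) powr p) \<and>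
     (\<Sum>\<^sub>\<infinity>l\<in>\<Lambda>. \<Sum>j<m l. norm (nderiv j f l) powr p) \<le> B * Lp_norm_pow p f)"

definition sampling_set_inf :: "(real \<Rightarrow> complex) \<Rightarrow> real set \<Rightarrow> (real \<Rightarrow> nat) \<Rightarrow> bool" where
  "sampling_set_inf g \<Lambda> m \<longleftrightarrow> (\<exists>A>0. \<exists>B>0. \<forall>f\<in>Vinf g.
     ereal A * Linf_norm f \<le> (SUP l\<in>\<Lambda>. SUP j\<in>{..<m l}. ereal (norm (nderiv j f l))) \<and>
     (SUP l\<in>\<Lambda>. SUP j\<in>{..<m l}. ereal (norm (nderiv j f l))) \<le> ereal B * Linf_norm f)"

definition lower_density :: "real set \<Rightarrow> (real \<Rightarrow> nat) \<Rightarrow> ereal" where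
  "lower_density \<Lambda> m = Liminf at_top (\<lambda>r::real. INF x. ereal ((\<Sum>l\<in>\<Lambda> \<inter> {x - r..x + r}. real (m l)) / (2 * r)))"

end

theory Submission
  imports Defs "HOL-Complex_Analysis.Complex_Analysis" "HOL-Probability.Probability" "HOL-Real_Asymp.Real_Asymp"
begin

text \<open>
  Since the Fourier transform of \<open>g\<close> is a Gaussian divided by the factors \<open>1 + 2\<pi>i\<delta>\<^sub>j\<xi>\<close>, applying the operators
  \<open>1 + \<delta>\<^sub>j d/dx\<close> one after the other turns a sum \<open>f = \<Sum>\<^sub>k c\<^sub>k g(x - k)\<close> into a Gaussian sum with the same
  coefficients, and by Rolle's theorem each of them loses at most one zero per interval. For a Gaussian
  \<open>exp (-ax\<^sup>2)\<close> the sum is, in the variable \<open>w = exp (2ax)\<close>, a Laurent series of size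
  \<open>exp (ax\<^sup>2)\<close> on \<open>|w| = exp (2a|x|)\<close>; dividing out its zeros and using the maximum principle on large annuli
  shows that it vanishes once the density of the zeros exceeds 1. This uniqueness statement is stable
  under translations and weak limits, so a compactness argument gives \<open>\<parallel>c\<parallel>\<^sub>\<infinity> \<le> C \<parallel>samples\<parallel>\<^sub>\<infinity>\<close> uniformly
  over all sampling patterns with given separation and density. Exponential weights commute with
  sampling up to a small error, which localises this bound and yields all \<open>p\<close> at once. Applied to
  patterns of density 2 adapted to \<open>f\<close>, the same bound gives \<open>\<parallel>c\<parallel>\<^sub>p \<le> C \<parallel>f\<parallel>\<^sub>p\<close>.

  Conversely, if the density is below 1, then on some long interval there are fewer sampling conditions
  than integers well inside it, so linear algebra provides a nonzero finitely supported \<open>c\<close> whose samples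
  vanish on the interval and are exponentially small outside, contradicting the sampling inequality.
\<close>

section \<open>Exponentially weighted sums over the integers\<close>

text \<open>Density 1 is critical because of a balance of quadratic exponents. Zeros of density
  \<open>D\<close> up to distance \<open>X\<close> force growth of order
  \<open>exp (a * D * X\<^sup>2)\<close> on the circles of radius \<open>exp (2 * a * X)\<close> and
  its inverse, while bounded coefficients allow only \<open>exp (a * X\<^sup>2)\<close>. A strict
  surplus absorbs everything of lower order: the zero that Rolle's theorem costs on a long interval,
  and factors exponential in the number of zeros. Rolle's theorem concerns real functions, hence
  real and imaginary parts are treated separately. A weak limit could be zero, and sample points
  could merge or leave a window. This is why the compactness argument keeps one coefficient of size
  at least 1/2, a fixed separation, and closed windows. Its constant depends only on the class of
  patterns; this uniformity is essential, since the bound is also applied at minimisers of the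
  modulus of \<open>f\<close>, which depend on \<open>f\<close>.\<close>

lemma exp_abs_int_sum_le:
  fixes b :: real
  assumes "b > 0" "finite K"
  shows "(\<Sum>k\<in>K. exp (- b * \<bar>real_of_int k\<bar>)) \<le> 2 / (1 - exp (-b))"
proof -
  define r where "r = exp (-b)"
  have r: "0 < r" "r < 1" using assms by (auto simp: r_def)
  \<comment> \<open>Each half line is enumerated injectively by absolute value, so its sum is part
    of the geometric series.\<close>
  have *: "(\<Sum>k\<in>A. exp (- b * \<bar>real_of_int k\<bar>)) \<le> 1 / (1 - r)"
    if "finite A" "inj_on (\<lambda>k. nat \<bar>k\<bar>) A" for A
  proof -
    have "(\<Sum>k\<in>A. exp (- b * \<bar>real_of_int k\<bar>)) = (\<Sum>k\<in>A. r ^ nat \<bar>k\<bar>)"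
      by (intro sum.cong refl) (simp add: r_def mult.commute flip: exp_of_nat_mult)
    also have "\<dots> = (\<Sum>n\<in>(\<lambda>k. nat \<bar>k\<bar>) ` A. r ^ n)"
      using that by (simp add: sum.reindex)
    also have "\<dots> \<le> suminf (\<lambda>n. r ^ n)"
      by (rule sum_le_suminf) (use that r in auto)
    also have "\<dots> = 1 / (1 - r)" using r by (simp add: suminf_geometric)
    finally show ?thesis .
  qed
  have "(\<Sum>k\<in>K. exp (- b * \<bar>real_of_int k\<bar>)) =
     (\<Sum>k\<in>K \<inter> {0..}. exp (- b * \<bar>real_of_int k\<bar>)) + (\<Sum>k\<in>K \<inter> - {0..}. exp (- b * \<bar>real_of_int k\<bar>))"
    using assms(2) by (rule sum.Int_Diff[of K _ "{0..}", unfolded Diff_eq])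
  also have "\<dots> \<le> 1 / (1 - r) + 1 / (1 - r)"
    by (intro add_mono *) (use assms in \<open>auto simp: inj_on_def\<close>)
  finally show ?thesis by (simp add: r_def)
qed

text \<open>The factor \<open>exp b\<close> pays for rounding \<open>x\<close> to an integer; what
  remains is twice a geometric series, so the bound does not depend on \<open>x\<close>.\<close>

definition exp_sum_bound :: "real \<Rightarrow> real" where
  "exp_sum_bound b = exp b * (2 / (1 - exp (-b)))"

lemma exp_sum_bound_pos: "b > 0 \<Longrightarrow> exp_sum_bound b > 0"
  by (simp add: exp_sum_bound_def)

lemma exp_dist_int_sum_le:
  fixes b x :: real
  assumes "b > 0" "finite K"
  shows "(\<Sum>k\<in>K. exp (- b * \<bar>x - real_of_int k\<bar>)) \<le> exp_sum_bound b"
proof -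
  have "(\<Sum>k\<in>K. exp (- b * \<bar>x - real_of_int k\<bar>)) \<le> (\<Sum>k\<in>K. exp b * exp (- b * \<bar>real_of_int (\<lfloor>x\<rfloor> - k)\<bar>))"
  proof (intro sum_mono)
    fix k
    have "\<bar>real_of_int (\<lfloor>x\<rfloor> - k)\<bar> \<le> \<bar>x - real_of_int k\<bar> + 1" by linarith
    then have "b * \<bar>real_of_int (\<lfloor>x\<rfloor> - k)\<bar> \<le> b * (\<bar>x - real_of_int k\<bar> + 1)"
      using assms by (intro mult_left_mono) auto
    then show "exp (- b * \<bar>x - real_of_int k\<bar>) \<le> exp b * exp (- b * \<bar>real_of_int (\<lfloor>x\<rfloor> - k)\<bar>)"
      by (simp add: distrib_left flip: exp_add)
  qed
  also have "\<dots> = exp b * (\<Sum>j\<in>(\<lambda>k. \<lfloor>x\<rfloor> - k) ` K. exp (- b * \<bar>real_of_int j\<bar>))"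
    by (subst sum.reindex) (auto simp: inj_on_def sum_distrib_left)
  also have "\<dots> \<le> exp b * (2 / (1 - exp (-b)))"
    by (intro mult_left_mono exp_abs_int_sum_le) (use assms in auto)
  finally show ?thesis by (simp add: exp_sum_bound_def)
qed

lemma summable_exp_dist_int:
  fixes b x :: real
  assumes "b > 0"
  shows "(\<lambda>k::int. exp (- b * \<bar>x - real_of_int k\<bar>)) summable_on UNIV"
  by (rule nonneg_bounded_partial_sums_imp_summable_on[where C = "exp_sum_bound b"])
     (use exp_dist_int_sum_le[OF assms] in \<open>auto intro!: eventually_finite_subsets_at_top_weakI\<close>)

lemma infsum_exp_dist_int_le:
  fixes b x :: real
  assumes "b > 0"
  shows "(\<Sum>\<^sub>\<infinity>k::int. exp (- b * \<bar>x - real_of_int k\<bar>)) \<le> exp_sum_bound b"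
  using summable_exp_dist_int[OF assms] exp_dist_int_sum_le[OF assms]
  by (intro infsum_le_finite_sums) auto

text \<open>Each \<open>q i\<close> lies within distance \<open>1 / Q \<le> 1\<close> of the grid
  point \<open>i / Q\<close>; dilation by \<open>Q\<close> turns the grid into the integers and the
  rate \<open>b\<close> into \<open>b / Q\<close>.\<close>

lemma exp_dist_cell_sum_le:
  fixes b x :: real and q :: "int \<Rightarrow> real"
  assumes "b > 0" "Q > 0" "finite I"
    and q: "\<And>i. real_of_int i / real Q \<le> q i" "\<And>i. q i \<le> (real_of_int i + 1) / real Q"
  shows "(\<Sum>i\<in>I. exp (- b * \<bar>q i - x\<bar>)) \<le> exp b * exp_sum_bound (b / real Q)"
proof -
  have "(\<Sum>i\<in>I. exp (- b * \<bar>q i - x\<bar>)) \<le> (\<Sum>i\<in>I. exp b * exp (- (b / real Q) * \<bar>x * real Q - real_of_int i\<bar>))"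
  proof (intro sum_mono)
    fix i
    have Q1: "1 / real Q \<le> 1" using assms by simp
    have "(b / real Q) * \<bar>x * real Q - real_of_int i\<bar> = b * \<bar>x - real_of_int i / real Q\<bar>"
    proof -
      have "x * real Q - real_of_int i = real Q * (x - real_of_int i / real Q)"
        using assms by (simp add: field_simps)
      then show ?thesis using assms by (simp add: abs_mult)
    qed
    also have "\<dots> \<le> b * (\<bar>q i - x\<bar> + 1)"
      using q[of i] Q1 assms(1) by (intro mult_left_mono) (auto simp: add_divide_distrib)
    finally show "exp (- b * \<bar>q i - x\<bar>) \<le> exp b * exp (- (b / real Q) * \<bar>x * real Q - real_of_int i\<bar>)"
      by (simp add: distrib_left flip: exp_add)
  qed
  also have "\<dots> \<le> exp b * exp_sum_bound (b / real Q)"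
    unfolding sum_distrib_left[symmetric]
    by (intro mult_left_mono exp_dist_int_sum_le) (use assms in auto)
  finally show ?thesis .
qed

section \<open>Real zeros with multiplicity\<close>

text \<open>Zeros are listed in increasing order and repeated according to multiplicity, with
  \<open>U j\<close> standing for the j-th derivative: an entry recurring \<open>j\<close> places
  later forces \<open>U j\<close> to vanish there. In this form, as in Hermite interpolation,
  Rolle's theorem treats simple and multiple zeros alike, one gap between neighbours at a
  time.\<close>

definition zero_list :: "(nat \<Rightarrow> real \<Rightarrow> real) \<Rightarrow> (nat \<Rightarrow> real) \<Rightarrow> nat \<Rightarrow> bool" where
  "zero_list U z N \<longleftrightarrow> (\<forall>i j. i \<le> j \<and> j < N \<longrightarrow> z i \<le> z j) \<and>
     (\<forall>i j. i + j < N \<and> z i = z (i + j) \<longrightarrow> U j (z i) = 0)"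

text \<open>Density above 1, uniformly in the position. Half-open windows tile the line without
  sharing zeros.\<close>

definition dense_zeros :: "(nat \<Rightarrow> real \<Rightarrow> real) \<Rightarrow> bool" where
  "dense_zeros U \<longleftrightarrow> (\<exists>L N. 0 < L \<and> L < real N \<and>
     (\<forall>x. \<exists>z. zero_list U z N \<and> (\<forall>i<N. z i \<in> {x..<x + L})))"

text \<open>Adding points in increasing order only appends \<open>\<mu> b\<close> copies of the new
  maximum to the end of the list.\<close>

lemma zero_list_of_multiplicities:
  assumes "finite S" "\<And>s j. s \<in> S \<Longrightarrow> j < \<mu> s \<Longrightarrow> U j s = 0"
  shows "\<exists>z. zero_list U z (\<Sum>s\<in>S. \<mu> s) \<and> (\<forall>i<(\<Sum>s\<in>S. \<mu> s). z i \<in> S)"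
  using assms
proof (induction S rule: finite_linorder_max_induct)
  case empty
  then show ?case by (auto simp: zero_list_def)
next
  case (insert b A)
  define N where "N = (\<Sum>s\<in>A. \<mu> s)"
  obtain z where z: "zero_list U z N" "\<And>i. i < N \<Longrightarrow> z i \<in> A"
    using insert unfolding N_def by blast
  define z' where "z' i = (if i < N then z i else b)" for i
  have lt: "z i < b" if "i < N" for i using z(2)[OF that] insert.hyps by blast
  have "b \<notin> A" using insert.hyps by blast
  then have eq: "(\<Sum>s\<in>Set.insert b A. \<mu> s) = N + \<mu> b"
    using insert.hyps by (simp add: N_def)
  have "zero_list U z' (N + \<mu> b)"
    unfolding zero_list_def
  proof (intro conjI allI impI)
    fix i j assume "i \<le> j \<and> j < N + \<mu> b"
    then show "z' i \<le> z' j"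
      using z(1) lt by (auto simp: z'_def zero_list_def intro: less_imp_le)
  next
    fix i j assume ij: "i + j < N + \<mu> b \<and> z' i = z' (i + j)"
    consider "i + j < N" | "i < N" "N \<le> i + j" | "N \<le> i" by linarith
    then show "U j (z' i) = 0"
    proof cases
      case 1
      then show ?thesis using ij z(1) by (auto simp: z'_def zero_list_def)
    next
      case 2
      then show ?thesis using ij lt[of i] by (auto simp: z'_def)
    next
      case 3
      then show ?thesis using ij insert.prems[of b j] by (auto simp: z'_def)
    qed
  qed
  moreover have "\<forall>i<N + \<mu> b. z' i \<in> Set.insert b A" using z(2) by (auto simp: z'_def)
  ultimately show ?case unfolding eq by blast
qed

lemma zero_list_subset:
  assumes "zero_list U z N" "N' \<le> N"
  shows "zero_list U z N'"
  using assms unfolding zero_list_def by auto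

text \<open>Consecutive windows are disjoint, so equal entries always come from the same block and
  no multiplicity is spread over a boundary.\<close>

lemma zero_list_concat:
  assumes N: "N > 0" and L: "L > 0" and block: "\<And>x. \<exists>z. zero_list U z N \<and> (\<forall>i<N. z i \<in> {x..<x + L})"
  shows "\<exists>z. (\<forall>K. zero_list U z K) \<and>
    (\<forall>i. z i \<in> {x + real (i div N) * L..<x + real (i div N + 1) * L})"
proof -
  have "\<forall>x. \<exists>z. zero_list U z N \<and> (\<forall>i<N. z i \<in> {x..<x + L})" using block by blast
  then obtain Z where Z: "\<And>x. zero_list U (Z x) N" "\<And>x i. i < N \<Longrightarrow> Z x i \<in> {x..<x + L}"
    by metis
  define z where "z i = Z (x + real (i div N) * L) (i mod N)" for i
  have zin: "z i \<in> {x + real (i div N) * L..<x + real (i div N + 1) * L}" for i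
    using Z(2)[of "i mod N" "x + real (i div N) * L"] N by (simp add: z_def algebra_simps)
  have lt: "z i < z j" if "i div N < j div N" for i j
  proof -
    have "real (i div N + 1) \<le> real (j div N)" using that by linarith
    then have "real (i div N + 1) * L \<le> real (j div N) * L" using L by (intro mult_right_mono) auto
    then show ?thesis using zin[of i] zin[of j] by (auto simp: algebra_simps)
  qed
  have "zero_list U z K" for K
    unfolding zero_list_def
  proof (intro conjI allI impI)
    fix i j assume "i \<le> j \<and> j < K"
    then have "i \<le> j" by simp
    then have "i div N \<le> j div N" by (rule div_le_mono)
    then consider "i div N < j div N" | "i div N = j div N" by linarith
    then show "z i \<le> z j"
    proof cases
      case 2
      then have "i mod N \<le> j mod N"
        using \<open>i \<le> j\<close> by (metis add_le_cancel_left div_mult_mod_eq)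
      then show ?thesis using Z(1)[of "x + real (j div N) * L"] 2 N
        by (auto simp: z_def zero_list_def)
    qed (use lt in \<open>auto intro: less_imp_le\<close>)
  next
    fix i j assume ij: "i + j < K \<and> z i = z (i + j)"
    have "i div N \<le> (i + j) div N" by (rule div_le_mono) simp
    then have eq: "(i + j) div N = i div N" using lt[of i "i + j"] ij by fastforce
    have "i div N * N + (i + j) mod N = i + j"
      using div_mult_mod_eq[of "i + j" N] by (simp only: eq)
    then have "(i + j) mod N = i mod N + j"
      using div_mult_mod_eq[of i N] by linarith
    then show "U j (z i) = 0"
      using Z(1)[of "x + real (i div N) * L"] ij eq N mod_less_divisor[of N "i + j"]
      by (auto simp: z_def zero_list_def)
  qed
  then show ?thesis using zin by blast
qed

text \<open>Rolle's theorem is applied to \<open>exp (x / \<delta>) * u\<close>; at a multiple zero the multiplicity drops by at most one.\<close>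
lemma zero_list_ode_step:
  assumes d: "\<And>j x. (U j has_real_derivative U (Suc j) x) (at x)"
    and V: "\<And>j x. V j x = U j x + \<delta> * U (Suc j) x"
    and z: "zero_list U z (Suc N)"
  shows "\<exists>z'. zero_list V z' N \<and> (\<forall>i<N. z i \<le> z' i \<and> z' i \<le> z (Suc i))"
proof -
  have rolle: "\<exists>s. a < s \<and> s < b \<and> V 0 s = 0" if "\<delta> \<noteq> 0" "a < b" "U 0 a = 0" "U 0 b = 0" for a b
  proof -
    have D: "((\<lambda>x. exp (x / \<delta>) * U 0 x) has_real_derivative exp (x / \<delta>) / \<delta> * V 0 x) (at x)" for x
      using that(1) by (auto intro!: derivative_eq_intros d simp: V field_simps)
    have "\<exists>s>a. s < b \<and> ((\<lambda>x. exp (x / \<delta>) * U 0 x) has_real_derivative 0) (at s)"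
    proof (rule Rolle)
      show "continuous_on {a..b} (\<lambda>x. exp (x / \<delta>) * U 0 x)"
        using D by (meson DERIV_isCont continuous_at_imp_continuous_on)
      show "(\<lambda>x. exp (x / \<delta>) * U 0 x) differentiable (at x)" for x
        using D real_differentiable_def by blast
    qed (use that in auto)
    then obtain s where s: "a < s" "s < b" "((\<lambda>x. exp (x / \<delta>) * U 0 x) has_real_derivative 0) (at s)"
      by blast
    have "exp (s / \<delta>) / \<delta> * V 0 s = 0" using DERIV_unique[OF D s(3)] .
    then show ?thesis using s that(1) by auto
  qed
  have mono: "z i \<le> z j" if "i \<le> j" "j \<le> N" for i j
    using z that unfolding zero_list_def by auto
  have zero: "U j (z i) = 0" if "i + j \<le> N" "z i = z (i + j)" for i j
    using z that unfolding zero_list_def by auto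
  show ?thesis
  proof (cases "\<delta> = 0")
    case True
    have "zero_list V z N"
      using zero_list_subset[OF z, of N] by (simp add: zero_list_def V True)
    then show ?thesis using mono by (intro exI[of _ z]) auto
  next
    case False
    \<comment> \<open>Between distinct neighbours Rolle supplies a zero strictly inside; equal
      neighbours keep their common value. The strictness is what makes multiplicities detectable
      below.\<close>
    have "\<forall>i. \<exists>s. i < N \<longrightarrow> (if z i = z (Suc i) then s = z i else z i < s \<and> s < z (Suc i) \<and> V 0 s = 0)"
    proof
      fix i
      show "\<exists>s. i < N \<longrightarrow> (if z i = z (Suc i) then s = z i else z i < s \<and> s < z (Suc i) \<and> V 0 s = 0)"
        using rolle[OF False, of "z i" "z (Suc i)"] mono[of i "Suc i"] zero[of i 0] zero[of "Suc i" 0]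
        by (cases "i < N"; cases "z i = z (Suc i)") auto
    qed
    then obtain z' where z': "\<And>i. i < N \<Longrightarrow> if z i = z (Suc i) then z' i = z i
        else z i < z' i \<and> z' i < z (Suc i) \<and> V 0 (z' i) = 0"
      by metis
    have bnd: "z i \<le> z' i" "z' i \<le> z (Suc i)" if "i < N" for i
      using z'[OF that] by (auto split: if_splits)
    have "zero_list V z' N"
      unfolding zero_list_def
    proof (intro conjI allI impI)
      fix i j assume ij: "i \<le> j \<and> j < N"
      show "z' i \<le> z' j"
      proof (cases "i = j")
        case False
        then have "z' i \<le> z (Suc i)" "z (Suc i) \<le> z j" "z j \<le> z' j"
          using ij bnd mono by auto
        then show ?thesis by linarith
      qed auto
    next
      fix i j assume ij: "i + j < N \<and> z' i = z' (i + j)"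
      show "V j (z' i) = 0"
      proof (cases "j = 0")
        case True
        then show ?thesis
          using z'[of i] zero[of i 0] zero[of i 1] ij by (auto simp: V split: if_splits)
      next
        case False
        \<comment> \<open>Two equal new entries squeeze the old ones between them, and strict
          interlacing rules out distinct neighbours at either end. Hence \<open>j + 2\<close> old
          entries coincide, so both \<open>U j\<close> and \<open>U (Suc j)\<close> vanish
          there.\<close>
        have "z' i \<le> z (Suc i)" "z (Suc i) \<le> z (i + j)" "z (i + j) \<le> z' (i + j)"
          using ij bnd(1)[of "i + j"] bnd(2)[of i] mono[of "Suc i" "i + j"] False by auto
        then have e: "z' i = z (Suc i)" "z' (i + j) = z (i + j)" "z (Suc i) = z (i + j)" using ij by auto
        have "z i = z (Suc i)" using z'[of i] e ij by (auto split: if_splits)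
        moreover have "z (i + j) = z (Suc (i + j))" using z'[of "i + j"] e ij by (auto split: if_splits)
        ultimately have "z i = z (i + j)" "z i = z (i + Suc j)" "z' i = z i" using e by auto
        then show ?thesis using zero[of i j] zero[of i "Suc j"] ij by (simp add: V)
      qed
    qed
    then show ?thesis using bnd by blast
  qed
qed

text \<open>One zero is lost per window, so windows are first merged in groups of \<open>q\<close>
  with \<open>q * (N - L) > 1\<close>; the merged window then still has more zeros than its
  length.\<close>

lemma dense_zeros_ode_step:
  assumes d: "\<And>j x. (U j has_real_derivative U (Suc j) x) (at x)"
    and V: "\<And>j x. V j x = U j x + \<delta> * U (Suc j) x"
    and "dense_zeros U"
  shows "dense_zeros V"
proof -
  obtain L N where LN: "0 < L" "L < real N"
      "\<And>x. \<exists>z. zero_list U z N \<and> (\<forall>i<N. z i \<in> {x..<x + L})"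
    using assms(3) unfolding dense_zeros_def by blast
  have "N > 0" using LN by (cases N) auto
  obtain q :: nat where q: "1 / (real N - L) < real q" using reals_Archimedean2 by blast
  have "1 < real q * (real N - L)" using q LN by (simp add: field_simps)
  then have qq: "real q * L < real (q * N - 1)" and q0: "q > 0"
    by (cases q; cases N; simp add: algebra_simps of_nat_diff; fail)+
  show ?thesis
    unfolding dense_zeros_def
  proof (rule exI[of _ "real q * L"], rule exI[of _ "q * N - 1"], intro conjI allI)
    show "0 < real q * L" using q0 LN by simp
    show "real q * L < real (q * N - 1)" by (rule qq)
    fix x
    obtain z where z: "\<And>K. zero_list U z K"
        "\<And>i. z i \<in> {x + real (i div N) * L..<x + real (i div N + 1) * L}"
      using zero_list_concat[OF \<open>N > 0\<close> LN(1,3), of x] by blast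
    have "\<exists>z'. zero_list V z' (q * N - 1) \<and> (\<forall>i<q * N - 1. z i \<le> z' i \<and> z' i \<le> z (Suc i))"
      by (rule zero_list_ode_step[OF d V z(1)])
    then obtain z' where z': "zero_list V z' (q * N - 1)"
        "\<And>i. i < q * N - 1 \<Longrightarrow> z i \<le> z' i \<and> z' i \<le> z (Suc i)" by blast
    have "z' i \<in> {x..<x + real q * L}" if "i < q * N - 1" for i
    proof -
      have "x \<le> z i" using z(2)[of i] LN(1) by (auto intro: order_trans[rotated])
      moreover have "z (Suc i) < x + real q * L"
      proof -
        have "Suc i div N < q" using that \<open>N > 0\<close> by (simp add: less_mult_imp_div_less)
        then have "real (Suc i div N + 1) * L \<le> real q * L" using LN(1) by (intro mult_right_mono) auto
        then show ?thesis using z(2)[of "Suc i"] by auto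
      qed
      ultimately show ?thesis using z'(2)[OF that] by auto
    qed
    then show "\<exists>z. zero_list V z (q * N - 1) \<and> (\<forall>i<q * N - 1. z i \<in> {x..<x + real q * L})"
      using z'(1) by blast
  qed
qed

section \<open>Uniqueness for Gaussian shift sums\<close>

definition real_coeff_series :: "(nat \<Rightarrow> real) \<Rightarrow> complex \<Rightarrow> complex" where
  "real_coeff_series d w = (\<Sum>n. complex_of_real (d n) * w ^ n)"

text \<open>Completing the square turns the term into \<open>exp (a * X\<^sup>2)\<close> times a
  Gaussian in \<open>X - n\<close>. With \<open>t = \<bar>X - n\<bar>\<close>, the inequality
  \<open>(t - 1/2)\<^sup>2 \<ge> 0\<close> weakens the Gaussian to exponential decay, whose sum over
  \<open>n\<close> is under control.\<close>

lemma gaussian_coeff_term_le: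
  fixes d :: "nat \<Rightarrow> real" and w :: complex
  assumes a: "a > 0" and B: "B \<ge> 0" and d: "\<And>n. \<bar>d n\<bar> \<le> B * exp (- a * (real n)\<^sup>2)"
    and w: "norm w \<le> exp (2 * a * X)"
  shows "norm (complex_of_real (d n) * w ^ n) \<le> B * exp (a * X\<^sup>2) * exp (a / 4) * exp (- a * \<bar>X - real n\<bar>)"
proof -
  have "norm (complex_of_real (d n) * w ^ n) = \<bar>d n\<bar> * norm w ^ n"
    by (simp add: norm_mult norm_power)
  also have "\<dots> \<le> (B * exp (- a * (real n)\<^sup>2)) * exp (2 * a * X) ^ n"
    by (intro mult_mono power_mono d w) (use B in auto)
  also have "\<dots> = B * exp (a * X\<^sup>2 - a * (X - real n)\<^sup>2)"
    by (simp add: mult_ac flip: exp_of_nat_mult exp_add) (simp add: algebra_simps power2_eq_square)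
  also have "\<dots> \<le> B * exp (a * X\<^sup>2 + a / 4 - a * \<bar>X - real n\<bar>)"
  proof -
    have "0 \<le> (\<bar>X - real n\<bar> - 1 / 2)\<^sup>2" by simp
    then have "\<bar>X - real n\<bar> - 1 / 4 \<le> (X - real n)\<^sup>2"
      by (simp add: power2_eq_square algebra_simps)
    then have "a * (\<bar>X - real n\<bar> - 1 / 4) \<le> a * (X - real n)\<^sup>2"
      using a by (intro mult_left_mono) auto
    then show ?thesis using B by (intro mult_left_mono) (auto simp: algebra_simps)
  qed
  also have "\<dots> = B * exp (a * X\<^sup>2) * exp (a / 4) * exp (- a * \<bar>X - real n\<bar>)"
    by (simp only: diff_conv_add_uminus exp_add mult.assoc mult_minus_left)
  finally show ?thesis .
qed

lemma exp_dist_nat_sum_le: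
  fixes b x :: real
  assumes "b > 0"
  shows "summable (\<lambda>n. exp (- b * \<bar>x - real n\<bar>))" "(\<Sum>n. exp (- b * \<bar>x - real n\<bar>)) \<le> exp_sum_bound b"
proof -
  have *: "(\<Sum>n<m. exp (- b * \<bar>x - real n\<bar>)) \<le> exp_sum_bound b" for m
  proof -
    have "(\<Sum>n<m. exp (- b * \<bar>x - real n\<bar>)) = (\<Sum>k\<in>int ` {..<m}. exp (- b * \<bar>x - real_of_int k\<bar>))"
      by (simp add: sum.reindex)
    also have "\<dots> \<le> exp_sum_bound b" by (rule exp_dist_int_sum_le) (use assms in auto)
    finally show ?thesis .
  qed
  show "summable (\<lambda>n. exp (- b * \<bar>x - real n\<bar>))"
    by (rule summableI_nonneg_bounded[OF _ *]) auto
  then show "(\<Sum>n. exp (- b * \<bar>x - real n\<bar>)) \<le> exp_sum_bound b"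
    using * by (intro suminf_le_const) auto
qed

lemma real_coeff_series_gaussian:
  fixes d :: "nat \<Rightarrow> real"
  assumes a: "a > 0" and B: "B \<ge> 0" and d: "\<And>n. \<bar>d n\<bar> \<le> B * exp (- a * (real n)\<^sup>2)"
  shows real_coeff_series_abs_summable: "summable (\<lambda>n. norm (complex_of_real (d n) * w ^ n))"
    and real_coeff_series_le: "norm w \<le> exp (2 * a * X) \<Longrightarrow>
          norm (real_coeff_series d w) \<le> B * exp (a / 4) * exp_sum_bound a * exp (a * X\<^sup>2)"
    and real_coeff_series_holomorphic: "real_coeff_series d holomorphic_on A"
proof -
  have sb: "summable (\<lambda>n. norm (complex_of_real (d n) * w ^ n)) \<and>
      (\<Sum>n. norm (complex_of_real (d n) * w ^ n)) \<le> B * exp (a / 4) * exp_sum_bound a * exp (a * X\<^sup>2)"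
    if "norm w \<le> exp (2 * a * X)" for w X
  proof -
    note t = gaussian_coeff_term_le[OF a B d that]
    have s: "summable (\<lambda>n. B * exp (a * X\<^sup>2) * exp (a / 4) * exp (- a * \<bar>X - real n\<bar>))"
      by (intro summable_mult exp_dist_nat_sum_le a)
    have s': "summable (\<lambda>n. norm (complex_of_real (d n) * w ^ n))"
      by (rule summable_comparison_test'[OF s]) (use t in auto)
    have "(\<Sum>n. norm (complex_of_real (d n) * w ^ n)) \<le> (\<Sum>n. B * exp (a * X\<^sup>2) * exp (a / 4) * exp (- a * \<bar>X - real n\<bar>))"
      by (rule suminf_le[OF t s' s])
    also have "\<dots> = B * exp (a * X\<^sup>2) * exp (a / 4) * (\<Sum>n. exp (- a * \<bar>X - real n\<bar>))"
      by (rule suminf_mult[OF exp_dist_nat_sum_le(1)[OF a]])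
    also have "\<dots> \<le> B * exp (a * X\<^sup>2) * exp (a / 4) * exp_sum_bound a"
      by (intro mult_left_mono exp_dist_nat_sum_le a) (use B in auto)
    finally show ?thesis using s' by (simp add: mult_ac)
  qed
  show sm: "summable (\<lambda>n. norm (complex_of_real (d n) * w ^ n))" for w
  proof (cases "w = 0")
    case True
    then show ?thesis using sb[of 0 0] by simp
  next
    case False
    then show ?thesis using sb[of w "ln (norm w) / (2 * a)"] a by simp
  qed
  show "norm (real_coeff_series d w) \<le> B * exp (a / 4) * exp_sum_bound a * exp (a * X\<^sup>2)"
    if "norm w \<le> exp (2 * a * X)"
    unfolding real_coeff_series_def using sb[OF that] summable_norm[OF sm, of w] by linarith
  have "real_coeff_series d holomorphic_on ball 0 r" for r
  proof (rule power_series_holomorphic)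
    fix w
    show "(\<lambda>n. complex_of_real (d n) * (w - 0) ^ n) sums real_coeff_series d w"
      unfolding real_coeff_series_def using summable_norm_cancel[OF sm[of w]] by (simp add: summable_sums)
  qed
  then have "real_coeff_series d field_differentiable (at w)" for w
    by (rule holomorphic_on_imp_differentiable_at[where s = "ball 0 (norm w + 1)"]) auto
  then have "real_coeff_series d holomorphic_on UNIV"
    by (auto simp: holomorphic_on_def)
  then show "real_coeff_series d holomorphic_on A" by (rule holomorphic_on_subset) auto
qed

text \<open>The Laurent series \<open>\<Sum>\<^sub>k c\<^sub>k exp (-ak\<^sup>2) w\<^sup>k\<close>; at \<open>w = exp (2ax)\<close> it equals \<open>exp (ax\<^sup>2) \<Sum>\<^sub>k c\<^sub>k exp (-a(x-k)\<^sup>2)\<close>.\<close>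
definition gaussian_laurent :: "real \<Rightarrow> (int \<Rightarrow> real) \<Rightarrow> complex \<Rightarrow> complex" where
  "gaussian_laurent a c w = real_coeff_series (\<lambda>n. c (int n) * exp (- a * (real n)\<^sup>2)) w +
     real_coeff_series (\<lambda>n. if n = 0 then 0 else c (- int n) * exp (- a * (real n)\<^sup>2)) (1 / w)"

context
  fixes a B :: real and c :: "int \<Rightarrow> real"
  assumes a: "a > 0" and c: "\<And>k. \<bar>c k\<bar> \<le> B"
begin

lemma gaussian_bound_nonneg: "B \<ge> 0" using c[of 0] by linarith

lemma gaussian_pos_coeff: "\<bar>c (int n) * exp (- a * (real n)\<^sup>2)\<bar> \<le> B * exp (- a * (real n)\<^sup>2)"
  using c[of "int n"] by (simp add: abs_mult)

lemma gaussian_neg_coeff: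
  "\<bar>if n = 0 then 0 else c (- int n) * exp (- a * (real n)\<^sup>2)\<bar> \<le> B * exp (- a * (real n)\<^sup>2)"
  using c[of "- int n"] gaussian_bound_nonneg by (simp add: abs_mult)

lemma gaussian_laurent_holomorphic: "gaussian_laurent a c holomorphic_on - {0}"
proof -
  let ?d = "\<lambda>n. if n = 0 then 0 else c (- int n) * exp (- a * (real n)\<^sup>2)"
  have "(real_coeff_series ?d \<circ> (\<lambda>w. 1 / w)) holomorphic_on - {0}"
    by (rule holomorphic_on_compose_gen[where t = UNIV])
       (auto intro!: holomorphic_intros real_coeff_series_holomorphic[OF a gaussian_bound_nonneg gaussian_neg_coeff])
  then show ?thesis unfolding gaussian_laurent_def o_def
    by (intro holomorphic_on_add real_coeff_series_holomorphic[OF a gaussian_bound_nonneg gaussian_pos_coeff])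
qed

text \<open>On either circle both \<open>norm w\<close> and \<open>norm (1 / w)\<close> are at most
  \<open>exp (2 * a * X)\<close>, so one growth estimate for power series bounds both
  halves.\<close>

lemma gaussian_laurent_le:
  assumes "X \<ge> 0" "norm w = exp (2 * a * X) \<or> norm w = exp (- 2 * a * X)"
  shows "norm (gaussian_laurent a c w) \<le> 2 * (B * exp (a / 4) * exp_sum_bound a) * exp (a * X\<^sup>2)"
proof -
  have *: "norm w \<le> exp (2 * a * X)" "norm (1 / w) \<le> exp (2 * a * X)"
  proof -
    have "0 \<le> a * X" using assms a by simp
    then have "exp (- 2 * a * X) \<le> exp (2 * a * X)" by (simp add: mult.commute)
    moreover have "1 / exp (2 * a * X) = exp (- 2 * a * X)" "1 / exp (- 2 * a * X) = exp (2 * a * X)"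
      by (simp_all add: exp_minus inverse_eq_divide)
    ultimately show "norm w \<le> exp (2 * a * X)" "norm (1 / w) \<le> exp (2 * a * X)"
      using assms(2) by (auto simp only: norm_divide norm_one)
  qed
  show ?thesis unfolding gaussian_laurent_def
    using norm_triangle_ineq[of "real_coeff_series (\<lambda>n. c (int n) * exp (- a * (real n)\<^sup>2)) w"
        "real_coeff_series (\<lambda>n. if n = 0 then 0 else c (- int n) * exp (- a * (real n)\<^sup>2)) (1 / w)"]
      real_coeff_series_le[OF a gaussian_bound_nonneg gaussian_pos_coeff *(1)]
      real_coeff_series_le[OF a gaussian_bound_nonneg gaussian_neg_coeff *(2)]
    by linarith
qed

text \<open>Expanding \<open>(x - k)\<^sup>2\<close> separates \<open>exp (- a * x\<^sup>2)\<close>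
  from a power of \<open>w\<close>. Indices \<open>k \<ge> 0\<close> come from the series in
  \<open>w\<close>, negative ones from the series in \<open>1 / w\<close>, whose zeroth coefficient
  is set to 0 lest \<open>k = 0\<close> be counted twice.\<close>

lemma gaussian_shift_sum_laurent:
  "((\<lambda>k. complex_of_real (c k * exp (- a * (x - of_int k)\<^sup>2))) has_sum
     complex_of_real (exp (- a * x\<^sup>2)) * gaussian_laurent a c (complex_of_real (exp (2 * a * x)))) UNIV"
proof -
  let ?w = "complex_of_real (exp (2 * a * x))"
  let ?d1 = "\<lambda>n. c (int n) * exp (- a * (real n)\<^sup>2)"
  let ?d2 = "\<lambda>n. if n = 0 then 0 else c (- int n) * exp (- a * (real n)\<^sup>2)"
  let ?f = "\<lambda>k. complex_of_real (c k * exp (- a * (x - of_int k)\<^sup>2))"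
  have hs: "((\<lambda>n. complex_of_real (d n) * w ^ n) has_sum real_coeff_series d w) UNIV"
    if "\<And>n. \<bar>d n\<bar> \<le> B * exp (- a * (real n)\<^sup>2)" for d w
    unfolding real_coeff_series_def
    using real_coeff_series_abs_summable[OF a gaussian_bound_nonneg that]
    by (intro norm_summable_imp_has_sum summable_sums) (auto intro: summable_norm_cancel)
  have e1: "complex_of_real (exp (- a * x\<^sup>2)) * (complex_of_real (?d1 n) * ?w ^ n) = ?f (int n)" for n
    by (simp flip: of_real_power of_real_mult exp_of_nat_mult)
       (simp add: mult_ac flip: exp_add, simp add: algebra_simps power2_eq_square)
  have e2: "complex_of_real (exp (- a * x\<^sup>2)) * (complex_of_real (?d2 n) * (1 / ?w) ^ n) = ?f (- int n)" if "n > 0" for n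
  proof -
    have w: "(1 / ?w) ^ n = complex_of_real (exp (real n * (- 2 * a * x)))"
      by (subst exp_of_nat_mult) (simp add: exp_minus field_simps)
    show ?thesis unfolding w using that
      by (simp flip: of_real_power of_real_mult exp_of_nat_mult)
         (simp add: mult_ac flip: exp_add, simp add: algebra_simps power2_eq_square)
  qed
  have "((\<lambda>n. complex_of_real (exp (- a * x\<^sup>2)) * (complex_of_real (?d1 n) * ?w ^ n)) has_sum
      complex_of_real (exp (- a * x\<^sup>2)) * real_coeff_series ?d1 ?w) UNIV"
    by (intro has_sum_cmult_right hs gaussian_pos_coeff)
  then have "((?f \<circ> int) has_sum complex_of_real (exp (- a * x\<^sup>2)) * real_coeff_series ?d1 ?w) UNIV"
    unfolding e1 o_def .
  then have h1: "(?f has_sum complex_of_real (exp (- a * x\<^sup>2)) * real_coeff_series ?d1 ?w) (range int)"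
    by (subst has_sum_reindex) auto
  have "((\<lambda>n. complex_of_real (exp (- a * x\<^sup>2)) * (complex_of_real (?d2 n) * (1 / ?w) ^ n)) has_sum
      complex_of_real (exp (- a * x\<^sup>2)) * real_coeff_series ?d2 (1 / ?w)) UNIV"
    by (intro has_sum_cmult_right hs gaussian_neg_coeff)
  then have "((?f \<circ> (\<lambda>n. - int n)) has_sum complex_of_real (exp (- a * x\<^sup>2)) * real_coeff_series ?d2 (1 / ?w)) {0<..}"
  proof (rule iffD2[OF has_sum_cong_neutral, rotated -1])
    fix n :: nat assume "n \<in> {0<..} \<inter> UNIV"
    then show "(?f \<circ> (\<lambda>n. - int n)) n =
        complex_of_real (exp (- a * x\<^sup>2)) * (complex_of_real (?d2 n) * (1 / ?w) ^ n)"
      unfolding o_def by (intro e2[symmetric]) simp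
  qed auto
  then have h2: "(?f has_sum complex_of_real (exp (- a * x\<^sup>2)) * real_coeff_series ?d2 (1 / ?w)) ((\<lambda>n. - int n) ` {0<..})"
    by (subst has_sum_reindex) (auto simp: inj_on_def)
  have "range int \<union> (\<lambda>n. - int n) ` {0<..} = UNIV"
  proof -
    have "k \<in> range int \<union> (\<lambda>n. - int n) ` {0<..}" for k
      by (cases "k \<ge> 0") (auto simp: image_iff intro: exI[of _ "nat k"] bexI[of _ "nat (-k)"] zero_le_imp_eq_int)
    then show ?thesis by blast
  qed
  moreover have "range int \<inter> (\<lambda>n. - int n) ` {0<..} = {}" by auto
  ultimately show ?thesis
    using has_sum_Un_disjoint[OF h1 h2] unfolding gaussian_laurent_def by (simp only: distrib_left)
qed

end

section \<open>Dividing out real zeros with multiplicity\<close>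

lemma taylor_order_tendsto_0:
  assumes d: "\<And>j x. (U j has_real_derivative U (Suc j) x) (at x)"
    and z: "\<And>i. i \<le> j \<Longrightarrow> U i s = (0::real)"
  shows "((\<lambda>x. U 0 x / (x - s) ^ j) \<longlongrightarrow> 0) (at s)"
proof -
  have "continuous_on {s - 1..s + 1} (U (Suc j))"
    using d by (meson DERIV_isCont continuous_at_imp_continuous_on)
  then have "bounded (U (Suc j) ` {s - 1..s + 1})"
    by (intro compact_imp_bounded compact_continuous_image) auto
  then obtain C where C: "\<And>t. t \<in> {s - 1..s + 1} \<Longrightarrow> \<bar>U (Suc j) t\<bar> \<le> C"
    unfolding bounded_iff by (auto simp del: atLeastAtMost_iff)
  have b: "\<bar>U 0 x / (x - s) ^ j\<bar> \<le> C * \<bar>x - s\<bar>" if x: "x \<noteq> s" "\<bar>x - s\<bar> < 1" for x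
  proof -
    have "\<exists>t. (if x < s then x < t \<and> t < s else s < t \<and> t < x) \<and>
      U 0 x = (\<Sum>m<Suc j. U m s / fact m * (x - s) ^ m) + U (Suc j) t / fact (Suc j) * (x - s) ^ Suc j"
      by (rule Taylor[where a = "s - 1" and b = "s + 1"]) (use d x in auto)
    then obtain t where t: "if x < s then x < t \<and> t < s else s < t \<and> t < x"
      "U 0 x = U (Suc j) t / fact (Suc j) * (x - s) ^ Suc j" using z by auto
    have tt: "\<bar>U (Suc j) t\<bar> \<le> C" using t(1) x by (intro C) (auto split: if_splits)
    have f1: "\<bar>U (Suc j) t / fact (Suc j)\<bar> \<le> C"
    proof -
      have "\<bar>U (Suc j) t / fact (Suc j)\<bar> \<le> \<bar>U (Suc j) t\<bar>"
        using fact_ge_1[of "Suc j", where 'a = real] by (simp add: abs_divide divide_le_eq mult_le_cancel_left1)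
      then show ?thesis using tt by linarith
    qed
    have "U 0 x / (x - s) ^ j = U (Suc j) t / fact (Suc j) * (x - s)"
      unfolding t(2) using x by (simp del: fact_Suc)
    then show ?thesis using f1 by (simp only: abs_mult mult_right_mono abs_ge_zero)
  qed
  show ?thesis
  proof (rule Lim_null_comparison)
    have "\<forall>\<^sub>F x in at s. x \<noteq> s \<and> \<bar>x - s\<bar> < 1"
      unfolding eventually_at by (rule exI[of _ 1]) (auto simp: dist_real_def)
    then show "\<forall>\<^sub>F x in at s. norm (U 0 x / (x - s) ^ j) \<le> C * \<bar>x - s\<bar>"
      by eventually_elim (use b in auto)
    have "((\<lambda>x. C * \<bar>x - s\<bar>) \<longlongrightarrow> C * \<bar>s - s\<bar>) (at s)" by (intro tendsto_intros)
    then show "((\<lambda>x. C * \<bar>x - s\<bar>) \<longlongrightarrow> 0) (at s)" by simp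
  qed
qed

text \<open>Multiplicity is known only for the real function \<open>U 0\<close>, while the factors
  belong to the holomorphic \<open>\<Theta>\<close>. If \<open>s = z k\<close> has been divided out
  \<open>j\<close> times already, then \<open>\<Theta> (W x) / (x - s) ^ j\<close> tends to 0
  because \<open>U 0\<close> vanishes to order \<open>j + 1\<close> at \<open>s\<close>, but its
  limit is also \<open>Q (W s)\<close> times a nonzero number. So the quotient \<open>Q\<close>
  vanishes at \<open>W s\<close> and one more factor splits off.\<close>

lemma zero_list_factor:
  fixes \<Theta> :: "complex \<Rightarrow> complex"
  assumes a: "a > 0" and hol: "\<Theta> holomorphic_on - {0}"
    and d: "\<And>j x. (U j has_real_derivative U (Suc j) x) (at x)"
    and U0: "\<And>x. complex_of_real (U 0 x) =
        complex_of_real (exp (- a * x\<^sup>2)) * \<Theta> (complex_of_real (exp (2 * a * x)))"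
    and zl: "zero_list U z N" and "k \<le> N"
  shows "\<exists>Q. Q holomorphic_on - {0} \<and>
    (\<forall>w. w \<noteq> 0 \<longrightarrow> \<Theta> w = Q w * (\<Prod>i<k. w - complex_of_real (exp (2 * a * z i))))"
  using \<open>k \<le> N\<close>
proof (induction k)
  case 0
  then show ?case using hol by auto
next
  case (Suc k)
  define W where "W x = complex_of_real (exp (2 * a * x))" for x
  have W0: "W x \<noteq> 0" for x by (simp add: W_def)
  obtain Q where Q: "Q holomorphic_on - {0}" "\<And>w. w \<noteq> 0 \<Longrightarrow> \<Theta> w = Q w * (\<Prod>i<k. w - W (z i))"
    using Suc unfolding W_def by auto
  define s where "s = z k"
  define i0 where "i0 = (LEAST i. z i = s)"
  have i0: "z i0 = s" unfolding i0_def by (rule LeastI[of _ k]) (simp add: s_def)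
  have i0k: "i0 \<le> k" unfolding i0_def by (rule Least_le) (simp add: s_def)
  have before: "z i \<noteq> s" if "i < i0" for i using not_less_Least[of i "\<lambda>i. z i = s"] that by (auto simp: i0_def)
  have zs: "z i = s" if "i0 \<le> i" "i \<le> k" for i
  proof -
    have "z i0 \<le> z i" "z i \<le> z k" using zl that Suc.prems unfolding zero_list_def by auto
    then show ?thesis using i0 by (simp add: s_def)
  qed
  define j where "j = k - i0"
  have Uz: "U m s = 0" if "m \<le> j" for m
  proof -
    have "i0 + m < N" "z i0 = z (i0 + m)" using zs[of "i0 + m"] that i0 i0k Suc.prems by (auto simp: j_def)
    then show ?thesis using zl i0 unfolding zero_list_def by auto
  qed
  have lim1: "((\<lambda>x. \<Theta> (W x) / complex_of_real ((x - s) ^ j)) \<longlongrightarrow> 0) (at s)"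
  proof -
    have "((\<lambda>x. complex_of_real (exp (a * x\<^sup>2)) * complex_of_real (U 0 x / (x - s) ^ j)) \<longlongrightarrow>
        complex_of_real (exp (a * s\<^sup>2)) * complex_of_real 0) (at s)"
      by (intro tendsto_intros taylor_order_tendsto_0 d Uz)
    moreover have "complex_of_real (exp (a * x\<^sup>2)) * complex_of_real (U 0 x / (x - s) ^ j) = \<Theta> (W x) / complex_of_real ((x - s) ^ j)" for x
    proof -
      have "complex_of_real (exp (a * x\<^sup>2)) * complex_of_real (U 0 x) = complex_of_real (exp (a * x\<^sup>2) * exp (- a * x\<^sup>2)) * \<Theta> (W x)"
        by (simp only: U0 W_def of_real_mult mult.assoc)
      also have "exp (a * x\<^sup>2) * exp (- a * x\<^sup>2) = 1" by (simp flip: exp_add)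
      finally show ?thesis by simp
    qed
    ultimately show ?thesis by (simp only: of_real_0 mult_zero_right)
  qed
  have contW: "isCont W s" unfolding W_def by (intro continuous_intros)
  have "isCont Q (W s)"
    by (intro field_differentiable_imp_continuous_at holomorphic_on_imp_differentiable_at[OF Q(1)]) (use W0 in auto)
  then have QW: "((\<lambda>x. Q (W x)) \<longlongrightarrow> Q (W s)) (at s)"
    using contW isCont_o2 isCont_def by blast
  \<comment> \<open>\<open>W\<close> has nonzero derivative, so orders of vanishing in
    \<open>x\<close> and in \<open>w\<close> agree.\<close>
  have dW: "((\<lambda>x. (W x - W s) / complex_of_real (x - s)) \<longlongrightarrow> complex_of_real (2 * a * exp (2 * a * s))) (at s)"
  proof -
    have "((\<lambda>x. exp (2 * a * x)) has_real_derivative (2 * a * exp (2 * a * s))) (at s)"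
      by (auto intro!: derivative_eq_intros)
    then have "((\<lambda>x. (exp (2 * a * x) - exp (2 * a * s)) / (x - s)) \<longlongrightarrow> 2 * a * exp (2 * a * s)) (at s)"
      by (simp add: has_field_derivative_iff)
    then have "((\<lambda>x. complex_of_real ((exp (2 * a * x) - exp (2 * a * s)) / (x - s))) \<longlongrightarrow> complex_of_real (2 * a * exp (2 * a * s))) (at s)"
      by (intro tendsto_intros)
    then show ?thesis by (simp add: W_def)
  qed
  have lim2: "((\<lambda>x. Q (W x) * (\<Prod>i<i0. W x - W (z i)) * ((W x - W s) / complex_of_real (x - s)) ^ j) \<longlongrightarrow>
      Q (W s) * (\<Prod>i<i0. W s - W (z i)) * complex_of_real (2 * a * exp (2 * a * s)) ^ j) (at s)"
    using contW by (intro tendsto_intros QW dW) (auto simp: isCont_def)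
  have "\<forall>\<^sub>F x in at s. Q (W x) * (\<Prod>i<i0. W x - W (z i)) * ((W x - W s) / complex_of_real (x - s)) ^ j
      = \<Theta> (W x) / complex_of_real ((x - s) ^ j)"
  proof (unfold eventually_at_filter, rule always_eventually, intro allI impI)
    fix x assume "x \<noteq> s"
    have "(\<Prod>i<k. W x - W (z i)) = (\<Prod>i<i0. W x - W (z i)) * (\<Prod>i=i0..<k. W x - W (z i))"
      using i0k prod.atLeastLessThan_concat[of 0 i0 k "\<lambda>i. W x - W (z i)"] by (simp add: atLeast0LessThan)
    also have "(\<Prod>i=i0..<k. W x - W (z i)) = (\<Prod>i=i0..<k. W x - W s)"
      by (intro prod.cong refl) (simp add: zs)
    also have "\<dots> = (W x - W s) ^ j" by (simp add: j_def)
    finally show "Q (W x) * (\<Prod>i<i0. W x - W (z i)) * ((W x - W s) / complex_of_real (x - s)) ^ j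
      = \<Theta> (W x) / complex_of_real ((x - s) ^ j)"
      using Q(2)[OF W0[of x]] by (simp add: power_divide)
  qed
  then have "((\<lambda>x. Q (W x) * (\<Prod>i<i0. W x - W (z i)) * ((W x - W s) / complex_of_real (x - s)) ^ j) \<longlongrightarrow> 0) (at s)"
    using lim1 by (rule iffD2[OF tendsto_cong])
  then have "Q (W s) * (\<Prod>i<i0. W s - W (z i)) * complex_of_real (2 * a * exp (2 * a * s)) ^ j = 0"
    by (intro tendsto_unique[OF _ lim2]) auto
  moreover have "(\<Prod>i<i0. W s - W (z i)) \<noteq> 0"
    using before a by (force simp: W_def prod_zero_iff)
  ultimately have Qs: "Q (W s) = 0" using a by auto
  \<comment> \<open>The difference quotient with its removable singularity filled in.\<close>
  define Q' where "Q' = (\<lambda>w. if w = W s then deriv Q (W s) else (Q w - Q (W s)) / (w - W s))"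
  have "Q' holomorphic_on - {0}" unfolding Q'_def by (rule pole_lemma_open[OF Q(1)]) auto
  moreover have "\<Theta> w = Q' w * (\<Prod>i<Suc k. w - W (z i))" if "w \<noteq> 0" for w
    using Q(2)[OF that] Qs by (simp add: Q'_def s_def)
  ultimately show ?case unfolding W_def by blast
qed

lemma sum_div_blocks:
  assumes "N > 0"
  shows "(\<Sum>i<q * N. real (i div N)) = real N * real q * (real q - 1) / 2"
proof (induction q)
  case (Suc q)
  have "(\<Sum>i<Suc q * N. real (i div N)) = (\<Sum>i<q * N. real (i div N)) + (\<Sum>i=q*N..<q*N+N. real (i div N))"
    using sum.atLeastLessThan_concat[of 0 "q * N" "q * N + N" "\<lambda>i. real (i div N)"]
    by (simp add: atLeast0LessThan add.commute)
  also have "(\<Sum>i=q*N..<q*N+N. real (i div N)) = (\<Sum>i=q*N..<q*N+N. real q)"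
    by (intro sum.cong refl arg_cong[where f = real] div_nat_eqI) (auto simp: algebra_simps)
  finally show ?case using Suc by (simp add: field_simps)
qed auto

section \<open>Growth against zeros on large annuli\<close>

lemma maximum_modulus_annulus:
  fixes f :: "complex \<Rightarrow> complex"
  assumes hol: "f holomorphic_on - {0}" and r: "0 < r" "r \<le> norm w" "norm w \<le> R"
    and le: "\<And>v. norm v = r \<or> norm v = R \<Longrightarrow> norm (f v) \<le> C"
  shows "norm (f w) \<le> C"
proof -
  define S where "S = cball 0 R - ball (0::complex) r"
  have cl: "closed S" unfolding S_def by (intro closed_Diff) auto
  have sub: "S \<subseteq> - {0}" using r by (auto simp: S_def)
  show ?thesis
  proof (rule maximum_modulus_frontier[where S = S and f = f and \<xi> = w])
    show "f holomorphic_on interior S"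
      by (rule holomorphic_on_subset[OF hol order_trans[OF interior_subset sub]])
    show "continuous_on (closure S) f"
      unfolding closure_closed[OF cl]
      by (rule continuous_on_subset[OF holomorphic_on_imp_continuous_on[OF hol] sub])
    show "bounded S" unfolding S_def by (intro bounded_diff) auto
    show "w \<in> S" using r by (auto simp: S_def)
    fix v assume v: "v \<in> frontier S"
    have "ball 0 R - cball 0 r \<subseteq> interior S"
      by (rule interior_maximal) (auto simp: S_def)
    then have "v \<in> S" "v \<notin> ball 0 R - cball 0 r" using v cl by (auto simp: frontier_def)
    then show "norm (f v) \<le> C" by (intro le) (auto simp: S_def)
  qed
qed

text \<open>The coefficient of \<open>q\<^sup>2\<close> in the exponent is
  \<open>a * L\<^sup>2 - a * L * N\<close>, which \<open>L < N\<close> makes negative;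
  \<open>H ^ (2 * (q * N))\<close> contributes only a term linear in \<open>q\<close>.\<close>

lemma laurent_estimate_tendsto_0:
  fixes a L H :: real
  assumes "a > 0" "0 < L" "L < real N" "H > 0"
  shows "(\<lambda>q. C * H ^ (2 * (q * N)) * exp (a * ((real q + 1) * L)\<^sup>2 - a * L * real N * real q * (real q + 1))) \<longlonglongrightarrow> 0"
proof -
  define \<alpha> \<beta> where "\<alpha> = a * L * (real N - L)" and "\<beta> = 2 * real N * ln H + 2 * a * L\<^sup>2 - a * L * real N"
  have \<alpha>: "\<alpha> > 0" using assms by (simp add: \<alpha>_def)
  have "(\<lambda>q. C * exp (a * L\<^sup>2) * exp (\<beta> * real q - \<alpha> * (real q)\<^sup>2)) \<longlonglongrightarrow> 0"
    using \<alpha> by real_asymp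
  moreover have "C * exp (a * L\<^sup>2) * exp (\<beta> * real q - \<alpha> * (real q)\<^sup>2) =
    C * H ^ (2 * (q * N)) * exp (a * ((real q + 1) * L)\<^sup>2 - a * L * real N * real q * (real q + 1))" for q
  proof -
    have "H ^ (2 * (q * N)) = exp (real (2 * (q * N)) * ln H)"
      using assms by (simp only: exp_of_nat_mult exp_ln)
    then show ?thesis
      by (simp add: mult.assoc flip: exp_add) (simp add: \<alpha>_def \<beta>_def algebra_simps power2_eq_square)
  qed
  ultimately show ?thesis by simp
qed

lemma exp_minus_one_ge:
  fixes y y0 :: real
  assumes "y0 \<le> t" "t \<le> y"
  shows "(1 - exp (- y0)) * exp t \<le> exp y - 1"
proof -
  have "exp (t - y0) \<ge> 1" using assms by simp
  then have "(1 - exp (- y0)) * exp t \<le> exp t - 1"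
    by (simp add: left_diff_distrib flip: exp_add)
  then show ?thesis using assms(2) by (smt (verit) exp_le_cancel_iff)
qed

text \<open>A Jensen-type argument. A zero at \<open>W\<close> with \<open>norm W < 1\<close> enters
  through \<open>(v - W) / v\<close>, the others through \<open>(v - W) / W\<close>. On the outer
  circle factors of the first kind are bounded below and those of the second are large; on the inner
  circle the roles are exchanged, and the full product has the same lower bound on both. Dividing by
  it and applying the maximum principle leaves at the fixed \<open>w\<close> a bound that tends to 0
  with \<open>q\<close>.\<close>

lemma gaussian_laurent_eq_0:
  assumes a: "a > 0" and c: "\<And>k. \<bar>c k\<bar> \<le> B"
    and d: "\<And>j x. (U j has_real_derivative U (Suc j) x) (at x)"
    and U0: "\<And>x. complex_of_real (U 0 x) =
        complex_of_real (exp (- a * x\<^sup>2)) * gaussian_laurent a c (complex_of_real (exp (2 * a * x)))"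
    and dense: "dense_zeros U" and w: "w \<noteq> 0"
  shows "gaussian_laurent a c w = 0"
proof -
  obtain L N where LN: "0 < L" "L < real N"
      "\<And>x. \<exists>z. zero_list U z N \<and> (\<forall>i<N. z i \<in> {x..<x + L})"
    using dense unfolding dense_zeros_def by blast
  have N: "N > 0" using LN by (cases N) auto
  \<comment> \<open>The logarithms of the moduli of the zeros stay \<open>2 * a * L\<close> away
    from those of the two radii, so each normalised factor is at least \<open>\<kappa>\<close> times
    its main term.\<close>
  define \<kappa> where "\<kappa> = 1 - exp (- (2 * a * L))"
  have \<kappa>: "0 < \<kappa>" "\<kappa> < 1" using a LN by (auto simp: \<kappa>_def)
  \<comment> \<open>Dominates both \<open>1 + norm w\<close> and \<open>1 + 1 / norm w\<close>,
    hence every normalised factor at \<open>w\<close>.\<close>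
  define H where "H = (1 + norm w) * (1 + 1 / norm w)"
  have H0: "norm w > 0" using w by simp
  have "H = 2 + norm w + 1 / norm w" using H0 by (simp add: H_def field_simps)
  moreover have "1 / norm w > 0" using H0 by simp
  ultimately have H: "1 + norm w \<le> H" "1 + 1 / norm w \<le> H" "H > 0"
    using H0 by linarith+
  define B' where "B' = 2 * (B * exp (a / 4) * exp_sum_bound a)"
  have bound: "norm (gaussian_laurent a c w) \<le> B' * (H / \<kappa>) ^ (2 * (q * N)) *
      exp (a * ((real q + 1) * L)\<^sup>2 - a * L * real N * real q * (real q + 1))"
    if q: "exp (- 2 * a * ((real q + 1) * L)) \<le> norm w" "norm w \<le> exp (2 * a * ((real q + 1) * L))" for q
  proof -
    \<comment> \<open>The zeros used lie between \<open>- q * L\<close> and \<open>q * L\<close>;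
      the extra length \<open>L\<close> separates them from both circles.\<close>
    define X where "X = (real q + 1) * L"
    have X0: "X \<ge> L" using LN by (simp add: X_def algebra_simps)
    obtain z where z: "\<And>K. zero_list U z K"
        "\<And>i. z i \<in> {- (real q * L) + real (i div N) * L..<- (real q * L) + real (i div N + 1) * L}"
      using zero_list_concat[OF N LN(1,3), of "- (real q * L)"] by blast
    define W where "W i = complex_of_real (exp (2 * a * z i))" for i
    have W0: "W i \<noteq> 0" "norm (W i) = exp (2 * a * z i)" for i by (auto simp: W_def)
    obtain Q where Q: "Q holomorphic_on - {0}"
        "\<And>v. v \<noteq> 0 \<Longrightarrow> gaussian_laurent a c v = Q v * (\<Prod>i<q * N + q * N. v - W i)"
      using zero_list_factor[OF a gaussian_laurent_holomorphic[OF a c] d U0 z(1) order_refl, of "q * N + q * N"]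
      unfolding W_def by blast
    define f1 where "f1 v = (\<Prod>i<q * N. (v - W i) / v)" for v
    define f2 where "f2 v = (\<Prod>i<q * N. (v - W (q * N + i)) / W (q * N + i))" for v
    \<comment> \<open>\<open>R\<close> is the Laurent function divided by \<open>f1\<close> and
      \<open>f2\<close>; the power of \<open>v\<close> and the product of the \<open>W\<close> undo
      the two normalisations.\<close>
    define R where "R v = Q v * v ^ (q * N) * (\<Prod>i<q * N. W (q * N + i))" for v
    have Rhol: "R holomorphic_on - {0}" unfolding R_def by (intro holomorphic_intros Q)
    have fact: "gaussian_laurent a c v = R v * f1 v * f2 v" if "v \<noteq> 0" for v
    proof -
      have "(\<Prod>i<q * N + q * N. v - W i) = (\<Prod>i<q * N. v - W i) * (\<Prod>i<q * N. v - W (q * N + i))"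
        using prod.nat_group[of "\<lambda>i. v - W i" "q * N" 2] prod.shift_bounds_nat_ivl[of "\<lambda>i. v - W i" 0 "q * N" "q * N"]
          prod.atLeastLessThan_concat[of 0 "q * N" "q * N + q * N" "\<lambda>i. v - W i"]
        by (simp add: atLeast0LessThan add.commute)
      also have "(\<Prod>i<q * N. v - W i) = f1 v * v ^ (q * N)"
        using that by (simp add: f1_def prod_dividef)
      also have "(\<Prod>i<q * N. v - W (q * N + i)) = f2 v * (\<Prod>i<q * N. W (q * N + i))"
        using W0 by (simp add: f2_def prod_dividef)
      finally show ?thesis unfolding Q(2)[OF that] R_def by (simp add: mult_ac)
    qed
    have zneg: "z i < 0" if "i < q * N" for i
    proof -
      have "i div N < q" using that N by (simp add: less_mult_imp_div_less)
      then have "real (i div N + 1) * L \<le> real q * L" using LN by (intro mult_right_mono) auto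
      then show ?thesis using z(2)[of i] by auto
    qed
    have zpos: "real (i div N) * L \<le> z (q * N + i)" "z (q * N + i) < real (i div N + 1) * L" for i
      using z(2)[of "q * N + i"] N by (auto simp: algebra_simps)
    \<comment> \<open>Total main exponent of the large factors, first on the inner, then on the
      outer circle; the two totals agree.\<close>
    have sum1: "(\<Sum>i<q * N. 2 * a * L * (real (i div N) + 1)) = a * L * real N * real q * (real q + 1)"
      by (simp add: sum.distrib sum_div_blocks[OF N] flip: sum_distrib_left) (simp add: field_simps)
    have sum2: "(\<Sum>i<q * N. 2 * a * L * (real q - real (i div N))) = a * L * real N * real q * (real q + 1)"
      by (simp add: sum_subtractf sum_div_blocks[OF N] flip: sum_distrib_left) (simp add: field_simps)
    let ?E = "exp (a * L * real N * real q * (real q + 1))"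
    have prodge: "\<kappa> ^ (q * N) * exp (\<Sum>i<q * N. e i) \<le> norm (\<Prod>i<q * N. h i)"
      if "\<And>i. i < q * N \<Longrightarrow> \<kappa> * exp (e i) \<le> norm (h i)" for e :: "nat \<Rightarrow> real" and h :: "nat \<Rightarrow> complex"
    proof -
      have "\<kappa> ^ (q * N) * exp (\<Sum>i<q * N. e i) = (\<Prod>i<q * N. \<kappa> * exp (e i))"
        by (simp add: prod.distrib exp_sum)
      also have "\<dots> \<le> (\<Prod>i<q * N. norm (h i))" using that \<kappa> by (intro prod_mono) auto
      finally show ?thesis by (simp add: prod_norm)
    qed
    have small: "\<kappa> * exp 0 \<le> 1 - exp y" if "y \<le> - (2 * a * L)" for y
      using that by (simp add: \<kappa>_def)
    have big: "\<kappa> * exp t \<le> exp y - 1" if "2 * a * L \<le> t" "t \<le> y" for t y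
      using exp_minus_one_ge[OF that] by (simp add: \<kappa>_def)
    have mul: "2 * a * s \<le> 2 * a * t" if "s \<le> t" for s t using that a by simp
    have circ: "\<kappa> ^ (2 * (q * N)) * ?E \<le> norm (f1 v) * norm (f2 v)"
      if v: "norm v = exp (2 * a * X) \<or> norm v = exp (- 2 * a * X)" for v
    proof -
      have v0: "v \<noteq> 0" using v by auto
      have low1: "\<bar>1 - norm (W i) / norm v\<bar> \<le> norm ((v - W i) / v)" for i
      proof -
        have "\<bar>norm v - norm (W i)\<bar> \<le> norm (v - W i)" by (rule norm_triangle_ineq3)
        then have "\<bar>norm v - norm (W i)\<bar> / norm v \<le> norm ((v - W i) / v)"
          by (simp add: norm_divide divide_right_mono)
        moreover have "1 - norm (W i) / norm v = (norm v - norm (W i)) / norm v" using v0 by (simp add: field_simps)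
        ultimately show ?thesis by (simp add: abs_divide)
      qed
      have low2: "\<bar>norm v / norm (W i) - 1\<bar> \<le> norm ((v - W i) / W i)" for i
      proof -
        have "\<bar>norm v - norm (W i)\<bar> \<le> norm (v - W i)" by (rule norm_triangle_ineq3)
        then have "\<bar>norm v - norm (W i)\<bar> / norm (W i) \<le> norm ((v - W i) / W i)"
          by (simp add: norm_divide divide_right_mono)
        moreover have "norm v / norm (W i) - 1 = (norm v - norm (W i)) / norm (W i)" using W0 by (simp add: field_simps)
        ultimately show ?thesis by (simp add: abs_divide)
      qed
      have comb: "\<kappa> ^ (2 * (q * N)) * ?E \<le> norm (f1 v) * norm (f2 v)"
        if "\<kappa> ^ (q * N) * exp A1 \<le> norm (f1 v)" "\<kappa> ^ (q * N) * exp A2 \<le> norm (f2 v)"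
          "A1 + A2 = a * L * real N * real q * (real q + 1)" for A1 A2
      proof -
        have "\<kappa> ^ (2 * (q * N)) * ?E = (\<kappa> ^ (q * N) * exp A1) * (\<kappa> ^ (q * N) * exp A2)"
          unfolding that(3)[symmetric] by (simp only: mult_2 power_add exp_add) (simp only: mult_ac)
        also have "\<dots> \<le> norm (f1 v) * norm (f2 v)" using that \<kappa> by (intro mult_mono) auto
        finally show ?thesis .
      qed
      from v show ?thesis
      proof
        assume v: "norm v = exp (2 * a * X)"
        show ?thesis
        proof (rule comb)
          show "\<kappa> ^ (q * N) * exp (\<Sum>i<q * N. 0) \<le> norm (f1 v)"
            unfolding f1_def
          proof (rule prodge)
            fix i assume "i < q * N"
            then have "2 * a * z i - 2 * a * X \<le> - (2 * a * L)"
              using zneg[of i] mul[of L "X - z i"] X0 by (simp add: algebra_simps)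
            from small[OF this] have "\<kappa> * exp 0 \<le> 1 - norm (W i) / norm v"
              by (simp only: exp_diff W0 v)
            then show "\<kappa> * exp 0 \<le> norm ((v - W i) / v)" using low1[of i] by linarith
          qed
          show "\<kappa> ^ (q * N) * exp (\<Sum>i<q * N. 2 * a * L * (real q - real (i div N))) \<le> norm (f2 v)"
            unfolding f2_def
          proof (rule prodge)
            fix i assume i: "i < q * N"
            have "real (i div N) + 1 \<le> real q"
              using less_mult_imp_div_less[OF i] by linarith
            then have 1: "2 * a * L \<le> 2 * a * L * (real q - real (i div N))"
              using mult_left_mono[of 1 "real q - real (i div N)" "2 * a * L"] a LN by simp
            have 2: "2 * a * L * (real q - real (i div N)) \<le> 2 * a * X - 2 * a * z (q * N + i)"
              using mul[of "L * (real q - real (i div N))" "X - z (q * N + i)"] zpos[of i]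
              by (simp add: X_def algebra_simps)
            from big[OF 1 2] have "\<kappa> * exp (2 * a * L * (real q - real (i div N))) \<le> norm v / norm (W (q * N + i)) - 1"
              by (simp only: exp_diff W0 v)
            then show "\<kappa> * exp (2 * a * L * (real q - real (i div N))) \<le> norm ((v - W (q * N + i)) / W (q * N + i))"
              using low2[of "q * N + i"] by linarith
          qed
        qed (simp only: sum2 sum.neutral_const add_0)
      next
        assume v: "norm v = exp (- 2 * a * X)"
        show ?thesis
        proof (rule comb)
          show "\<kappa> ^ (q * N) * exp (\<Sum>i<q * N. 2 * a * L * (real (i div N) + 1)) \<le> norm (f1 v)"
            unfolding f1_def
          proof (rule prodge)
            fix i assume i: "i < q * N"
            have 1: "2 * a * L \<le> 2 * a * L * (real (i div N) + 1)"
              using mult_left_mono[of 1 "real (i div N) + 1" "2 * a * L"] a LN by simp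
            have 2: "2 * a * L * (real (i div N) + 1) \<le> 2 * a * z i - (- 2 * a * X)"
              using mul[of "L * (real (i div N) + 1)" "X + z i"] z(2)[of i]
              by (simp add: X_def algebra_simps)
            from big[OF 1 2] have "\<kappa> * exp (2 * a * L * (real (i div N) + 1)) \<le> norm (W i) / norm v - 1"
              by (simp only: exp_diff W0 v)
            then show "\<kappa> * exp (2 * a * L * (real (i div N) + 1)) \<le> norm ((v - W i) / v)"
              using low1[of i] by linarith
          qed
          show "\<kappa> ^ (q * N) * exp (\<Sum>i<q * N. 0) \<le> norm (f2 v)"
            unfolding f2_def
          proof (rule prodge)
            fix i assume "i < q * N"
            have "0 \<le> z (q * N + i)" using zpos(1)[of i] LN(1) by (auto intro: order_trans[rotated])
            then have "- 2 * a * X - 2 * a * z (q * N + i) \<le> - (2 * a * L)"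
              using mul[of L "X + z (q * N + i)"] X0 by (simp add: algebra_simps)
            from small[OF this] have "\<kappa> * exp 0 \<le> 1 - norm v / norm (W (q * N + i))"
              by (simp only: exp_diff W0 v)
            then show "\<kappa> * exp 0 \<le> norm ((v - W (q * N + i)) / W (q * N + i))"
              using low2[of "q * N + i"] by linarith
          qed
        qed (simp only: sum1 sum.neutral_const add_0_right)
      qed
    qed
    define M where "M = B' * exp (a * X\<^sup>2) / (\<kappa> ^ (2 * (q * N)) * ?E)"
    have Rw: "norm (R w) \<le> M"
    proof (rule maximum_modulus_annulus[OF Rhol])
      show "0 < exp (- 2 * a * X)" by simp
      show "exp (- 2 * a * X) \<le> norm w" "norm w \<le> exp (2 * a * X)" using q by (simp_all add: X_def)
      fix v :: complex assume "norm v = exp (- 2 * a * X) \<or> norm v = exp (2 * a * X)"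
      then have v: "norm v = exp (2 * a * X) \<or> norm v = exp (- 2 * a * X)" by blast
      then have "v \<noteq> 0" by auto
      have "norm (R v) * (\<kappa> ^ (2 * (q * N)) * ?E) \<le> norm (R v) * (norm (f1 v) * norm (f2 v))"
        by (intro mult_left_mono circ v) auto
      also have "\<dots> = norm (gaussian_laurent a c v)"
        unfolding fact[OF \<open>v \<noteq> 0\<close>] by (simp add: norm_mult)
      also have "\<dots> \<le> B' * exp (a * X\<^sup>2)"
        unfolding B'_def by (rule gaussian_laurent_le[OF a c _ v]) (use X0 LN in auto)
      finally show "norm (R v) \<le> M" unfolding M_def using \<kappa> by (simp add: pos_le_divide_eq)
    qed
    have f1w: "norm (f1 w) \<le> H ^ (q * N)"
    proof -
      have "norm ((w - W i) / w) \<le> H" if "i < q * N" for i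
      proof -
        have "2 * a * z i \<le> 0" using zneg[OF that] a by (simp add: mult_nonneg_nonpos)
        then have "norm (W i) \<le> 1" unfolding W0 by simp
        then have "norm (w - W i) \<le> norm w + 1" using norm_triangle_ineq4[of w "W i"] by linarith
        then have "norm ((w - W i) / w) \<le> (norm w + 1) / norm w"
          by (simp add: norm_divide divide_right_mono)
        also have "\<dots> = 1 + 1 / norm w" using H0 by (simp add: field_simps)
        finally show ?thesis using H by linarith
      qed
      then have "(\<Prod>i<q * N. norm ((w - W i) / w)) \<le> (\<Prod>i<q * N. H)" by (intro prod_mono) auto
      then show ?thesis by (simp add: f1_def flip: prod_norm)
    qed
    have f2w: "norm (f2 w) \<le> H ^ (q * N)"
    proof -
      have "norm ((w - W (q * N + i)) / W (q * N + i)) \<le> H" for i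
      proof -
        have "0 \<le> z (q * N + i)" using zpos(1)[of i] LN(1) by (auto intro: order_trans[rotated])
        then have W1: "norm (W (q * N + i)) \<ge> 1" unfolding W0 using a by simp
        have "norm ((w - W (q * N + i)) / W (q * N + i)) \<le> (norm w + norm (W (q * N + i))) / norm (W (q * N + i))"
          unfolding norm_divide by (intro divide_right_mono norm_triangle_ineq4) auto
        also have "\<dots> = norm w / norm (W (q * N + i)) + 1" using W0(1) by (simp add: add_divide_distrib)
        also have "norm w / norm (W (q * N + i)) \<le> norm w / 1"
          using W1 by (intro divide_left_mono) auto
        finally show ?thesis using H by simp
      qed
      then have "(\<Prod>i<q * N. norm ((w - W (q * N + i)) / W (q * N + i))) \<le> (\<Prod>i<q * N. H)" by (intro prod_mono) auto
      then show ?thesis by (simp add: f2_def flip: prod_norm)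
    qed
    have "norm (gaussian_laurent a c w) = norm (R w) * norm (f1 w) * norm (f2 w)"
      unfolding fact[OF w] by (simp add: norm_mult)
    also have "\<dots> \<le> M * H ^ (q * N) * H ^ (q * N)"
      by (intro mult_mono Rw f1w f2w) (use H order_trans[OF norm_ge_zero Rw] in auto)
    also have "\<dots> = B' * (H / \<kappa>) ^ (2 * (q * N)) * exp (a * X\<^sup>2 - a * L * real N * real q * (real q + 1))"
      by (simp add: M_def exp_diff power_divide mult_2 power_add)
    finally show ?thesis by (simp only: X_def)
  qed
  have "\<forall>\<^sub>F q in sequentially. norm (gaussian_laurent a c w) \<le> B' * (H / \<kappa>) ^ (2 * (q * N)) *
      exp (a * ((real q + 1) * L)\<^sup>2 - a * L * real N * real q * (real q + 1))"
  proof -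
    have "(\<lambda>q. exp (- 2 * a * ((real q + 1) * L))) \<longlonglongrightarrow> 0" using a LN by real_asymp
    then have 1: "\<forall>\<^sub>F q in sequentially. exp (- 2 * a * ((real q + 1) * L)) < norm w"
      using H0 by (rule order_tendstoD)
    have "filterlim (\<lambda>q. exp (2 * a * ((real q + 1) * L))) at_top sequentially" using a LN by real_asymp
    then have 2: "\<forall>\<^sub>F q in sequentially. norm w \<le> exp (2 * a * ((real q + 1) * L))"
      by (auto simp: filterlim_at_top)
    from 1 2 show ?thesis by eventually_elim (rule bound, auto)
  qed
  moreover have "(\<lambda>q. B' * (H / \<kappa>) ^ (2 * (q * N)) *
      exp (a * ((real q + 1) * L)\<^sup>2 - a * L * real N * real q * (real q + 1))) \<longlonglongrightarrow> 0"
    by (rule laurent_estimate_tendsto_0) (use a LN H \<kappa> in auto)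
  ultimately have "norm (gaussian_laurent a c w) \<le> 0"
    by (intro tendsto_lowerbound[where F = sequentially]) auto
  then show ?thesis by simp
qed

text \<open>The part with powers \<open>n \<ge> 0\<close> is entire and equals minus the part in
  \<open>1 / w\<close>, which tends to its zeroth coefficient 0 at infinity, so Liouville's theorem
  applies. The coefficient at 0 suffices, since translation by integers brings any other index
  there.\<close>

lemma gaussian_laurent_zero_coeff:
  assumes a: "a > 0" and c: "\<And>k. \<bar>c k\<bar> \<le> B" and z: "\<And>w. w \<noteq> 0 \<Longrightarrow> gaussian_laurent a c w = 0"
  shows "c 0 = 0"
proof -
  let ?d1 = "\<lambda>n. c (int n) * exp (- a * (real n)\<^sup>2)"
  let ?d2 = "\<lambda>n. if n = 0 then 0 else c (- int n) * exp (- a * (real n)\<^sup>2)"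
  note b = gaussian_bound_nonneg[OF a c]
  have h1: "real_coeff_series ?d1 holomorphic_on UNIV"
    by (rule real_coeff_series_holomorphic[OF a b gaussian_pos_coeff[OF a c]])
  have h2: "real_coeff_series ?d2 holomorphic_on UNIV"
    by (rule real_coeff_series_holomorphic[OF a b gaussian_neg_coeff[OF a c]])
  have at0: "real_coeff_series d 0 = complex_of_real (d 0)" for d
    unfolding real_coeff_series_def by (subst suminf_finite[of "{0}"]) auto
  have "isCont (real_coeff_series ?d2) 0"
    by (intro field_differentiable_imp_continuous_at holomorphic_on_imp_differentiable_at[OF h2]) auto
  then have "((\<lambda>w. - real_coeff_series ?d2 (inverse w)) \<longlongrightarrow> - real_coeff_series ?d2 0) at_infinity"
    by (intro tendsto_minus isCont_tendsto_compose[OF _ tendsto_inverse_0])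
  moreover have "\<forall>\<^sub>F w in at_infinity. - real_coeff_series ?d2 (inverse w) = real_coeff_series ?d1 w"
  proof -
    have "- real_coeff_series ?d2 (inverse w) = real_coeff_series ?d1 w" if "norm w \<ge> 1" for w
    proof -
      have "w \<noteq> 0" using that by auto
      from z[OF this] have "real_coeff_series ?d2 (inverse w) + real_coeff_series ?d1 w = 0"
        by (simp only: gaussian_laurent_def inverse_eq_divide add.commute)
      then show ?thesis by (rule minus_unique)
    qed
    then show ?thesis unfolding eventually_at_infinity by blast
  qed
  ultimately have "(real_coeff_series ?d1 \<longlongrightarrow> - real_coeff_series ?d2 0) at_infinity"
    by (rule Lim_transform_eventually)
  then have "(real_coeff_series ?d1 \<longlongrightarrow> 0) at_infinity"
    by (simp add: at0)
  then have "real_coeff_series ?d1 0 = 0" by (rule Liouville_weak_0[OF h1])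
  then show ?thesis by (simp add: at0)
qed

section \<open>Shift sums of exponentially decaying functions\<close>

definition shift_sum :: "(real \<Rightarrow> complex) \<Rightarrow> (int \<Rightarrow> complex) \<Rightarrow> real \<Rightarrow> complex" where
  "shift_sum h c x = (\<Sum>\<^sub>\<infinity>k. c k * h (x - of_int k))"

lemma shift_term_le:
  assumes "\<And>x. norm (h x) \<le> C * exp (- b * \<bar>x\<bar>)" "\<And>k. norm (c k) \<le> B"
  shows "norm (c k * h (x - of_int k) :: complex) \<le> B * C * exp (- b * \<bar>x - of_int k\<bar>)"
proof -
  have "0 \<le> B" using assms(2)[of 0] norm_ge_zero order_trans by blast
  then show ?thesis
    unfolding norm_mult mult.assoc by (intro mult_mono assms) auto
qed

lemma shift_sum_abs_summable:
  assumes "b > 0" "\<And>x. norm (h x) \<le> C * exp (- b * \<bar>x\<bar>)" "\<And>k. norm (c k) \<le> B"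
  shows "(\<lambda>k. norm (c k * h (x - of_int k) :: complex)) summable_on UNIV"
  by (rule summable_on_comparison_test[OF summable_on_cmult_right[OF summable_exp_dist_int[OF assms(1)]]
        shift_term_le[OF assms(2,3)]]) auto

lemma shift_sum_has_sum:
  assumes "b > 0" "\<And>x. norm (h x) \<le> C * exp (- b * \<bar>x\<bar>)" "\<And>k. norm (c k) \<le> B"
  shows "((\<lambda>k. c k * h (x - of_int k)) has_sum shift_sum h c x) UNIV"
  unfolding shift_sum_def
  by (rule has_sum_infsum[OF abs_summable_summable[OF shift_sum_abs_summable[OF assms]]])

lemma shift_sum_norm_le:
  assumes "b > 0" "\<And>x. norm (h x) \<le> C * exp (- b * \<bar>x\<bar>)" "\<And>k. norm (c k) \<le> B"
  shows "norm (shift_sum h c x) \<le> B * C * exp_sum_bound b"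
proof -
  have "norm (shift_sum h c x) \<le> B * C * (\<Sum>\<^sub>\<infinity>k::int. exp (- b * \<bar>x - real_of_int k\<bar>))"
    by (rule norm_infsum_le[OF shift_sum_has_sum[OF assms] has_sum_cmult_right[OF has_sum_infsum[OF summable_exp_dist_int[OF assms(1)]]]
          shift_term_le[OF assms(2,3)]])
  also have "\<dots> \<le> B * C * exp_sum_bound b"
  proof (intro mult_left_mono infsum_exp_dist_int_le assms)
    have "0 \<le> B" using assms(3)[of 0] norm_ge_zero order_trans by blast
    moreover have "0 \<le> C" using assms(2)[of 0] order_trans[OF norm_ge_zero] by force
    ultimately show "0 \<le> B * C" by simp
  qed
  finally show ?thesis .
qed

lemma shift_sum_translate:
  "shift_sum h c (x + of_int t) = shift_sum h (\<lambda>k. c (k + t)) x"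
  unfolding shift_sum_def
  by (rule infsum_reindex_bij_witness[where i = "\<lambda>k. k + t" and j = "\<lambda>k. k - t"]) (auto simp: algebra_simps)

lemma shift_sum_cmult: "shift_sum h (\<lambda>k. z * c k) x = z * shift_sum h c x"
  unfolding shift_sum_def by (simp add: mult.assoc infsum_cmult_right')

text \<open>The 3 is crude: 2 from the oscillation of \<open>h2\<close>, bounded by
  \<open>2 * C\<close>, and 1 from the linear term of \<open>h1\<close>. What matters is the
  quadratic order in \<open>t\<close>.\<close>

lemma taylor_quadratic_bound:
  fixes h0 h1 h2 :: "real \<Rightarrow> complex"
  assumes d0: "\<And>x. (h0 has_vector_derivative h1 x) (at x)"
    and d1: "\<And>x. (h1 has_vector_derivative h2 x) (at x)"
    and C: "\<And>x. x \<in> closed_segment y (y + t) \<Longrightarrow> norm (h2 x) \<le> C"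
  shows "norm (h0 (y + t) - h0 y - t *\<^sub>R h1 y) \<le> 3 * C * t\<^sup>2"
proof -
  let ?S = "closed_segment y (y + t)"
  have h1: "norm (h1 x - h1 y) \<le> 3 * C * \<bar>t\<bar>" if x: "x \<in> ?S" for x
  proof -
    have xt: "\<bar>x - y\<bar> \<le> \<bar>t\<bar>" using x by (auto simp: closed_segment_eq_real_ivl split: if_splits)
    have sub: "closed_segment y x \<subseteq> ?S" using x by (simp add: subset_closed_segment)
    have "norm (h1 x - h1 y - (x - y) *\<^sub>R h2 y) \<le> norm (x - y) * (2 * C)"
    proof (rule vector_differentiable_bound_linearization[OF _ sub])
      fix u assume "u \<in> ?S"
      then show "norm (h2 u - h2 y) \<le> 2 * C"
        using C[of u] C[of y] norm_triangle_ineq4[of "h2 u" "h2 y"] by auto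
    qed (auto intro: has_vector_derivative_at_within d1)
    moreover have "norm ((x - y) *\<^sub>R h2 y) \<le> \<bar>x - y\<bar> * C"
      using C[of y] by (simp add: mult_left_mono)
    moreover have "norm (h1 x - h1 y) \<le> norm (h1 x - h1 y - (x - y) *\<^sub>R h2 y) + norm ((x - y) *\<^sub>R h2 y)"
      by (metis diff_add_cancel norm_triangle_ineq)
    ultimately have "norm (h1 x - h1 y) \<le> 3 * C * \<bar>x - y\<bar>" by (simp add: algebra_simps)
    also have "\<dots> \<le> 3 * C * \<bar>t\<bar>"
      using C[of y] order_trans[OF norm_ge_zero, of "h2 y" C] by (intro mult_left_mono xt) auto
    finally show ?thesis .
  qed
  have "norm (h0 (y + t) - h0 y - (y + t - y) *\<^sub>R h1 y) \<le> norm (y + t - y) * (3 * C * \<bar>t\<bar>)"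
    by (rule vector_differentiable_bound_linearization[where S = ?S]) (auto intro: has_vector_derivative_at_within d0 h1)
  then show ?thesis by (simp add: power2_eq_square algebra_simps flip: abs_mult)
qed

text \<open>Differentiation under the lattice sum and under the Fourier integral both go through
  this criterion: quadratic remainders can be summed or integrated, so no separate exchange of
  limits arises.\<close>

lemma has_vector_derivative_quadraticI:
  fixes F :: "real \<Rightarrow> 'a::real_normed_vector"
  assumes est: "\<And>t. \<bar>t\<bar> \<le> 1 \<Longrightarrow> norm (F (x + t) - F x - t *\<^sub>R D) \<le> K * t\<^sup>2"
  shows "(F has_vector_derivative D) (at x)"
  unfolding has_vector_derivative_def
proof (rule has_derivativeI_sandwich[of 1])
  fix y assume y: "y \<noteq> x" "dist y x < 1"
  have "norm (F y - F x - (y - x) *\<^sub>R D) \<le> K * \<bar>y - x\<bar> * \<bar>y - x\<bar>"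
    using est[of "y - x"] y by (simp add: dist_real_def power2_eq_square mult.assoc)
  then show "norm (F y - F x - (y - x) *\<^sub>R D) / norm (y - x) \<le> K * \<bar>y - x\<bar>"
    using y by (simp add: divide_le_eq)
next
  have "((\<lambda>y. K * \<bar>y - x\<bar>) \<longlongrightarrow> K * \<bar>x - x\<bar>) (at x)" by (intro tendsto_intros)
  then show "((\<lambda>y. K * \<bar>y - x\<bar>) \<longlongrightarrow> 0) (at x)" by simp
qed (auto intro!: bounded_linear_intros)

text \<open>The quadratic Taylor remainders are summed over \<open>k\<close>. Since
  \<open>\<bar>t\<bar> \<le> 1\<close>, moving along the segment costs only a factor
  \<open>exp b\<close> in the decay of \<open>h2\<close>.\<close>

lemma shift_sum_has_vector_derivative:
  fixes h0 h1 h2 :: "real \<Rightarrow> complex"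
  assumes b: "b > 0" and c: "\<And>k. norm (c k) \<le> B"
    and d0: "\<And>x. (h0 has_vector_derivative h1 x) (at x)"
    and d1: "\<And>x. (h1 has_vector_derivative h2 x) (at x)"
    and C0: "\<And>x. norm (h0 x) \<le> C0 * exp (- b * \<bar>x\<bar>)"
    and C1: "\<And>x. norm (h1 x) \<le> C1 * exp (- b * \<bar>x\<bar>)"
    and C2: "\<And>x. norm (h2 x) \<le> C2 * exp (- b * \<bar>x\<bar>)"
  shows "(shift_sum h0 c has_vector_derivative shift_sum h1 c x) (at x)"
proof -
  have C20: "0 \<le> C2" using C2[of 0] order_trans[OF norm_ge_zero] by force
  have B0: "0 \<le> B" using c[of 0] norm_ge_zero order_trans by blast
  have seg: "norm (h2 u) \<le> C2 * exp b * exp (- b * \<bar>y\<bar>)" if "u \<in> closed_segment y (y + t)" "\<bar>t\<bar> \<le> 1" for u y t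
  proof -
    have "\<bar>y\<bar> \<le> \<bar>u\<bar> + 1" using that by (auto simp: closed_segment_eq_real_ivl split: if_splits)
    then have "b * \<bar>y\<bar> \<le> b * (\<bar>u\<bar> + 1)" using b by (intro mult_left_mono) auto
    then have "exp (- b * \<bar>u\<bar>) \<le> exp b * exp (- b * \<bar>y\<bar>)"
      by (simp add: distrib_left flip: exp_add)
    then have "C2 * exp (- b * \<bar>u\<bar>) \<le> C2 * (exp b * exp (- b * \<bar>y\<bar>))" using C20 by (rule mult_left_mono)
    then show ?thesis using C2[of u] by (simp add: mult.assoc)
  qed
  define K where "K = B * (3 * C2 * exp b) * exp_sum_bound b"
  have est: "norm (shift_sum h0 c (x + t) - shift_sum h0 c x - t *\<^sub>R shift_sum h1 c x) \<le> K * t\<^sup>2" if t: "\<bar>t\<bar> \<le> 1" for t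
  proof -
    have hs: "((\<lambda>k. c k * h0 (x + t - of_int k) - c k * h0 (x - of_int k) - t *\<^sub>R (c k * h1 (x - of_int k))) has_sum
       (shift_sum h0 c (x + t) - shift_sum h0 c x - t *\<^sub>R shift_sum h1 c x)) UNIV"
      using has_sum_add[OF has_sum_add[OF shift_sum_has_sum[OF b C0 c] has_sum_uminusI[OF shift_sum_has_sum[OF b C0 c]]]
         has_sum_uminusI[OF has_sum_scaleR[OF shift_sum_has_sum[OF b C1 c]]]]
      by (simp only: diff_conv_add_uminus)
    have "norm (shift_sum h0 c (x + t) - shift_sum h0 c x - t *\<^sub>R shift_sum h1 c x)
       \<le> (B * (3 * C2 * exp b) * t\<^sup>2) * (\<Sum>\<^sub>\<infinity>k::int. exp (- b * \<bar>x - real_of_int k\<bar>))"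
    proof (rule norm_infsum_le[OF hs has_sum_cmult_right[OF has_sum_infsum[OF summable_exp_dist_int[OF b]]]])
      fix k :: int
      have "norm (h0 ((x - of_int k) + t) - h0 (x - of_int k) - t *\<^sub>R h1 (x - of_int k)) \<le> 3 * (C2 * exp b * exp (- b * \<bar>x - of_int k\<bar>)) * t\<^sup>2"
        by (rule taylor_quadratic_bound[OF d0 d1 seg[OF _ t]])
      then have "norm (c k) * norm (h0 ((x - of_int k) + t) - h0 (x - of_int k) - t *\<^sub>R h1 (x - of_int k)) \<le>
          B * (3 * (C2 * exp b * exp (- b * \<bar>x - of_int k\<bar>)) * t\<^sup>2)"
        using B0 by (intro mult_mono c) auto
      moreover have "c k * h0 (x + t - of_int k) - c k * h0 (x - of_int k) - t *\<^sub>R (c k * h1 (x - of_int k)) =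
          c k * (h0 ((x - of_int k) + t) - h0 (x - of_int k) - t *\<^sub>R h1 (x - of_int k))"
        by (simp add: algebra_simps)
      ultimately show "norm (c k * h0 (x + t - of_int k) - c k * h0 (x - of_int k) - t *\<^sub>R (c k * h1 (x - of_int k)))
        \<le> B * (3 * C2 * exp b) * t\<^sup>2 * exp (- b * \<bar>x - of_int k\<bar>)"
        by (simp only: norm_mult mult_ac)
    qed
    also have "\<dots> \<le> (B * (3 * C2 * exp b) * t\<^sup>2) * exp_sum_bound b"
      by (intro mult_left_mono infsum_exp_dist_int_le b) (use B0 C20 in auto)
    finally show ?thesis by (simp add: K_def mult_ac)
  qed
  then show ?thesis by (rule has_vector_derivative_quadraticI)
qed

text \<open>\<open>G i\<close> lists the derivatives of the function whose Fourier transform retains only the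
  factors \<open>\<delta> i, \<delta> (i + 1), \<dots>\<close>, so that \<open>G n\<close> is a Gaussian.\<close>
locale gaussian_chain =
  fixes G :: "nat \<Rightarrow> nat \<Rightarrow> real \<Rightarrow> complex" and n :: nat and \<delta> :: "nat \<Rightarrow> real" and a A b :: real
  assumes a_pos: "a > 0" and A_pos: "A > 0" and b_pos: "b > 0"
    and deriv: "i \<le> n \<Longrightarrow> (G i j has_vector_derivative G i (Suc j) x) (at x)"
    and decay: "i \<le> n \<Longrightarrow> \<exists>C. \<forall>x. norm (G i j x) \<le> C * exp (- b * \<bar>x\<bar>)"
    and step: "i < n \<Longrightarrow> G i j x + complex_of_real (\<delta> i) * G i (Suc j) x = G (Suc i) j x"
    and gauss: "G n 0 x = complex_of_real (A * exp (- a * x\<^sup>2))"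
begin

lemma chain_has_sum:
  assumes "i \<le> n" "\<And>k. norm (c k) \<le> B"
  shows "((\<lambda>k. c k * G i j (x - of_int k)) has_sum shift_sum (G i j) c x) UNIV"
proof -
  obtain C where "\<And>x. norm (G i j x) \<le> C * exp (- b * \<bar>x\<bar>)" using decay[OF assms(1)] by blast
  from shift_sum_has_sum[OF b_pos this assms(2)] show ?thesis .
qed

lemma chain_has_vector_derivative:
  assumes "i \<le> n" "\<And>k. norm (c k) \<le> B"
  shows "(shift_sum (G i j) c has_vector_derivative shift_sum (G i (Suc j)) c x) (at x)"
proof -
  obtain C0 where C0: "\<And>x. norm (G i j x) \<le> C0 * exp (- b * \<bar>x\<bar>)" using decay[OF assms(1)] by blast
  obtain C1 where C1: "\<And>x. norm (G i (Suc j) x) \<le> C1 * exp (- b * \<bar>x\<bar>)" using decay[OF assms(1)] by blast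
  obtain C2 where C2: "\<And>x. norm (G i (Suc (Suc j)) x) \<le> C2 * exp (- b * \<bar>x\<bar>)" using decay[OF assms(1)] by blast
  show ?thesis
    by (rule shift_sum_has_vector_derivative[OF b_pos assms(2) deriv[OF assms(1)] deriv[OF assms(1)] C0 C1 C2])
qed

text \<open>The \<open>\<delta> i\<close> are real, so real parts commute with the operators and
  density of zeros passes from \<open>G 0\<close> to \<open>G n\<close>. There the kernel is a real
  Gaussian, hence the real part is the Gaussian sum with coefficients
  \<open>A * Re (c k)\<close>.\<close>

lemma chain_Re_zero_coeff:
  assumes c: "\<And>k. norm (c k) \<le> B"
    and z: "dense_zeros (\<lambda>j x. Re (shift_sum (G 0 j) c x))"
  shows "Re (c 0) = 0"
proof -
  have dRe: "((\<lambda>x. Re (shift_sum (G i j) c x)) has_real_derivative Re (shift_sum (G i (Suc j)) c x)) (at x)"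
    if "i \<le> n" for i j x
    using bounded_linear.has_vector_derivative[OF bounded_linear_Re chain_has_vector_derivative[OF that c]]
    by (simp add: has_real_derivative_iff_has_vector_derivative)
  have "i \<le> n \<Longrightarrow> dense_zeros (\<lambda>j x. Re (shift_sum (G i j) c x))" for i
  proof (induction i)
    case (Suc i)
    then have i: "i \<le> n" "i < n" by auto
    have "shift_sum (G i j) c x + complex_of_real (\<delta> i) * shift_sum (G i (Suc j)) c x = shift_sum (G (Suc i) j) c x" for j x
    proof -
      have "((\<lambda>k. c k * G i j (x - of_int k) + complex_of_real (\<delta> i) * (c k * G i (Suc j) (x - of_int k))) has_sum
         (shift_sum (G i j) c x + complex_of_real (\<delta> i) * shift_sum (G i (Suc j)) c x)) UNIV"
        by (intro has_sum_add has_sum_cmult_right chain_has_sum[OF i(1) c])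
      moreover have "c k * G i j (x - of_int k) + complex_of_real (\<delta> i) * (c k * G i (Suc j) (x - of_int k)) =
          c k * G (Suc i) j (x - of_int k)" for k
        unfolding step[OF i(2), symmetric] by (simp only: distrib_left mult.left_commute)
      ultimately have "((\<lambda>k. c k * G (Suc i) j (x - of_int k)) has_sum
         (shift_sum (G i j) c x + complex_of_real (\<delta> i) * shift_sum (G i (Suc j)) c x)) UNIV"
        by (simp only:)
      from has_sum_unique[OF this chain_has_sum[OF Suc.prems c]] show ?thesis .
    qed
    from this[symmetric] have "Re (shift_sum (G (Suc i) j) c x) = Re (shift_sum (G i j) c x) + \<delta> i * Re (shift_sum (G i (Suc j)) c x)" for j x
      by simp
    from dense_zeros_ode_step[OF dRe[OF i(1)] this Suc.IH[OF i(1)]] show ?case .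
  qed (use z in auto)
  then have dz: "dense_zeros (\<lambda>j x. Re (shift_sum (G n j) c x))" by blast
  define c' where "c' k = A * Re (c k)" for k
  have c': "\<bar>c' k\<bar> \<le> A * B" for k
    unfolding c'_def abs_mult using A_pos c[of k] abs_Re_le_cmod[of "c k"] by (intro mult_mono) auto
  have U0: "complex_of_real (Re (shift_sum (G n 0) c x)) =
     complex_of_real (exp (- a * x\<^sup>2)) * gaussian_laurent a c' (complex_of_real (exp (2 * a * x)))" for x
  proof -
    have "((\<lambda>k. complex_of_real (Re (c k * G n 0 (x - of_int k)))) has_sum
        complex_of_real (Re (shift_sum (G n 0) c x))) UNIV"
      by (intro has_sum_of_real has_sum_Re chain_has_sum[OF order_refl c])
    moreover have "Re (c k * G n 0 (x - of_int k)) = c' k * exp (- a * (x - of_int k)\<^sup>2)" for k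
      by (simp add: gauss c'_def)
    ultimately have "((\<lambda>k. complex_of_real (c' k * exp (- a * (x - of_int k)\<^sup>2))) has_sum
        complex_of_real (Re (shift_sum (G n 0) c x))) UNIV"
      by (simp only:)
    from has_sum_unique[OF this gaussian_shift_sum_laurent[OF a_pos c']] show ?thesis .
  qed
  have "c' 0 = 0"
  proof (rule gaussian_laurent_zero_coeff[OF a_pos c'])
    fix w :: complex assume "w \<noteq> 0"
    then show "gaussian_laurent a c' w = 0"
      by (rule gaussian_laurent_eq_0[OF a_pos c' dRe[OF order_refl] U0 dz])
  qed
  then show ?thesis using A_pos by (simp add: c'_def)
qed

text \<open>The imaginary part is the real part for the sequence \<open>- \<i> * c\<close>. A zero
  of the complex sum is a zero of both parts, so multiplicities carry over.\<close>

lemma chain_zero_coeff: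
  assumes c: "\<And>k. norm (c k) \<le> B" and L: "0 < L" "L < real N"
    and z: "\<And>x. \<exists>S \<mu>. finite S \<and> S \<subseteq> {x..<x + L} \<and> N \<le> (\<Sum>s\<in>S. \<mu> s) \<and>
       (\<forall>s\<in>S. \<forall>j<\<mu> s. shift_sum (G 0 j) c s = 0)"
  shows "c 0 = 0"
proof -
  have dz: "dense_zeros (\<lambda>j x. f (shift_sum (G 0 j) c x))" if f: "f 0 = 0" for f :: "complex \<Rightarrow> real"
    unfolding dense_zeros_def
  proof (intro exI[of _ L] exI[of _ N] conjI allI L)
    fix x
    obtain S \<mu> where S: "finite S" "S \<subseteq> {x..<x + L}" "N \<le> (\<Sum>s\<in>S. \<mu> s)"
       "\<And>s j. s \<in> S \<Longrightarrow> j < \<mu> s \<Longrightarrow> shift_sum (G 0 j) c s = 0"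
      using z[of x] by metis
    have "\<exists>z. zero_list (\<lambda>j x. f (shift_sum (G 0 j) c x)) z (\<Sum>s\<in>S. \<mu> s) \<and> (\<forall>i<(\<Sum>s\<in>S. \<mu> s). z i \<in> S)"
      by (rule zero_list_of_multiplicities) (use S f in auto)
    then show "\<exists>z. zero_list (\<lambda>j x. f (shift_sum (G 0 j) c x)) z N \<and> (\<forall>i<N. z i \<in> {x..<x + L})"
      using S(2,3) zero_list_subset by (meson order.strict_trans2 subsetD)
  qed
  have "Re (c 0) = 0" by (rule chain_Re_zero_coeff[OF c dz]) auto
  moreover have "Re (- \<i> * c 0) = 0"
  proof (rule chain_Re_zero_coeff)
    show "norm (- \<i> * c k) \<le> B" for k using c[of k] by (simp add: norm_mult)
    show "dense_zeros (\<lambda>j x. Re (shift_sum (G 0 j) (\<lambda>k. - \<i> * c k) x))"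
      unfolding shift_sum_cmult by (rule dz) auto
  qed
  ultimately show ?thesis by (simp add: complex_eq_iff)
qed

end

section \<open>Compactness of sampling patterns\<close>

lemma infsum_tendsto_dominated:
  fixes f :: "nat \<Rightarrow> 'a \<Rightarrow> 'b::banach"
  assumes lim: "\<And>k. (\<lambda>n. f n k) \<longlonglongrightarrow> g k"
    and dom: "\<forall>\<^sub>F n in sequentially. \<forall>k. norm (f n k) \<le> M k"
    and M: "M summable_on UNIV"
  shows "(\<lambda>n. infsum (f n) UNIV) \<longlonglongrightarrow> infsum g UNIV"
proof -
  have g: "norm (g k) \<le> M k" for k
    by (rule tendsto_upperbound[OF tendsto_norm[OF lim]]) (use dom in \<open>auto elim: eventually_mono\<close>)
  have tail: "norm (infsum h UNIV - sum h K) \<le> infsum M UNIV - sum M K"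
    if h: "\<And>k. norm (h k) \<le> M k" and K: "finite K" for h :: "'a \<Rightarrow> 'b" and K
  proof -
    have M0: "0 \<le> M k" for k using h[of k] norm_ge_zero order_trans by blast
    have sh: "h summable_on UNIV"
      by (rule abs_summable_summable, rule summable_on_comparison_test[OF M]) (use h in auto)
    have 1: "infsum h UNIV = sum h K + infsum h (UNIV - K)"
      using infsum_Diff[OF sh, of K] K by simp
    have 2: "infsum M UNIV = sum M K + infsum M (UNIV - K)"
      using infsum_Diff[OF M, of K] K by simp
    have "norm (infsum h (UNIV - K)) \<le> infsum M (UNIV - K)"
      by (rule norm_infsum_le[OF has_sum_infsum has_sum_infsum])
         (use sh M h K in \<open>auto intro: summable_on_cofin_subset\<close>)
    then show ?thesis using 1 2 by simp
  qed
  show ?thesis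
  proof (rule LIMSEQ_I)
    fix e :: real assume e: "e > 0"
    obtain K where K: "finite K" "norm (infsum M UNIV - sum M K) < e / 3"
      proof -
      obtain K where "finite K" "dist (sum M K) (infsum M UNIV) \<le> e / 6"
        using infsum_finite_approximation[OF M, of "e / 6"] e by auto
      moreover from this(2) have "norm (infsum M UNIV - sum M K) < e / 3"
        using e unfolding dist_norm norm_minus_commute[of "sum M K"] by linarith
      ultimately show thesis using that by blast
    qed
    have "(\<lambda>n. sum (f n) K) \<longlonglongrightarrow> sum g K" by (intro tendsto_sum lim)
    from tendstoD[OF this, of "e / 3"] e
    have "\<forall>\<^sub>F n in sequentially. norm (sum (f n) K - sum g K) < e / 3"
      by (simp only: dist_norm)
    with dom have "\<forall>\<^sub>F n in sequentially. norm (infsum (f n) UNIV - infsum g UNIV) < e"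
    proof eventually_elim
      case (elim n)
      have "norm (infsum (f n) UNIV - sum (f n) K) < e / 3" "norm (infsum g UNIV - sum g K) < e / 3"
        using tail[OF elim(1)[rule_format] K(1)] tail[OF g K(1)] K(2) unfolding real_norm_def by linarith+
      moreover have "norm (infsum (f n) UNIV - infsum g UNIV) \<le>
        norm (infsum (f n) UNIV - sum (f n) K) + norm (sum (f n) K - sum g K) + norm (infsum g UNIV - sum g K)"
      proof -
        let ?u = "infsum (f n) UNIV - sum (f n) K" and ?v = "sum (f n) K - sum g K" and ?w = "infsum g UNIV - sum g K"
        have "norm (infsum (f n) UNIV - infsum g UNIV) = norm (?u + ?v - ?w)" by simp
        then show ?thesis
          using norm_triangle_ineq[of ?u ?v] norm_triangle_ineq4[of "?u + ?v" ?w] by linarith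
      qed
      ultimately show ?case using elim(2) by linarith
    qed
    then show "\<exists>no. \<forall>n\<ge>no. norm (infsum (f n) UNIV - infsum g UNIV) < e"
      by (simp add: eventually_sequentially)
  qed
qed

text \<open>The coefficients converge only coordinatewise; the decay of \<open>h\<close> supplies
  the majorant, with \<open>exp b\<close> covering sample points displaced by less than 1.\<close>

lemma shift_sum_tendsto:
  assumes b: "b > 0" and C: "\<And>x. norm (h x) \<le> C * exp (- b * \<bar>x\<bar>)" and cont: "\<And>x. isCont h x"
    and B: "\<And>n k. norm (c n k) \<le> B" and c: "\<And>k. (\<lambda>n. c n k) \<longlonglongrightarrow> c' k" and x: "xs \<longlonglongrightarrow> x"
  shows "(\<lambda>n. shift_sum h (c n) (xs n)) \<longlonglongrightarrow> shift_sum h c' x"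
  unfolding shift_sum_def
proof (rule infsum_tendsto_dominated)
  show "(\<lambda>n. c n k * h (xs n - real_of_int k)) \<longlonglongrightarrow> c' k * h (x - real_of_int k)" for k
    by (intro tendsto_mult c isCont_tendsto_compose[OF cont] tendsto_diff x tendsto_const)
  have B0: "0 \<le> B" using B[of 0 0] norm_ge_zero order_trans by blast
  have C0: "0 \<le> C" using C[of 0] order_trans[OF norm_ge_zero] by force
  show "(\<lambda>k. B * C * exp b * exp (- b * \<bar>x - real_of_int k\<bar>)) summable_on UNIV"
    by (intro summable_on_cmult_right summable_exp_dist_int b)
  have "\<forall>\<^sub>F n in sequentially. dist (xs n) x < 1" using x by (auto simp: tendsto_iff)
  then show "\<forall>\<^sub>F n in sequentially. \<forall>k. norm (c n k * h (xs n - real_of_int k)) \<le> B * C * exp b * exp (- b * \<bar>x - real_of_int k\<bar>)"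
  proof eventually_elim
    case (elim n)
    show ?case
    proof
      fix k
      have "\<bar>x - real_of_int k\<bar> \<le> \<bar>xs n - real_of_int k\<bar> + 1" using elim by (auto simp: dist_real_def)
      then have "b * \<bar>x - real_of_int k\<bar> \<le> b * (\<bar>xs n - real_of_int k\<bar> + 1)" using b by (intro mult_left_mono) auto
      then have "exp (- b * \<bar>xs n - real_of_int k\<bar>) \<le> exp b * exp (- b * \<bar>x - real_of_int k\<bar>)"
        by (simp add: distrib_left flip: exp_add)
      then have "B * C * exp (- b * \<bar>xs n - real_of_int k\<bar>) \<le> B * C * (exp b * exp (- b * \<bar>x - real_of_int k\<bar>))"
        using B0 C0 by (intro mult_left_mono) auto
      then show "norm (c n k * h (xs n - real_of_int k)) \<le> B * C * exp b * exp (- b * \<bar>x - real_of_int k\<bar>)"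
        using shift_term_le[of h C b "c n" B k "xs n", OF C B] by (simp add: mult.assoc)
    qed
  qed
qed

lemma convergent_nat_eventually_const:
  fixes u :: "nat \<Rightarrow> nat"
  assumes "(\<lambda>n. real (u n)) \<longlonglongrightarrow> l"
  shows "\<exists>v. \<forall>\<^sub>F n in sequentially. u n = v"
proof -
  have "\<forall>\<^sub>F n in sequentially. dist (real (u n)) l < 1 / 2" by (rule tendstoD[OF assms]) simp
  then obtain n0 where n0: "\<And>n. n \<ge> n0 \<Longrightarrow> dist (real (u n)) l < 1 / 2" by (auto simp: eventually_sequentially)
  have "u n = u n0" if "n \<ge> n0" for n
    using n0[OF that] n0[OF order_refl] unfolding dist_real_def by linarith
  then show ?thesis by (auto simp: eventually_sequentially)
qed

text \<open>A separated set with multiplicities is encoded by one point \<open>p i\<close> in each cell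
  \<open>[i/Q, (i+1)/Q]\<close>; the multiplicity \<open>\<mu> i = 0\<close> marks an empty cell.\<close>
definition sample_class :: "nat \<Rightarrow> nat \<Rightarrow> real \<Rightarrow> real \<Rightarrow> nat \<Rightarrow> (int \<Rightarrow> real) \<Rightarrow> (int \<Rightarrow> nat) \<Rightarrow> bool" where
  "sample_class Q M d L N p \<mu> \<longleftrightarrow>
     (\<forall>i. real_of_int i / real Q \<le> p i \<and> p i \<le> (real_of_int i + 1) / real Q) \<and>
     (\<forall>i. \<mu> i \<le> M) \<and>
     (\<forall>i i'. i \<noteq> i' \<longrightarrow> 0 < \<mu> i \<longrightarrow> 0 < \<mu> i' \<longrightarrow> d \<le> \<bar>p i - p i'\<bar>) \<and>
     (\<forall>x. N \<le> (\<Sum>i | p i \<in> {x..x + L}. \<mu> i))"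

lemma cell_indices_bounded:
  assumes "Q > 0" "real_of_int i / real Q \<le> q" "q \<le> (real_of_int i + 1) / real Q" "q \<in> {x..y}"
  shows "i \<in> {\<lfloor>real Q * x\<rfloor> - 1..\<lceil>real Q * y\<rceil>}"
proof -
  have "real_of_int i \<le> real Q * q" "real Q * q \<le> real_of_int i + 1"
    using assms by (auto simp: field_simps)
  moreover have "real Q * x \<le> real Q * q" "real Q * q \<le> real Q * y"
    using assms by (auto intro: mult_left_mono)
  ultimately have "real_of_int i \<le> real Q * y" "real Q * x \<le> real_of_int i + 1" by linarith+
  then show ?thesis by (auto simp: le_ceiling_iff floor_le_iff) linarith+
qed

context gaussian_chain
begin

lemma chain_isCont: "i \<le> n \<Longrightarrow> isCont (G i j) x"
  using deriv has_vector_derivative_continuous by blast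

text \<open>If no \<open>\<eta>\<close> worked, there would be patterns with all samples below
  \<open>1 / Suc m\<close>. A limit of them is a pattern of the same class on which the limiting sum
  vanishes exactly, so \<open>c 0 = 0\<close> by uniqueness, against
  \<open>1 / 2 \<le> norm (c 0)\<close>, which survives the limit.\<close>

lemma sample_lower_compactness:
  assumes Q: "Q > 0" and d: "0 < d" and L: "0 \<le> L" "L < real N"
  shows "\<exists>\<eta>>0. \<forall>p \<mu> c. sample_class Q M d L N p \<mu> \<longrightarrow> (\<forall>k. norm (c k) \<le> 1) \<longrightarrow> 1 / 2 \<le> norm (c 0) \<longrightarrow>
     (\<exists>i j. j < \<mu> i \<and> \<eta> \<le> norm (shift_sum (G 0 j) c (p i)))"
proof (rule ccontr)
  assume neg: "\<not> ?thesis"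
  define R where "R m p \<mu> c \<longleftrightarrow> sample_class Q M d L N p \<mu> \<and> (\<forall>k. norm (c k) \<le> 1) \<and> 1 / 2 \<le> norm (c 0) \<and>
     (\<forall>i j. \<not> j < \<mu> i \<or> norm (shift_sum (G 0 j) c (p i)) < 1 / real (Suc m))" for m p \<mu> c
  have "\<exists>p \<mu> c. R m p \<mu> c" for m
  proof -
    have "\<not> 0 < 1 / real (Suc m) \<or> (\<exists>p \<mu> c. R m p \<mu> c)"
      unfolding R_def by (rule neg[unfolded not_ex de_Morgan_conj not_all not_imp not_le, THEN spec])
    then show ?thesis by simp
  qed
  then obtain P MU CC where PMC: "\<And>m. R m (P m) (MU m) (CC m)" by metis
  have P: "sample_class Q M d L N (P m) (MU m)" for m using PMC unfolding R_def by blast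
  have CC: "norm (CC m k) \<le> 1" "1 / 2 \<le> norm (CC m 0)" for m k using PMC unfolding R_def by blast+
  have small: "norm (shift_sum (G 0 j) (CC m) (P m i)) < 1 / real (Suc m)" if "j < MU m i" for m i j
    using PMC that unfolding R_def by blast
  note Pc = P[unfolded sample_class_def]
  have cell: "real_of_int i / real Q \<le> P m i" "P m i \<le> (real_of_int i + 1) / real Q" for m i
    using Pc by auto
  \<comment> \<open>Coefficients, offsets inside the cells and multiplicities are packed into one
    uniformly bounded function on a countable set, so a single diagonal extraction handles them all.
    Offsets replace the points because the points are unbounded.\<close>
  define F :: "nat \<Rightarrow> int \<times> nat \<Rightarrow> complex" where
    "F m = (\<lambda>(k, t). if t = 0 then CC m k else if t = 1 then complex_of_real (P m k - real_of_int k / real Q)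
       else complex_of_real (real (MU m k)))" for m
  have F: "norm (F m kt) \<le> 1 + real M" for m kt
  proof -
    obtain k t where kt: "kt = (k, t)" by fastforce
    have "1 / real Q \<le> 1" using Q by simp
    then have "\<bar>P m k - real_of_int k / real Q\<bar> \<le> 1" using cell[where i = k and m = m] by (simp add: add_divide_distrib)
    moreover have "real (MU m k) \<le> real M" using Pc by simp
    ultimately show ?thesis using CC(1)[of m k] unfolding F_def kt
      by (auto simp del: of_real_diff of_real_divide)
  qed
  obtain r where r: "strict_mono (r :: nat \<Rightarrow> nat)" and rl: "\<And>x. x \<in> UNIV \<Longrightarrow> \<exists>l. (\<lambda>m. F (r m) x) \<longlonglongrightarrow> l"
    by (rule function_convergent_subsequence[of UNIV F "1 + real M"]) (use F in auto)
  obtain l where l: "\<And>x. (\<lambda>m. F (r m) x) \<longlonglongrightarrow> l x" using rl by (metis UNIV_I)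
  define c where "c k = l (k, 0)" for k
  have c: "(\<lambda>m. CC (r m) k) \<longlonglongrightarrow> c k" for k using l[of "(k, 0)"] by (simp add: F_def c_def)
  define p where "p i = Re (l (i, 1)) + real_of_int i / real Q" for i
  have p: "(\<lambda>m. P (r m) i) \<longlonglongrightarrow> p i" for i
  proof -
    have "(\<lambda>m. Re (F (r m) (i, 1)) + real_of_int i / real Q) \<longlonglongrightarrow> p i"
      unfolding p_def by (intro tendsto_intros l)
    then show ?thesis by (simp add: F_def)
  qed
  have "\<exists>v. \<forall>\<^sub>F m in sequentially. MU (r m) i = v" for i
  proof (rule convergent_nat_eventually_const)
    have "(\<lambda>m. Re (F (r m) (i, 2))) \<longlonglongrightarrow> Re (l (i, 2))" by (intro tendsto_intros l)
    then show "(\<lambda>m. real (MU (r m) i)) \<longlonglongrightarrow> Re (l (i, 2))" by (simp add: F_def)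
  qed
  then obtain \<mu> where \<mu>: "\<And>i. \<forall>\<^sub>F m in sequentially. MU (r m) i = \<mu> i" by metis
  have c1: "norm (c k) \<le> 1" for k
    by (rule tendsto_upperbound[OF tendsto_norm[OF c]]) (use CC in auto)
  have c0: "1 / 2 \<le> norm (c 0)"
    by (rule tendsto_lowerbound[OF tendsto_norm[OF c]]) (use CC in auto)
  have zero: "shift_sum (G 0 j) c (p i) = 0" if j: "j < \<mu> i" for i j
  proof -
    obtain C where C: "\<And>x. norm (G 0 j x) \<le> C * exp (- b * \<bar>x\<bar>)" using decay[of 0 j] by auto
    have lim: "(\<lambda>m. shift_sum (G 0 j) (CC (r m)) (P (r m) i)) \<longlonglongrightarrow> shift_sum (G 0 j) c (p i)"
      by (rule shift_sum_tendsto[OF b_pos C chain_isCont CC(1) c p]) auto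
    have "(\<lambda>m. shift_sum (G 0 j) (CC (r m)) (P (r m) i)) \<longlonglongrightarrow> 0"
    proof (rule Lim_null_comparison)
      show "(\<lambda>m. 1 / real (Suc m)) \<longlonglongrightarrow> 0" by real_asymp
      show "\<forall>\<^sub>F m in sequentially. norm (shift_sum (G 0 j) (CC (r m)) (P (r m) i)) \<le> 1 / real (Suc m)"
        using \<mu>[of i]
      proof eventually_elim
        case (elim m)
        have "m \<le> r m" by (rule strict_mono_imp_increasing[OF r])
        then have "1 / real (Suc (r m)) \<le> 1 / real (Suc m)" by (simp add: frac_le)
        then show ?case using small[of j "r m" i] j elim by simp
      qed
    qed
    then show ?thesis using lim LIMSEQ_unique by blast
  qed
  \<comment> \<open>Separation survives the limit, so occupied points cannot merge.\<close>
  have sep: "d \<le> \<bar>p i - p i'\<bar>" if "i \<noteq> i'" "0 < \<mu> i" "0 < \<mu> i'" for i i'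
  proof (rule tendsto_lowerbound)
    show "(\<lambda>m. \<bar>P (r m) i - P (r m) i'\<bar>) \<longlonglongrightarrow> \<bar>p i - p i'\<bar>" by (intro tendsto_intros p)
    show "\<forall>\<^sub>F m in sequentially. d \<le> \<bar>P (r m) i - P (r m) i'\<bar>"
      using \<mu>[of i] \<mu>[of i'] by eventually_elim (use Pc that in auto)
  qed auto
  have pcell: "real_of_int i / real Q \<le> p i" "p i \<le> (real_of_int i + 1) / real Q" for i
    by (rule tendsto_lowerbound[OF p] tendsto_upperbound[OF p]; use cell in auto)+
  have count: "N \<le> (\<Sum>i | p i \<in> {x..x + L}. \<mu> i)" for x
  proof -
    define J where "J = {\<lfloor>real Q * x\<rfloor> - 1..\<lceil>real Q * (x + L)\<rceil>}"
    have J: "finite J" by (simp add: J_def)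
    \<comment> \<open>The window is closed, so a point outside it in the limit is eventually
      outside; hence counts can only grow in the limit.\<close>
    have "\<forall>\<^sub>F m in sequentially. \<forall>i\<in>J. MU (r m) i = \<mu> i \<and> (p i \<notin> {x..x + L} \<longrightarrow> P (r m) i \<notin> {x..x + L})"
    proof (rule eventually_ball_finite[OF J], intro ballI)
      fix i
      show "\<forall>\<^sub>F m in sequentially. MU (r m) i = \<mu> i \<and> (p i \<notin> {x..x + L} \<longrightarrow> P (r m) i \<notin> {x..x + L})"
      proof (cases "p i \<in> {x..x + L}")
        case False
        have "open (- {x..x + L})" by (intro open_Compl) auto
        with False have "\<forall>\<^sub>F m in sequentially. P (r m) i \<in> - {x..x + L}"
          by (intro topological_tendstoD[OF p]) auto
        with \<mu>[of i] show ?thesis by eventually_elim auto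
      qed (use \<mu> in auto)
    qed
    then obtain m where m: "\<And>i. i \<in> J \<Longrightarrow> MU (r m) i = \<mu> i \<and> (p i \<notin> {x..x + L} \<longrightarrow> P (r m) i \<notin> {x..x + L})"
      by (auto simp: eventually_sequentially)
    have inJ: "i \<in> J" if "P (r m) i \<in> {x..x + L} \<or> p i \<in> {x..x + L}" for i
      using cell_indices_bounded[OF Q cell] cell_indices_bounded[OF Q pcell] that unfolding J_def by blast
    have "N \<le> (\<Sum>i | P (r m) i \<in> {x..x + L}. MU (r m) i)" using Pc by blast
    also have "\<dots> = (\<Sum>i | P (r m) i \<in> {x..x + L}. \<mu> i)" using m inJ by (intro sum.cong) auto
    also have "\<dots> \<le> (\<Sum>i | p i \<in> {x..x + L}. \<mu> i)"
    proof (rule sum_mono2)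
      show "finite {i. p i \<in> {x..x + L}}" by (rule finite_subset[OF _ J]) (use inJ in auto)
      show "{i. P (r m) i \<in> {x..x + L}} \<subseteq> {i. p i \<in> {x..x + L}}" using m inJ by blast
    qed auto
    finally show ?thesis .
  qed
  have "c 0 = 0"
  proof (rule chain_zero_coeff[OF c1])
    \<comment> \<open>A length strictly between \<open>L\<close> and \<open>N\<close> turns closed
      windows into half-open ones and keeps the surplus of zeros.\<close>
    show "0 < (L + real N) / 2" "(L + real N) / 2 < real N" using L by auto
    fix x
    define I where "I = {i. p i \<in> {x..x + L} \<and> 0 < \<mu> i}"
    have fin: "finite {i. p i \<in> {x..x + L}}"
      by (rule finite_subset[of _ "{\<lfloor>real Q * x\<rfloor> - 1..\<lceil>real Q * (x + L)\<rceil>}"])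
         (use cell_indices_bounded[OF Q pcell] in blast)+
    have inj: "inj_on p I"
    proof (rule inj_onI, rule ccontr)
      fix i i' assume "i \<in> I" "i' \<in> I" "p i = p i'" "i \<noteq> i'"
      then show False using sep[of i i'] d by (auto simp: I_def)
    qed
    have "N \<le> (\<Sum>i\<in>I. \<mu> i)"
      using count[of x] fin unfolding I_def
      by (subst (asm) sum.mono_neutral_right[where S = "{i. p i \<in> {x..x + L} \<and> 0 < \<mu> i}"]) auto
    also have "(\<Sum>i\<in>I. \<mu> i) = (\<Sum>s\<in>p ` I. \<mu> (inv_into I p s))"
      by (simp add: sum.reindex[OF inj] inv_into_f_f[OF inj])
    finally have "N \<le> (\<Sum>s\<in>p ` I. \<mu> (inv_into I p s))" .
    moreover have "finite (p ` I)" unfolding I_def by (intro finite_imageI finite_subset[OF _ fin]) auto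
    moreover have "p ` I \<subseteq> {x..<x + (L + real N) / 2}"
    proof
      fix s assume "s \<in> p ` I"
      then have "x \<le> s" "s \<le> x + L" by (auto simp: I_def)
      moreover have "L < (L + real N) / 2" using L by simp
      ultimately show "s \<in> {x..<x + (L + real N) / 2}" unfolding atLeastLessThan_iff by linarith
    qed
    moreover have "\<forall>s\<in>p ` I. \<forall>j<\<mu> (inv_into I p s). shift_sum (G 0 j) c s = 0"
      using zero by (auto simp: inv_into_f_f[OF inj])
    ultimately show "\<exists>S \<mu>. finite S \<and> S \<subseteq> {x..<x + (L + real N) / 2} \<and> N \<le> (\<Sum>s\<in>S. \<mu> s) \<and>
       (\<forall>s\<in>S. \<forall>j<\<mu> s. shift_sum (G 0 j) c s = 0)"
      by blast
  qed
  then show False using c0 by simp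
qed

end

section \<open>Localisation of the lower bound\<close>

text \<open>Translation by an integer \<open>t\<close> shifts cell indices by \<open>Q * t\<close>,
  so estimates proved at coefficient 0 hold at every coefficient with the same constant.\<close>

lemma sample_class_translate:
  assumes Q: "Q > 0" and K: "sample_class Q M d L N p \<mu>"
  shows "sample_class Q M d L N (\<lambda>i. p (i + int Q * t) - of_int t) (\<lambda>i. \<mu> (i + int Q * t))"
  unfolding sample_class_def
proof (intro conjI allI impI)
  note K' = K[unfolded sample_class_def]
  fix i
  have "real_of_int (i + int Q * t) / real Q \<le> p (i + int Q * t)"
    "p (i + int Q * t) \<le> (real_of_int (i + int Q * t) + 1) / real Q" using K' by blast+
  moreover have "real_of_int (i + int Q * t) / real Q = real_of_int i / real Q + of_int t"
    "(real_of_int (i + int Q * t) + 1) / real Q = (real_of_int i + 1) / real Q + of_int t"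
    using Q by (simp_all add: field_simps)
  ultimately show "real_of_int i / real Q \<le> p (i + int Q * t) - of_int t"
    "p (i + int Q * t) - of_int t \<le> (real_of_int i + 1) / real Q" by linarith+
  show "\<mu> (i + int Q * t) \<le> M" using K' by blast
  show "d \<le> \<bar>p (i + int Q * t) - of_int t - (p (i' + int Q * t) - of_int t)\<bar>"
    if "i \<noteq> i'" "0 < \<mu> (i + int Q * t)" "0 < \<mu> (i' + int Q * t)" for i'
  proof -
    have "i + int Q * t \<noteq> i' + int Q * t" using that by simp
    then show ?thesis using K' that by (simp del: add_right_cancel)
  qed
next
  fix x
  have "N \<le> (\<Sum>i | p i \<in> {x + of_int t..x + of_int t + L}. \<mu> i)"
    using K unfolding sample_class_def by blast
  also have "\<dots> = (\<Sum>i | p (i + int Q * t) - real_of_int t \<in> {x..x + L}. \<mu> (i + int Q * t))"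
    by (rule sum.reindex_bij_witness[where i = "\<lambda>i. i + int Q * t" and j = "\<lambda>i. i - int Q * t"]) auto
  finally show "N \<le> (\<Sum>i | p (i + int Q * t) - real_of_int t \<in> {x..x + L}. \<mu> (i + int Q * t))" .
qed

text \<open>With \<open>D = exp (\<epsilon> * \<bar>x - y\<bar>)\<close> the two weights differ by a
  factor between \<open>1 / D\<close> and \<open>D\<close>, and \<open>1 - 1 / D \<le> D - 1\<close>
  gives both directions the same bound.\<close>

lemma exp_weight_diff_le:
  fixes x y z \<epsilon> :: real
  assumes "\<epsilon> \<ge> 0"
  shows "\<bar>exp (- \<epsilon> * \<bar>y - z\<bar>) - exp (- \<epsilon> * \<bar>x - z\<bar>)\<bar> \<le> exp (- \<epsilon> * \<bar>y - z\<bar>) * (exp (\<epsilon> * \<bar>x - y\<bar>) - 1)"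
proof -
  let ?E = "exp (- \<epsilon> * \<bar>y - z\<bar>)" and ?D = "exp (\<epsilon> * \<bar>x - y\<bar>)"
  have a1: "exp (- \<epsilon> * \<bar>x - z\<bar>) \<le> ?E * ?D"
  proof -
    have "\<epsilon> * \<bar>y - z\<bar> \<le> \<epsilon> * (\<bar>x - y\<bar> + \<bar>x - z\<bar>)" using assms by (intro mult_left_mono) auto
    then show ?thesis by (simp add: distrib_left flip: exp_add)
  qed
  have a2: "?E / ?D \<le> exp (- \<epsilon> * \<bar>x - z\<bar>)"
  proof -
    have "\<epsilon> * \<bar>x - z\<bar> \<le> \<epsilon> * (\<bar>x - y\<bar> + \<bar>y - z\<bar>)" using assms by (intro mult_left_mono) auto
    then show ?thesis by (simp add: distrib_left flip: exp_diff)
  qed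
  have D: "?D \<ge> 1" using assms by simp
  have "1 / ?D \<ge> 2 - ?D"
  proof -
    have "0 \<le> (?D - 1)\<^sup>2" by simp
    then have "(2 - ?D) * ?D \<le> 1" by (simp add: power2_eq_square algebra_simps)
    then show ?thesis using D by (simp add: pos_le_divide_eq)
  qed
  then have "?E * (2 - ?D) \<le> ?E * (1 / ?D)" by (intro mult_left_mono) auto
  then have "?E * (2 - ?D) \<le> exp (- \<epsilon> * \<bar>x - z\<bar>)"
    using a2 unfolding times_divide_eq_right mult_1_right by linarith
  then show ?thesis using a1 unfolding abs_le_iff right_diff_distrib by simp
qed

text \<open>In \<open>exp (\<epsilon> * t) - 1 \<le> \<epsilon> * t * exp (\<epsilon> * t)\<close>
  one quarter of the rate \<open>b\<close> absorbs the exponential and another the factor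
  \<open>t\<close>. Half the decay is left, and the factor \<open>\<epsilon>\<close> makes the
  commutator small.\<close>

lemma exp_minus_one_decay:
  fixes t \<epsilon> b :: real
  assumes "t \<ge> 0" "0 \<le> \<epsilon>" "\<epsilon> \<le> b / 4" "b > 0"
  shows "(exp (\<epsilon> * t) - 1) * exp (- b * t) \<le> \<epsilon> * (4 / b) * exp (- (b / 2) * t)"
proof -
  have "1 - \<epsilon> * t \<le> exp (- (\<epsilon> * t))" using exp_ge_add_one_self[of "- (\<epsilon> * t)"] by simp
  then have "(1 - \<epsilon> * t) * exp (\<epsilon> * t) \<le> exp (- (\<epsilon> * t)) * exp (\<epsilon> * t)" by (intro mult_right_mono) auto
  then have "exp (\<epsilon> * t) - 1 \<le> \<epsilon> * t * exp (\<epsilon> * t)" by (simp add: algebra_simps flip: exp_add)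
  also have "\<dots> \<le> \<epsilon> * ((4 / b) * exp (b / 4 * t)) * exp (b / 4 * t)"
  proof -
    have "b / 4 * t \<le> exp (b / 4 * t)" using exp_ge_add_one_self[of "b / 4 * t"] by linarith
    then have "t \<le> (4 / b) * exp (b / 4 * t)" using assms(4) by (simp add: field_simps)
    moreover have "exp (\<epsilon> * t) \<le> exp (b / 4 * t)" using mult_right_mono[OF assms(3,1)] by simp
    ultimately show ?thesis using assms by (intro mult_mono mult_nonneg_nonneg) auto
  qed
  also have "\<dots> = \<epsilon> * (4 / b) * exp (b / 2 * t)" by (simp add: flip: exp_add)
  finally have "(exp (\<epsilon> * t) - 1) * exp (- b * t) \<le> \<epsilon> * (4 / b) * exp (b / 2 * t) * exp (- b * t)"
    by (rule mult_right_mono) auto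
  also have "\<dots> = \<epsilon> * (4 / b) * exp (- (b / 2) * t)" by (simp add: mult.assoc flip: exp_add)
  finally show ?thesis .
qed

context gaussian_chain
begin

lemma decay_uniform: "\<exists>C\<ge>0. \<forall>j<M. \<forall>x. norm (G 0 j x) \<le> C * exp (- b * \<bar>x\<bar>)"
proof (induction M)
  case (Suc M)
  then obtain C where C: "C \<ge> 0" "\<And>j x. j < M \<Longrightarrow> norm (G 0 j x) \<le> C * exp (- b * \<bar>x\<bar>)" by blast
  obtain C' where C': "\<And>x. norm (G 0 M x) \<le> C' * exp (- b * \<bar>x\<bar>)" using decay[of 0 M] by auto
  have "norm (G 0 j x) \<le> max C C' * exp (- b * \<bar>x\<bar>)" if "j < Suc M" for j x
  proof -
    have "C * exp (- b * \<bar>x\<bar>) \<le> max C C' * exp (- b * \<bar>x\<bar>)" "C' * exp (- b * \<bar>x\<bar>) \<le> max C C' * exp (- b * \<bar>x\<bar>)"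
      by (intro mult_right_mono; simp)+
    then show ?thesis using C(2)[of j x] C'[of x] that by (cases "j = M") (auto intro: order_trans)
  qed
  then show ?case using C(1) by (intro exI[of _ "max C C'"]) auto
qed auto

text \<open>\<open>D\<close> bounds the weighted coefficients, so the error is small relative to
  their own supremum and does not involve \<open>B\<close>. This allows it to be absorbed
  later.\<close>

lemma shift_sum_weight_commutator:
  assumes \<epsilon>: "0 \<le> \<epsilon>" "\<epsilon> \<le> b / 4" and C: "C \<ge> 0" "\<And>x. norm (G 0 j x) \<le> C * exp (- b * \<bar>x\<bar>)"
    and B: "\<And>k. norm (c k) \<le> B" and D: "\<And>k. exp (- \<epsilon> * \<bar>of_int k - z\<bar>) * norm (c k) \<le> D"
  shows "norm (shift_sum (G 0 j) (\<lambda>k. of_real (exp (- \<epsilon> * \<bar>of_int k - z\<bar>)) * c k) x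
      - of_real (exp (- \<epsilon> * \<bar>x - z\<bar>)) * shift_sum (G 0 j) c x) \<le> D * (\<epsilon> * (4 / b) * C * exp_sum_bound (b / 2))"
proof -
  have D0: "0 \<le> D" using D[of 0] order_trans[OF mult_nonneg_nonneg[OF exp_ge_zero norm_ge_zero]] by blast
  let ?w = "\<lambda>k. complex_of_real (exp (- \<epsilon> * \<bar>real_of_int k - z\<bar>))"
  let ?v = "complex_of_real (exp (- \<epsilon> * \<bar>x - z\<bar>))"
  have D': "norm (?w k * c k) \<le> D" for k using D[of k] by (simp add: norm_mult)
  have b2: "b / 2 > 0" using b_pos by simp
  have hs: "((\<lambda>k. ?w k * c k * G 0 j (x - of_int k) - ?v * (c k * G 0 j (x - of_int k))) has_sum
      (shift_sum (G 0 j) (\<lambda>k. ?w k * c k) x - ?v * shift_sum (G 0 j) c x)) UNIV"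
    using has_sum_add[OF shift_sum_has_sum[OF b_pos C(2) D'] has_sum_uminusI[OF has_sum_cmult_right[OF shift_sum_has_sum[OF b_pos C(2) B]]]]
    by (simp only: diff_conv_add_uminus)
  have "norm (shift_sum (G 0 j) (\<lambda>k. ?w k * c k) x - ?v * shift_sum (G 0 j) c x) \<le>
     D * (\<epsilon> * (4 / b) * C) * (\<Sum>\<^sub>\<infinity>k::int. exp (- (b / 2) * \<bar>x - real_of_int k\<bar>))"
  proof (rule norm_infsum_le[OF hs has_sum_cmult_right[OF has_sum_infsum[OF summable_exp_dist_int[OF b2]]]])
    fix k :: int
    let ?t = "\<bar>x - real_of_int k\<bar>"
    have "?w k * c k * G 0 j (x - of_int k) - ?v * (c k * G 0 j (x - of_int k)) =
       complex_of_real (exp (- \<epsilon> * \<bar>of_int k - z\<bar>) - exp (- \<epsilon> * \<bar>x - z\<bar>)) * c k * G 0 j (x - of_int k)"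
      by (simp add: algebra_simps)
    then have "norm (?w k * c k * G 0 j (x - of_int k) - ?v * (c k * G 0 j (x - of_int k))) =
       \<bar>exp (- \<epsilon> * \<bar>of_int k - z\<bar>) - exp (- \<epsilon> * \<bar>x - z\<bar>)\<bar> * norm (c k) * norm (G 0 j (x - of_int k))"
      by (simp only: norm_mult norm_of_real)
    also have "\<dots> \<le> (exp (- \<epsilon> * \<bar>of_int k - z\<bar>) * (exp (\<epsilon> * ?t) - 1)) * norm (c k) * (C * exp (- b * ?t))"
      using \<epsilon> by (intro mult_mono exp_weight_diff_le C mult_nonneg_nonneg) auto
    also have "\<dots> = (exp (- \<epsilon> * \<bar>of_int k - z\<bar>) * norm (c k)) * (C * ((exp (\<epsilon> * ?t) - 1) * exp (- b * ?t)))"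
      by (simp only: mult_ac)
    also have "\<dots> \<le> D * (C * (\<epsilon> * (4 / b) * exp (- (b / 2) * ?t)))"
      using \<epsilon> b_pos C(1) D0 by (intro mult_mono D exp_minus_one_decay mult_nonneg_nonneg) auto
    also have "\<dots> = D * (\<epsilon> * (4 / b) * C) * exp (- (b / 2) * ?t)" by (simp only: mult_ac)
    finally show "norm (?w k * c k * G 0 j (x - of_int k) - ?v * (c k * G 0 j (x - of_int k)))
       \<le> D * (\<epsilon> * (4 / b) * C) * exp (- (b / 2) * ?t)" .
  qed
  also have "\<dots> \<le> D * (\<epsilon> * (4 / b) * C) * exp_sum_bound (b / 2)"
    using \<epsilon> C b_pos D0 by (intro mult_left_mono infsum_exp_dist_int_le b2) auto
  finally show ?thesis by (simp only: mult.assoc)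
qed

text \<open>Division by \<open>B\<close> and translation of the nearly maximal index
  \<open>k1\<close> to 0 reduce this to the normalised bound.\<close>

lemma sample_lower_sup:
  assumes Q: "Q > 0" and d: "0 < d" and L: "0 \<le> L" "L < real N"
  shows "\<exists>\<eta>>0. \<forall>p \<mu> c B k1. sample_class Q M d L N p \<mu> \<longrightarrow> B > 0 \<longrightarrow> (\<forall>k. norm (c k) \<le> B) \<longrightarrow> B / 2 \<le> norm (c k1) \<longrightarrow>
     (\<exists>i j. j < \<mu> i \<and> \<eta> * B \<le> norm (shift_sum (G 0 j) c (p i)))"
proof -
  obtain \<eta> where \<eta>: "\<eta> > 0" "\<And>p \<mu> c. sample_class Q M d L N p \<mu> \<Longrightarrow> (\<forall>k. norm (c k) \<le> 1) \<Longrightarrow> 1 / 2 \<le> norm (c 0) \<Longrightarrow>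
     \<exists>i j. j < \<mu> i \<and> \<eta> \<le> norm (shift_sum (G 0 j) c (p i))"
    using sample_lower_compactness[OF Q d L, of M] by meson
  have "\<exists>i j. j < \<mu> i \<and> \<eta> * B \<le> norm (shift_sum (G 0 j) c (p i))"
    if K: "sample_class Q M d L N p \<mu>" and B: "B > 0" "\<And>k. norm (c k) \<le> B" "B / 2 \<le> norm (c k1)" for p \<mu> c B k1
  proof -
    define c' where "c' k = complex_of_real (1 / B) * c (k + k1)" for k
    have nc: "norm (c' k) = norm (c (k + k1)) / B" for k using B(1) by (simp add: c'_def norm_mult norm_divide)
    have "\<exists>i j. j < \<mu> (i + int Q * k1) \<and> \<eta> \<le> norm (shift_sum (G 0 j) c' (p (i + int Q * k1) - of_int k1))"
      by (rule \<eta>(2)[OF sample_class_translate[OF Q K]]) (use B in \<open>auto simp: nc field_simps\<close>)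
    then obtain i j where ij: "j < \<mu> (i + int Q * k1)" "\<eta> \<le> norm (shift_sum (G 0 j) c' (p (i + int Q * k1) - of_int k1))"
      by blast
    have "shift_sum (G 0 j) c' (p (i + int Q * k1) - of_int k1) = complex_of_real (1 / B) * shift_sum (G 0 j) c (p (i + int Q * k1))"
      unfolding c'_def shift_sum_cmult shift_sum_translate[symmetric] by simp
    then have "\<eta> \<le> norm (shift_sum (G 0 j) c (p (i + int Q * k1))) / B"
      using ij(2) B(1) by (simp add: norm_mult norm_divide)
    then show ?thesis using ij(1) B(1) by (auto simp: field_simps)
  qed
  then show ?thesis using \<eta>(1) by (intro exI[of _ \<eta>]) blast
qed

text \<open>Applying the sup-norm bound to the weighted sequence \<open>exp (- \<epsilon> * \<bar>k - k0\<bar>) * c k\<close> localises it: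
  the weight commutes with sampling up to an error of order \<open>\<epsilon>\<close>.\<close>
lemma sample_domination:
  assumes Q: "Q > 0" and d: "0 < d" and L: "0 \<le> L" "L < real N"
  shows "\<exists>\<epsilon>>0. \<exists>C>0. \<forall>p \<mu> c B. sample_class Q M d L N p \<mu> \<longrightarrow> (\<forall>k. norm (c k) \<le> B) \<longrightarrow>
     (\<forall>k. \<exists>i j. j < \<mu> i \<and> norm (c k) \<le> C * exp (- \<epsilon> * \<bar>p i - of_int k\<bar>) * norm (shift_sum (G 0 j) c (p i)))"
proof -
  obtain \<eta> where \<eta>: "\<eta> > 0" "\<And>p \<mu> c B k1. sample_class Q M d L N p \<mu> \<Longrightarrow> B > 0 \<Longrightarrow> (\<forall>k. norm (c k) \<le> B) \<Longrightarrow> B / 2 \<le> norm (c k1) \<Longrightarrow>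
     \<exists>i j. j < \<mu> i \<and> \<eta> * B \<le> norm (shift_sum (G 0 j) c (p i))"
    using sample_lower_sup[OF Q d L, of M] by meson
  obtain C where C: "C \<ge> 0" "\<And>j x. j < M \<Longrightarrow> norm (G 0 j x) \<le> C * exp (- b * \<bar>x\<bar>)"
    using decay_uniform[of M] by blast
  define K where "K = (4 / b) * C * exp_sum_bound (b / 2)"
  have K: "K \<ge> 0" using C b_pos exp_sum_bound_pos[of "b / 2"] by (simp add: K_def)
  \<comment> \<open>Chosen so that the commutator error is at most half of the lower bound
    \<open>\<eta> * S\<close>; \<open>K + 1\<close> guards against \<open>K = 0\<close>.\<close>
  define \<epsilon> where "\<epsilon> = min (b / 4) (\<eta> / (2 * (K + 1)))"
  have "\<eta> / (2 * (K + 1)) > 0" using \<eta>(1) K by simp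
  then have \<epsilon>: "0 < \<epsilon>" "\<epsilon> \<le> b / 4" "\<epsilon> \<le> \<eta> / (2 * (K + 1))"
    unfolding \<epsilon>_def using b_pos by (simp_all only: min.cobounded1 min.cobounded2 min_less_iff_conj) simp
  have "\<epsilon> * (2 * (K + 1)) \<le> \<eta>" using \<epsilon>(3) K by (simp add: pos_le_divide_eq)
  then have \<epsilon>K: "\<epsilon> * K \<le> \<eta> / 2" using \<epsilon>(1) by (simp add: distrib_left)
  have "\<exists>i j. j < \<mu> i \<and> norm (c k0) \<le> 2 / \<eta> * exp (- \<epsilon> * \<bar>p i - of_int k0\<bar>) * norm (shift_sum (G 0 j) c (p i))"
    if cl: "sample_class Q M d L N p \<mu>" and B: "\<And>k. norm (c k) \<le> B" for p \<mu> c B k0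
  proof -
    define e where "e k = complex_of_real (exp (- \<epsilon> * \<bar>real_of_int k - of_int k0\<bar>)) * c k" for k
    have eB: "norm (e k) \<le> B" for k
    proof -
      have "norm (e k) \<le> 1 * norm (c k)" unfolding e_def norm_mult using \<epsilon> by (intro mult_right_mono) auto
      then show ?thesis using B[of k] by simp
    qed
    \<comment> \<open>The weight equals 1 at \<open>k0\<close>, so a bound on the weighted supremum
      \<open>S\<close> bounds \<open>c k0\<close>.\<close>
    define S where "S = (SUP k. norm (e k))"
    have bdd: "bdd_above (range (\<lambda>k. norm (e k)))" by (rule bdd_aboveI2[where M = B]) (rule eB)
    have eS: "norm (e k) \<le> S" for k unfolding S_def by (rule cSUP_upper[OF _ bdd]) simp
    have cS: "norm (c k0) \<le> S" using eS[of k0] by (simp add: e_def)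
    show ?thesis
    proof (cases "S > 0")
      case True
      then have "S / 2 < S" by simp
      then obtain k1 where k1: "S / 2 < norm (e k1)" unfolding S_def less_cSUP_iff[OF UNIV_not_empty bdd] by blast
      obtain i j where ij: "j < \<mu> i" "\<eta> * S \<le> norm (shift_sum (G 0 j) e (p i))"
        using \<eta>(2)[OF cl True, of e k1] eS k1 by auto
      have "\<mu> i \<le> M" using cl unfolding sample_class_def by blast
      then have "j < M" using ij by simp
      have "norm (shift_sum (G 0 j) e (p i) - of_real (exp (- \<epsilon> * \<bar>p i - of_int k0\<bar>)) * shift_sum (G 0 j) c (p i)) \<le> S * (\<epsilon> * (4 / b) * C * exp_sum_bound (b / 2))"
        unfolding e_def
      proof (rule shift_sum_weight_commutator[OF _ \<epsilon>(2) C(1) C(2)[OF \<open>j < M\<close>] B])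
        show "exp (- \<epsilon> * \<bar>real_of_int k - real_of_int k0\<bar>) * norm (c k) \<le> S" for k
          using eS[of k] by (simp add: e_def norm_mult)
      qed (use \<epsilon> in auto)
      also have "\<dots> = S * (\<epsilon> * K)" by (simp add: K_def mult_ac)
      also have "\<dots> \<le> S * (\<eta> / 2)" using \<epsilon>K True by (intro mult_left_mono) auto
      finally have "norm (shift_sum (G 0 j) e (p i)) \<le> norm (of_real (exp (- \<epsilon> * \<bar>p i - of_int k0\<bar>)) * shift_sum (G 0 j) c (p i)) + S * (\<eta> / 2)"
        using norm_triangle_ineq2[of "shift_sum (G 0 j) e (p i)" "of_real (exp (- \<epsilon> * \<bar>p i - of_int k0\<bar>)) * shift_sum (G 0 j) c (p i)"] by linarith
      then have "S * (\<eta> / 2) \<le> exp (- \<epsilon> * \<bar>p i - of_int k0\<bar>) * norm (shift_sum (G 0 j) c (p i))"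
        using ij(2) by (simp add: norm_mult algebra_simps)
      then have "S \<le> 2 / \<eta> * (exp (- \<epsilon> * \<bar>p i - of_int k0\<bar>) * norm (shift_sum (G 0 j) c (p i)))"
        using \<eta>(1) by (simp add: field_simps)
      then show ?thesis using ij(1) cS by (intro exI[of _ i] exI[of _ j]) (auto simp: mult.assoc)
    next
      case False
      then have "norm (c k0) \<le> 0" using cS by linarith
      \<comment> \<open>Here \<open>c k0 = 0\<close>, and any occupied cell serves as witness; one
        exists because \<open>N > 0\<close>.\<close>
      have "N \<le> (\<Sum>i | p i \<in> {0..0 + L}. \<mu> i)" using cl unfolding sample_class_def by blast
      moreover have "N > 0" using L by (cases N) auto
      ultimately obtain i where "\<mu> i \<noteq> 0" by (metis (no_types, lifting) less_le_not_le sum.neutral)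
      then show ?thesis using \<open>norm (c k0) \<le> 0\<close> \<eta>(1) by (intro exI[of _ i] exI[of _ 0]) auto
    qed
  qed
  moreover have "2 / \<eta> > 0" using \<eta>(1) by simp
  ultimately show ?thesis using \<epsilon>(1) by blast
qed

end

section \<open>Norm inequalities\<close>

text \<open>Every \<open>i\<close> has been assigned a single index \<open>\<kappa> i\<close>;
  grouping by it leaves, for each \<open>k\<close>, a sum of weights bounded by
  \<open>S\<close>.\<close>

lemma sum_grouped_le:
  fixes w :: "'i \<Rightarrow> 'k \<Rightarrow> real" and y :: "'k \<Rightarrow> real"
  assumes "finite I" and y: "\<And>k. 0 \<le> y k" and S: "\<And>k. (\<Sum>i\<in>{i \<in> I. \<kappa> i = k}. w i k) \<le> S"
  shows "(\<Sum>i\<in>I. w i (\<kappa> i) * y (\<kappa> i)) \<le> S * (\<Sum>k\<in>\<kappa> ` I. y k)"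
proof -
  have "(\<Sum>i\<in>I. w i (\<kappa> i) * y (\<kappa> i)) = (\<Sum>k\<in>\<kappa> ` I. \<Sum>i\<in>{i \<in> I. \<kappa> i = k}. w i (\<kappa> i) * y (\<kappa> i))"
    by (rule sum.image_gen[OF assms(1)])
  also have "\<dots> = (\<Sum>k\<in>\<kappa> ` I. (\<Sum>i\<in>{i \<in> I. \<kappa> i = k}. w i k) * y k)"
    by (intro sum.cong refl) (simp add: sum_distrib_right)
  also have "\<dots> \<le> (\<Sum>k\<in>\<kappa> ` I. S * y k)"
    by (intro sum_mono mult_right_mono S y)
  finally show ?thesis by (simp add: sum_distrib_left)
qed

lemma in_lp_bounded:
  assumes "in_lp P c" "P \<ge> 1"
  shows "norm (c k) \<le> (\<Sum>\<^sub>\<infinity>k. norm (c k) powr P) powr (1 / P)"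
proof -
  have "norm (c k) powr P = (\<Sum>k\<in>{k}. norm (c k) powr P)" by simp
  also have "\<dots> \<le> (\<Sum>\<^sub>\<infinity>k. norm (c k) powr P)"
    using assms(1) unfolding in_lp_def by (intro finite_sum_le_infsum) auto
  finally have "(norm (c k) powr P) powr (1 / P) \<le> (\<Sum>\<^sub>\<infinity>k. norm (c k) powr P) powr (1 / P)"
    using assms(2) by (intro powr_mono2) auto
  then show ?thesis using assms(2) by (simp add: powr_powr)
qed

text \<open>A convergent sum is dominated by the supremum of its terms against half of the exponential weight;
  this replaces Young's inequality in all the \<open>\<ell>\<^sup>p\<close> estimates below.\<close>
lemma exp_weighted_sum_le_term:
  fixes u :: "int \<Rightarrow> real"
  assumes \<beta>: "\<beta> > 0" and u: "\<And>k. 0 \<le> u k" "\<And>k. u k \<le> B"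
  shows "\<exists>k. (\<Sum>\<^sub>\<infinity>k. u k * exp (- \<beta> * \<bar>x - real_of_int k\<bar>)) \<le> 2 * exp_sum_bound (\<beta> / 2) * (u k * exp (- (\<beta> / 2) * \<bar>x - real_of_int k\<bar>))"
proof -
  have \<beta>2: "\<beta> / 2 > 0" using \<beta> by simp
  define v where "v k = u k * exp (- (\<beta> / 2) * \<bar>x - real_of_int k\<bar>)" for k
  have v: "0 \<le> v k" "v k \<le> B" for k
  proof -
    have "v k \<le> u k * 1" unfolding v_def using \<beta> u by (intro mult_left_mono) auto
    then show "v k \<le> B" using u(2)[of k] by simp
  qed (use u in \<open>auto simp: v_def\<close>)
  have bdd: "bdd_above (range v)" by (rule bdd_aboveI2[where M = B]) (rule v)
  define s where "s = (SUP k. v k)"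
  have vs: "v k \<le> s" for k unfolding s_def by (rule cSUP_upper[OF _ bdd]) simp
  have s0: "0 \<le> s" using v(1)[of 0] vs[of 0] by linarith
  have split: "u k * exp (- \<beta> * \<bar>x - real_of_int k\<bar>) = v k * exp (- (\<beta> / 2) * \<bar>x - real_of_int k\<bar>)" for k
    by (simp add: v_def mult.assoc flip: exp_add)
  have sm: "(\<lambda>k. s * exp (- (\<beta> / 2) * \<bar>x - real_of_int k\<bar>)) summable_on UNIV"
    by (intro summable_on_cmult_right summable_exp_dist_int \<beta>2)
  have "(\<Sum>\<^sub>\<infinity>k. u k * exp (- \<beta> * \<bar>x - real_of_int k\<bar>)) \<le> (\<Sum>\<^sub>\<infinity>k. s * exp (- (\<beta> / 2) * \<bar>x - real_of_int k\<bar>))"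
    unfolding split
  proof (rule infsum_mono[OF _ sm])
    show "(\<lambda>k. v k * exp (- (\<beta> / 2) * \<bar>x - real_of_int k\<bar>)) summable_on UNIV"
      by (rule summable_on_comparison_test[OF sm]) (use v vs in \<open>auto intro: mult_right_mono\<close>)
  qed (use vs in \<open>auto intro: mult_right_mono\<close>)
  also have "\<dots> = s * (\<Sum>\<^sub>\<infinity>k::int. exp (- (\<beta> / 2) * \<bar>x - real_of_int k\<bar>))" by (rule infsum_cmult_right')
  also have "\<dots> \<le> s * exp_sum_bound (\<beta> / 2)"
    by (intro mult_left_mono infsum_exp_dist_int_le \<beta>2 s0)
  finally have le: "(\<Sum>\<^sub>\<infinity>k. u k * exp (- \<beta> * \<bar>x - real_of_int k\<bar>)) \<le> s * exp_sum_bound (\<beta> / 2)" .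
  \<comment> \<open>The supremum need not be attained; the factor 2 buys an actual term.\<close>
  have "\<exists>k. s \<le> 2 * v k"
  proof (cases "s > 0")
    case True
    then have "s / 2 < (SUP k. v k)" by (simp add: s_def)
    then obtain k where "s / 2 < v k" unfolding less_cSUP_iff[OF UNIV_not_empty bdd] by blast
    then show ?thesis by (intro exI[of _ k]) simp
  next
    case False
    then show ?thesis using v(1)[of 0] s0 by (intro exI[of _ 0]) simp
  qed
  then obtain k where "s \<le> 2 * v k" by blast
  then have "s * exp_sum_bound (\<beta> / 2) \<le> 2 * v k * exp_sum_bound (\<beta> / 2)"
    using exp_sum_bound_pos[OF \<beta>2] by (intro mult_right_mono) auto
  with le have "(\<Sum>\<^sub>\<infinity>k. u k * exp (- \<beta> * \<bar>x - real_of_int k\<bar>)) \<le> 2 * exp_sum_bound (\<beta> / 2) * v k"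
    by (simp add: mult_ac)
  then show ?thesis unfolding v_def by blast
qed

definition cells :: "nat \<Rightarrow> (int \<Rightarrow> real) \<Rightarrow> bool" where
  "cells Q q \<longleftrightarrow> (\<forall>i. real_of_int i / real Q \<le> q i \<and> q i \<le> (real_of_int i + 1) / real Q)"

text \<open>Once each weighted sum is replaced by one dominating term, powers can be taken termwise.
  The weight is at most 1 and \<open>P \<ge> 1\<close>, so its power is at most itself, and grouping
  by the dominating index finishes.\<close>

lemma exp_weighted_samples_le:
  assumes \<beta>: "\<beta> > 0" and Q: "Q > 0" and P: "P \<ge> 1"
  shows "\<exists>C>0. \<forall>q c I. cells Q q \<longrightarrow> in_lp P c \<longrightarrow> finite I \<longrightarrow>
    (\<Sum>i\<in>I. (\<Sum>\<^sub>\<infinity>k. norm (c k) * exp (- \<beta> * \<bar>q i - real_of_int k\<bar>)) powr P) \<le> C * (\<Sum>\<^sub>\<infinity>k. norm (c k) powr P)"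
proof -
  define S where "S = 2 * exp_sum_bound (\<beta> / 2)"
  define S' where "S' = exp (\<beta> / 2) * exp_sum_bound (\<beta> / 2 / real Q)"
  have S: "S > 0" "S' > 0" using \<beta> Q exp_sum_bound_pos[of "\<beta> / 2"] exp_sum_bound_pos[of "\<beta> / 2 / real Q"]
    by (auto simp: S_def S'_def)
  have "(\<Sum>i\<in>I. (\<Sum>\<^sub>\<infinity>k. norm (c k) * exp (- \<beta> * \<bar>q i - real_of_int k\<bar>)) powr P) \<le> S powr P * S' * (\<Sum>\<^sub>\<infinity>k. norm (c k) powr P)"
    if q: "cells Q q" and c: "in_lp P c" and I: "finite I" for q c I
  proof -
    have "\<forall>i. \<exists>k. (\<Sum>\<^sub>\<infinity>k. norm (c k) * exp (- \<beta> * \<bar>q i - real_of_int k\<bar>)) \<le> S * (norm (c k) * exp (- (\<beta> / 2) * \<bar>q i - real_of_int k\<bar>))"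
      unfolding S_def using exp_weighted_sum_le_term[OF \<beta>, of "\<lambda>k. norm (c k)", OF norm_ge_zero in_lp_bounded[OF c P]] by blast
    then obtain \<kappa> where \<kappa>: "\<And>i. (\<Sum>\<^sub>\<infinity>k. norm (c k) * exp (- \<beta> * \<bar>q i - real_of_int k\<bar>)) \<le> S * (norm (c (\<kappa> i)) * exp (- (\<beta> / 2) * \<bar>q i - real_of_int (\<kappa> i)\<bar>))"
      by metis
    have "(\<Sum>i\<in>I. (\<Sum>\<^sub>\<infinity>k. norm (c k) * exp (- \<beta> * \<bar>q i - real_of_int k\<bar>)) powr P) \<le>
       (\<Sum>i\<in>I. S powr P * (exp (- (\<beta> / 2) * \<bar>q i - real_of_int (\<kappa> i)\<bar>) * norm (c (\<kappa> i)) powr P))"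
    proof (intro sum_mono)
      fix i
      let ?E = "exp (- (\<beta> / 2) * \<bar>q i - real_of_int (\<kappa> i)\<bar>)"
      have "(\<Sum>\<^sub>\<infinity>k. norm (c k) * exp (- \<beta> * \<bar>q i - real_of_int k\<bar>)) powr P \<le> (S * (norm (c (\<kappa> i)) * ?E)) powr P"
        using P by (intro powr_mono2 \<kappa> infsum_nonneg) auto
      also have "\<dots> = S powr P * (?E powr P * norm (c (\<kappa> i)) powr P)"
        using S by (simp add: powr_mult mult_ac)
      also have "\<dots> \<le> S powr P * (?E * norm (c (\<kappa> i)) powr P)"
      proof -
        have "?E powr P \<le> ?E powr 1" using P \<beta> by (intro powr_mono') auto
        then show ?thesis by (intro mult_left_mono mult_right_mono) auto
      qed
      finally show "(\<Sum>\<^sub>\<infinity>k. norm (c k) * exp (- \<beta> * \<bar>q i - real_of_int k\<bar>)) powr P \<le> S powr P * (?E * norm (c (\<kappa> i)) powr P)" .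
    qed
    also have "\<dots> = S powr P * (\<Sum>i\<in>I. exp (- (\<beta> / 2) * \<bar>q i - real_of_int (\<kappa> i)\<bar>) * norm (c (\<kappa> i)) powr P)"
      by (simp add: sum_distrib_left)
    also have "\<dots> \<le> S powr P * (S' * (\<Sum>k\<in>\<kappa> ` I. norm (c k) powr P))"
    proof (intro mult_left_mono)
      show "(\<Sum>i\<in>I. exp (- (\<beta> / 2) * \<bar>q i - real_of_int (\<kappa> i)\<bar>) * norm (c (\<kappa> i)) powr P) \<le> S' * (\<Sum>k\<in>\<kappa> ` I. norm (c k) powr P)"
        by (rule sum_grouped_le[where w = "\<lambda>i k. exp (- (\<beta> / 2) * \<bar>q i - real_of_int k\<bar>)" and y = "\<lambda>k. norm (c k) powr P", OF I])
           (use exp_dist_cell_sum_le[of "\<beta> / 2" Q _ q] \<beta> Q I q in \<open>auto simp: S'_def cells_def\<close>)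
    qed auto
    also have "\<dots> \<le> S powr P * (S' * (\<Sum>\<^sub>\<infinity>k. norm (c k) powr P))"
      using c S I unfolding in_lp_def by (intro mult_left_mono finite_sum_le_infsum) auto
    finally show ?thesis by (simp add: mult.assoc)
  qed
  then show ?thesis using S by (intro exI[of _ "S powr P * S'"]) auto
qed

context gaussian_chain
begin

lemma shift_sum_le_exp_weighted:
  assumes C: "\<And>x. norm (h x) \<le> C * exp (- b * \<bar>x\<bar>)" and B: "\<And>k. norm (c k) \<le> B"
  shows "norm (shift_sum h c x) \<le> C * (\<Sum>\<^sub>\<infinity>k. norm (c k) * exp (- b * \<bar>x - real_of_int k\<bar>))"
proof (rule norm_infsum_le[OF shift_sum_has_sum[OF b_pos C B] has_sum_cmult_right[OF has_sum_infsum]])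
  show "(\<lambda>k. norm (c k) * exp (- b * \<bar>x - real_of_int k\<bar>)) summable_on UNIV"
    by (rule summable_on_comparison_test[OF summable_on_cmult_right[OF summable_exp_dist_int[OF b_pos], of B]])
       (auto intro: mult_right_mono B)
  show "norm (c k * h (x - real_of_int k)) \<le> C * (norm (c k) * exp (- b * \<bar>x - real_of_int k\<bar>))" for k
    using mult_left_mono[OF C[of "x - real_of_int k"], of "norm (c k)"] by (simp add: norm_mult mult_ac)
qed

lemma samples_upper:
  assumes Q: "Q > 0" and P: "P \<ge> 1"
  shows "\<exists>C>0. \<forall>j<M. \<forall>q c I. cells Q q \<longrightarrow> in_lp P c \<longrightarrow> finite I \<longrightarrow>
    (\<Sum>i\<in>I. norm (shift_sum (G 0 j) c (q i)) powr P) \<le> C * (\<Sum>\<^sub>\<infinity>k. norm (c k) powr P)"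
proof -
  obtain C where C: "C \<ge> 0" "\<And>j x. j < M \<Longrightarrow> norm (G 0 j x) \<le> C * exp (- b * \<bar>x\<bar>)"
    using decay_uniform[of M] by blast
  obtain C' where C': "C' > 0" "\<And>q c I. cells Q q \<Longrightarrow> in_lp P c \<Longrightarrow> finite I \<Longrightarrow>
    (\<Sum>i\<in>I. (\<Sum>\<^sub>\<infinity>k. norm (c k) * exp (- b * \<bar>q i - real_of_int k\<bar>)) powr P) \<le> C' * (\<Sum>\<^sub>\<infinity>k. norm (c k) powr P)"
    using exp_weighted_samples_le[OF b_pos Q P] by blast
  have "(\<Sum>i\<in>I. norm (shift_sum (G 0 j) c (q i)) powr P) \<le> ((C + 1) powr P * C') * (\<Sum>\<^sub>\<infinity>k. norm (c k) powr P)"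
    if j: "j < M" and q: "cells Q q" and c: "in_lp P c" and I: "finite I" for j q c I
  proof -
    have "(\<Sum>i\<in>I. norm (shift_sum (G 0 j) c (q i)) powr P) \<le>
       (\<Sum>i\<in>I. (C + 1) powr P * (\<Sum>\<^sub>\<infinity>k. norm (c k) * exp (- b * \<bar>q i - real_of_int k\<bar>)) powr P)"
    proof (intro sum_mono)
      fix i
      let ?E = "\<Sum>\<^sub>\<infinity>k. norm (c k) * exp (- b * \<bar>q i - real_of_int k\<bar>)"
      have E0: "0 \<le> ?E" by (intro infsum_nonneg) auto
      have "norm (shift_sum (G 0 j) c (q i)) \<le> C * ?E"
        by (rule shift_sum_le_exp_weighted[OF C(2)[OF j] in_lp_bounded[OF c P]])
      also have "\<dots> \<le> (C + 1) * ?E" using E0 by (intro mult_right_mono) auto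
      finally have "norm (shift_sum (G 0 j) c (q i)) powr P \<le> ((C + 1) * ?E) powr P"
        using P by (intro powr_mono2) auto
      then show "norm (shift_sum (G 0 j) c (q i)) powr P \<le> (C + 1) powr P * ?E powr P"
        using C(1) E0 by (simp add: powr_mult)
    qed
    also have "\<dots> = (C + 1) powr P * (\<Sum>i\<in>I. (\<Sum>\<^sub>\<infinity>k. norm (c k) * exp (- b * \<bar>q i - real_of_int k\<bar>)) powr P)"
      by (simp add: sum_distrib_left)
    also have "\<dots> \<le> (C + 1) powr P * (C' * (\<Sum>\<^sub>\<infinity>k. norm (c k) powr P))"
      by (intro mult_left_mono C' q c I) auto
    finally show ?thesis by (simp add: mult.assoc)
  qed
  moreover have "(C + 1) powr P * C' > 0" using C(1) C'(1) by simp
  ultimately show ?thesis by blast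
qed

text \<open>Each coefficient is charged to a sample that dominates it; a fixed cell receives charges
  of total weight at most \<open>exp_sum_bound \<epsilon>\<close>. \<open>Y\<close> bounds finite
  partial sums, so the estimate applies before the sample sum is known to converge, and also with an
  integral as the bound.\<close>

lemma coefficients_le_samples:
  assumes Q: "Q > 0" and d: "0 < d" and L: "0 \<le> L" "L < real N" and P: "P \<ge> 1"
  shows "\<exists>C>0. \<forall>p \<mu> c Y. sample_class Q M d L N p \<mu> \<longrightarrow> in_lp P c \<longrightarrow>
    (\<forall>I. finite I \<longrightarrow> (\<Sum>i\<in>I. \<Sum>j<\<mu> i. norm (shift_sum (G 0 j) c (p i)) powr P) \<le> Y) \<longrightarrow>
    (\<Sum>\<^sub>\<infinity>k. norm (c k) powr P) \<le> C * Y"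
proof -
  obtain \<epsilon> C where \<epsilon>: "\<epsilon> > 0" "C > 0" and dom: "\<And>p \<mu> c B k. sample_class Q M d L N p \<mu> \<Longrightarrow> (\<forall>k. norm (c k) \<le> B) \<Longrightarrow>
     \<exists>i j. j < \<mu> i \<and> norm (c k) \<le> C * exp (- \<epsilon> * \<bar>p i - of_int k\<bar>) * norm (shift_sum (G 0 j) c (p i))"
    using sample_domination[OF Q d L, of M] by blast
  define C' where "C' = C powr P * exp_sum_bound \<epsilon>"
  have C': "C' > 0" using \<epsilon> exp_sum_bound_pos[of \<epsilon>] by (simp add: C'_def)
  have "(\<Sum>\<^sub>\<infinity>k. norm (c k) powr P) \<le> C' * Y"
    if cl: "sample_class Q M d L N p \<mu>" and c: "in_lp P c"
      and Y: "\<And>I. finite I \<Longrightarrow> (\<Sum>i\<in>I. \<Sum>j<\<mu> i. norm (shift_sum (G 0 j) c (p i)) powr P) \<le> Y" for p \<mu> c Y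
  proof -
    define y where "y i = (\<Sum>j<\<mu> i. norm (shift_sum (G 0 j) c (p i)) powr P)" for i
    have y0: "0 \<le> y i" for i by (simp add: y_def sum_nonneg)
    have "\<forall>k. \<exists>i. norm (c k) powr P \<le> C powr P * (exp (- \<epsilon> * \<bar>p i - of_int k\<bar>) * y i)"
    proof
      fix k
      obtain i j where ij: "j < \<mu> i" "norm (c k) \<le> C * exp (- \<epsilon> * \<bar>p i - of_int k\<bar>) * norm (shift_sum (G 0 j) c (p i))"
        using dom[OF cl, of c _ k] in_lp_bounded[OF c P] by blast
      let ?E = "exp (- \<epsilon> * \<bar>p i - of_int k\<bar>)"
      have "norm (c k) powr P \<le> (C * ?E * norm (shift_sum (G 0 j) c (p i))) powr P"
        using P by (intro powr_mono2 ij) auto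
      also have "\<dots> = C powr P * (?E powr P * norm (shift_sum (G 0 j) c (p i)) powr P)"
        using \<epsilon> by (simp add: powr_mult mult_ac)
      also have "\<dots> \<le> C powr P * (?E * y i)"
      proof -
        have "?E powr P \<le> ?E powr 1" using P \<epsilon> by (intro powr_mono') auto
        moreover have "norm (shift_sum (G 0 j) c (p i)) powr P \<le> y i"
          unfolding y_def using ij(1) by (intro member_le_sum) auto
        ultimately show ?thesis by (intro mult_left_mono mult_mono) auto
      qed
      finally show "\<exists>i. norm (c k) powr P \<le> C powr P * (exp (- \<epsilon> * \<bar>p i - of_int k\<bar>) * y i)" by blast
    qed
    then obtain \<iota> where \<iota>: "\<And>k. norm (c k) powr P \<le> C powr P * (exp (- \<epsilon> * \<bar>p (\<iota> k) - of_int k\<bar>) * y (\<iota> k))" by metis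
    show ?thesis
    proof (rule infsum_le_finite_sums)
      show "(\<lambda>k. norm (c k) powr P) summable_on UNIV" using c by (simp add: in_lp_def)
      fix K :: "int set" assume K: "finite K"
      have "(\<Sum>k\<in>K. norm (c k) powr P) \<le> (\<Sum>k\<in>K. C powr P * (exp (- \<epsilon> * \<bar>p (\<iota> k) - of_int k\<bar>) * y (\<iota> k)))"
        by (intro sum_mono \<iota>)
      also have "\<dots> = C powr P * (\<Sum>k\<in>K. exp (- \<epsilon> * \<bar>p (\<iota> k) - of_int k\<bar>) * y (\<iota> k))" by (simp add: sum_distrib_left)
      also have "\<dots> \<le> C powr P * (exp_sum_bound \<epsilon> * (\<Sum>i\<in>\<iota> ` K. y i))"
      proof (intro mult_left_mono)
        show "(\<Sum>k\<in>K. exp (- \<epsilon> * \<bar>p (\<iota> k) - of_int k\<bar>) * y (\<iota> k)) \<le> exp_sum_bound \<epsilon> * (\<Sum>i\<in>\<iota> ` K. y i)"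
          by (rule sum_grouped_le[where w = "\<lambda>k i. exp (- \<epsilon> * \<bar>p i - of_int k\<bar>)", OF K y0 exp_dist_int_sum_le[OF \<epsilon>(1)]])
             (use K in auto)
      qed auto
      also have "\<dots> \<le> C powr P * (exp_sum_bound \<epsilon> * Y)"
        using Y[of "\<iota> ` K"] K exp_sum_bound_pos[OF \<epsilon>(1)] by (intro mult_left_mono) (auto simp: y_def)
      finally show "(\<Sum>k\<in>K. norm (c k) powr P) \<le> C' * Y" by (simp add: C'_def mult.assoc)
    qed
  qed
  then show ?thesis using C' by blast
qed

lemma coefficients_le_samples_sup:
  assumes Q: "Q > 0" and d: "0 < d" and L: "0 \<le> L" "L < real N"
  shows "\<exists>C>0. \<forall>p \<mu> c B k. sample_class Q M d L N p \<mu> \<longrightarrow> (\<forall>k. norm (c k) \<le> B) \<longrightarrow>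
    (\<exists>i j. j < \<mu> i \<and> norm (c k) \<le> C * norm (shift_sum (G 0 j) c (p i)))"
proof -
  obtain \<epsilon> C where \<epsilon>: "\<epsilon> > 0" "C > 0" and dom: "\<And>p \<mu> c B k. sample_class Q M d L N p \<mu> \<Longrightarrow> (\<forall>k. norm (c k) \<le> B) \<Longrightarrow>
     \<exists>i j. j < \<mu> i \<and> norm (c k) \<le> C * exp (- \<epsilon> * \<bar>p i - of_int k\<bar>) * norm (shift_sum (G 0 j) c (p i))"
    using sample_domination[OF Q d L, of M] by blast
  have "\<exists>i j. j < \<mu> i \<and> norm (c k) \<le> C * norm (shift_sum (G 0 j) c (p i))"
    if cl: "sample_class Q M d L N p \<mu>" and B: "\<forall>k. norm (c k) \<le> B" for p \<mu> c B k
  proof -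
    obtain i j where ij: "j < \<mu> i" "norm (c k) \<le> C * exp (- \<epsilon> * \<bar>p i - of_int k\<bar>) * norm (shift_sum (G 0 j) c (p i))"
      using dom[OF cl B, of k] by blast
    have "C * exp (- \<epsilon> * \<bar>p i - of_int k\<bar>) * norm (shift_sum (G 0 j) c (p i)) \<le> C * 1 * norm (shift_sum (G 0 j) c (p i))"
      using \<epsilon> by (intro mult_right_mono mult_left_mono) auto
    then show ?thesis using ij by (intro exI[of _ i] exI[of _ j]) auto
  qed
  then show ?thesis using \<epsilon>(2) by blast
qed

lemma shift_sum_continuous:
  assumes "\<And>k. norm (c k) \<le> B"
  shows "continuous_on X (shift_sum (G 0 j) c)"
proof -
  have "isCont (shift_sum (G 0 j) c) x" for x
    using has_vector_derivative_continuous[OF chain_has_vector_derivative[OF _ assms]] by simp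
  then show ?thesis by (rule continuous_at_imp_continuous_on[rule_format])
qed

end

text \<open>Each point ranges freely over the left half of a cell of length 1/2, so it may be
  adapted to \<open>f\<close>, and the right halves guarantee the gap 1/4. Six points per window of
  length 5 already mean density above 1.\<close>

lemma quarter_cells_sample_class:
  assumes "\<And>i. q i \<in> {real_of_int i / 2..real_of_int i / 2 + 1 / 4}"
  shows "sample_class 2 1 (1 / 4) 5 6 q (\<lambda>i. 1)"
  unfolding sample_class_def
proof (intro conjI allI impI)
  fix i
  show "real_of_int i / real 2 \<le> q i" "q i \<le> (real_of_int i + 1) / real 2" using assms[of i] by (auto simp: field_simps)
  fix i' :: int assume "i \<noteq> i'"
  then have "\<bar>real_of_int i - real_of_int i'\<bar> \<ge> 1" by linarith
  then show "1 / 4 \<le> \<bar>q i - q i'\<bar>"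
    using assms[of i] assms[of i'] unfolding atLeastAtMost_iff by linarith
next
  fix x :: real
  have "{\<lceil>2 * x\<rceil>..\<lceil>2 * x\<rceil> + 5} \<subseteq> {i. q i \<in> {x..x + 5}}"
  proof
    fix i assume "i \<in> {\<lceil>2 * x\<rceil>..\<lceil>2 * x\<rceil> + 5}"
    then have "2 * x \<le> real_of_int i" "real_of_int i \<le> 2 * x + 6" by (auto simp: ceiling_le_iff) linarith
    then show "i \<in> {i. q i \<in> {x..x + 5}}" using assms[of i] by auto
  qed
  moreover have "finite {i. q i \<in> {x..x + 5}}"
  proof (rule finite_subset)
    show "{i. q i \<in> {x..x + 5}} \<subseteq> {\<lfloor>2 * x\<rfloor> - 1..\<lceil>2 * x\<rceil> + 11}"
    proof
      fix i assume "i \<in> {i. q i \<in> {x..x + 5}}"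
      then have "real_of_int i \<le> 2 * x + 10" "2 * x \<le> real_of_int i + 1" using assms[of i] by auto
      then show "i \<in> {\<lfloor>2 * x\<rfloor> - 1..\<lceil>2 * x\<rceil> + 11}" by (auto; linarith)
    qed
  qed auto
  ultimately have "card {\<lceil>2 * x\<rceil>..\<lceil>2 * x\<rceil> + 5} \<le> card {i. q i \<in> {x..x + 5}}" by (rule card_mono[rotated])
  then show "6 \<le> (\<Sum>i | q i \<in> {x..x + 5}. (1::nat))" by simp
qed auto

section \<open>Sums over cells against integrals\<close>

lemma sum_le_integral_quarter_cells:
  fixes F :: "real \<Rightarrow> real"
  assumes F: "integrable lborel F" "\<And>x. 0 \<le> F x" and I: "finite I"
    and y: "\<And>i x. x \<in> {real_of_int i / 2..real_of_int i / 2 + 1 / 4} \<Longrightarrow> y i \<le> F x"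
  shows "(\<Sum>i\<in>I. y i) \<le> 4 * (LINT x|lborel. F x)"
proof -
  let ?A = "\<lambda>i. {real_of_int i / 2..real_of_int i / 2 + 1 / 4}"
  have int: "integrable lborel (\<lambda>x. y i * indicator (?A i) x)" for i
    by (intro integrable_mult_right integrable_real_indicator) auto
  have "(LINT x|lborel. (\<Sum>i\<in>I. y i * indicator (?A i) x)) = (\<Sum>i\<in>I. y i / 4)"
    by (subst Bochner_Integration.integral_sum[OF int]) (simp add: measure_def)
  moreover have "(LINT x|lborel. (\<Sum>i\<in>I. y i * indicator (?A i) x)) \<le> (LINT x|lborel. F x)"
  proof (rule integral_mono[OF Bochner_Integration.integrable_sum[OF int] F(1)])
    fix x
    \<comment> \<open>The quarter cells are disjoint, so at most one indicator is nonzero at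
      \<open>x\<close>.\<close>
    have fl: "i = \<lfloor>2 * x\<rfloor>" if "x \<in> ?A i" for i
      using that unfolding atLeastAtMost_iff by linarith
    have "(\<Sum>i\<in>I. y i * indicator (?A i) x) = (\<Sum>i\<in>I. if i = \<lfloor>2 * x\<rfloor> then y i * indicator (?A i) x else 0)"
      by (intro sum.cong refl) (use fl in \<open>auto simp: indicator_def\<close>)
    also have "\<dots> \<le> F x"
      using y[of x "\<lfloor>2 * x\<rfloor>"] F(2)[of x] I by (auto simp: indicator_def)
    finally show "(\<Sum>i\<in>I. y i * indicator (?A i) x) \<le> F x" .
  qed
  ultimately show ?thesis by (simp add: sum_divide_distrib[symmetric])
qed

text \<open>Integrability is part of the conclusion, hence the truncation to \<open>{- N..N}\<close>
  followed by monotone convergence. Neighbouring cells share an endpoint, which is harmless for an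
  upper bound.\<close>

lemma integral_le_unit_cells:
  fixes F :: "real \<Rightarrow> real"
  assumes F: "continuous_on UNIV F" "\<And>x. 0 \<le> F x"
    and y: "\<And>i x. x \<in> {real_of_int i..real_of_int i + 1} \<Longrightarrow> F x \<le> y i"
    and Y: "\<And>I. finite I \<Longrightarrow> (\<Sum>i\<in>I. y i) \<le> Y"
  shows "integrable lborel F" "(LINT x|lborel. F x) \<le> Y"
proof -
  define h where "h N x = indicator {- real N..real N} x * F x" for N :: nat and x
  have y0: "0 \<le> y i" for i using y[of "real_of_int i" i] F(2)[of "real_of_int i"] by auto
  have hi: "integrable lborel (h N)" for N
    unfolding h_def real_scaleR_def[symmetric]
    by (rule borel_integrable_compact) (auto intro: continuous_on_subset[OF F(1)])
  have bound: "(LINT x|lborel. h N x) \<le> Y" for N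
  proof -
    let ?J = "{- int N..int N}"
    let ?A = "\<lambda>i. {real_of_int i..real_of_int i + 1}"
    have int: "integrable lborel (\<lambda>x. y i * indicator (?A i) x)" for i
      by (intro integrable_mult_right integrable_real_indicator) auto
    have "(LINT x|lborel. h N x) \<le> (LINT x|lborel. (\<Sum>i\<in>?J. y i * indicator (?A i) x))"
    proof (rule integral_mono[OF hi Bochner_Integration.integrable_sum[OF int]])
      fix x
      show "h N x \<le> (\<Sum>i\<in>?J. y i * indicator (?A i) x)"
      proof (cases "x \<in> {- real N..real N}")
        case True
        then have J: "\<lfloor>x\<rfloor> \<in> ?J" by (auto simp: le_floor_iff floor_le_iff)
        have x: "x \<in> ?A \<lfloor>x\<rfloor>" unfolding atLeastAtMost_iff by linarith
        have "h N x \<le> y \<lfloor>x\<rfloor> * indicator (?A \<lfloor>x\<rfloor>) x" using y[OF x] x True by (simp add: h_def)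
        also have "\<dots> \<le> (\<Sum>i\<in>?J. y i * indicator (?A i) x)"
          by (rule member_le_sum[OF J]) (use y0 in auto)
        finally show ?thesis .
      next
        case False
        then show ?thesis using y0 by (auto simp: h_def intro!: sum_nonneg)
      qed
    qed
    also have "\<dots> = (\<Sum>i\<in>?J. y i)"
      by (subst Bochner_Integration.integral_sum[OF int]) (simp add: measure_def)
    also have "\<dots> \<le> Y" by (rule Y) simp
    finally show ?thesis .
  qed
  have mono: "mono (\<lambda>N. h N x)" for x
    by (intro monoI) (use F(2) in \<open>auto simp: h_def indicator_def\<close>)
  have lim: "(\<lambda>N. h N x) \<longlonglongrightarrow> F x" for x
  proof (rule tendsto_eventually)
    obtain N0 :: nat where N0: "\<bar>x\<bar> \<le> real N0" using real_arch_simple by blast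
    have "h N x = F x" if "N \<ge> N0" for N
    proof -
      have "real N0 \<le> real N" using that by simp
      then have "x \<in> {- real N..real N}" using N0 unfolding atLeastAtMost_iff by linarith
      then show ?thesis by (simp add: h_def)
    qed
    then show "\<forall>\<^sub>F N in sequentially. h N x = F x" by (auto simp: eventually_sequentially)
  qed
  have "mono (\<lambda>N. LINT x|lborel. h N x)"
    by (intro monoI integral_mono hi) (use mono in \<open>auto simp: mono_def\<close>)
  then obtain l where l: "(\<lambda>N. LINT x|lborel. h N x) \<longlonglongrightarrow> l" "\<And>N. (LINT x|lborel. h N x) \<le> l"
    using incseq_convergent[of "\<lambda>N. LINT x|lborel. h N x" Y] bound by blast
  have "F \<in> borel_measurable lborel" using F(1) by (simp add: borel_measurable_continuous_onI)
  then have hb: "has_bochner_integral lborel F l"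
    by (intro has_bochner_integral_monotone_convergence[OF hi]) (use mono lim l in auto)
  have "l \<le> Y" by (rule LIMSEQ_le_const2[OF l(1)]) (use bound in auto)
  then show "integrable lborel F" "(LINT x|lborel. F x) \<le> Y"
    using hb by (auto simp: has_bochner_integral_iff)
qed

context gaussian_chain
begin

text \<open>Sampling at a minimiser of the modulus on each quarter cell makes the sample sum a lower
  Riemann sum, at most 4 times the integral. The points depend on \<open>c\<close>, which the
  uniform constant permits.\<close>

lemma coefficients_le_Lp:
  assumes P: "P \<ge> 1"
  shows "\<exists>C>0. \<forall>c. in_lp P c \<longrightarrow> in_Lp P (shift_sum (G 0 0) c) \<longrightarrow>
     (\<Sum>\<^sub>\<infinity>k. norm (c k) powr P) \<le> C * Lp_norm_pow P (shift_sum (G 0 0) c)"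
proof -
  obtain C where C: "C > 0" "\<And>p \<mu> c Y. sample_class 2 1 (1 / 4) 5 6 p \<mu> \<Longrightarrow> in_lp P c \<Longrightarrow>
    (\<forall>I. finite I \<longrightarrow> (\<Sum>i\<in>I. \<Sum>j<\<mu> i. norm (shift_sum (G 0 j) c (p i)) powr P) \<le> Y) \<Longrightarrow>
    (\<Sum>\<^sub>\<infinity>k. norm (c k) powr P) \<le> C * Y"
    using coefficients_le_samples[of 2 "1 / 4" 5 6 P 1] P by auto
  have "(\<Sum>\<^sub>\<infinity>k. norm (c k) powr P) \<le> (C * 4) * Lp_norm_pow P (shift_sum (G 0 0) c)"
    if c: "in_lp P c" and f: "in_Lp P (shift_sum (G 0 0) c)" for c
  proof -
    let ?f = "shift_sum (G 0 0) c"
    have "\<forall>i. \<exists>q. q \<in> {real_of_int i / 2..real_of_int i / 2 + 1 / 4} \<and>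
        (\<forall>x\<in>{real_of_int i / 2..real_of_int i / 2 + 1 / 4}. norm (?f q) \<le> norm (?f x))"
    proof
      fix i
      have "continuous_on {real_of_int i / 2..real_of_int i / 2 + 1 / 4} (\<lambda>x. norm (?f x))"
        by (intro continuous_on_norm shift_sum_continuous[OF in_lp_bounded[OF c P]])
      from continuous_attains_inf[OF _ _ this]
      show "\<exists>q. q \<in> {real_of_int i / 2..real_of_int i / 2 + 1 / 4} \<and>
        (\<forall>x\<in>{real_of_int i / 2..real_of_int i / 2 + 1 / 4}. norm (?f q) \<le> norm (?f x))" by auto
    qed
    then obtain q where q: "\<And>i. q i \<in> {real_of_int i / 2..real_of_int i / 2 + 1 / 4}"
      "\<And>i x. x \<in> {real_of_int i / 2..real_of_int i / 2 + 1 / 4} \<Longrightarrow> norm (?f (q i)) \<le> norm (?f x)"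
      by metis
    have "(\<Sum>\<^sub>\<infinity>k. norm (c k) powr P) \<le> C * (4 * Lp_norm_pow P ?f)"
    proof (rule C(2)[OF quarter_cells_sample_class[OF q(1)] c], intro allI impI)
      fix I :: "int set" assume I: "finite I"
      have "(\<Sum>i\<in>I. norm (?f (q i)) powr P) \<le> 4 * (LINT x|lborel. norm (?f x) powr P)"
        using f unfolding in_Lp_def
        by (intro sum_le_integral_quarter_cells I powr_mono2 q(2)) (use P in auto)
      then show "(\<Sum>i\<in>I. \<Sum>j<1. norm (shift_sum (G 0 j) c (q i)) powr P) \<le> 4 * Lp_norm_pow P ?f"
        by (simp add: Lp_norm_pow_def)
    qed
    then show ?thesis by (simp add: mult.assoc)
  qed
  moreover have "C * 4 > 0" using C(1) by simp
  ultimately show ?thesis by blast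
qed

text \<open>Dually, maximisers on unit cells turn the upper sampling bound into a bound for the
  integral.\<close>

lemma Lp_le_coefficients:
  assumes P: "P \<ge> 1"
  shows "\<exists>C>0. \<forall>c. in_lp P c \<longrightarrow> in_Lp P (shift_sum (G 0 0) c) \<and>
     Lp_norm_pow P (shift_sum (G 0 0) c) \<le> C * (\<Sum>\<^sub>\<infinity>k. norm (c k) powr P)"
proof -
  obtain C where C: "C > 0" "\<And>q c I. cells 1 q \<Longrightarrow> in_lp P c \<Longrightarrow> finite I \<Longrightarrow>
    (\<Sum>i\<in>I. norm (shift_sum (G 0 0) c (q i)) powr P) \<le> C * (\<Sum>\<^sub>\<infinity>k. norm (c k) powr P)"
    using samples_upper[of 1 P 1] P by auto
  have "in_Lp P (shift_sum (G 0 0) c) \<and>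
     Lp_norm_pow P (shift_sum (G 0 0) c) \<le> C * (\<Sum>\<^sub>\<infinity>k. norm (c k) powr P)"
    if c: "in_lp P c" for c
  proof -
    let ?f = "shift_sum (G 0 0) c"
    have cont: "continuous_on X ?f" for X by (rule shift_sum_continuous[OF in_lp_bounded[OF c P]])
    have "\<forall>i. \<exists>q. q \<in> {real_of_int i..real_of_int i + 1} \<and>
        (\<forall>x\<in>{real_of_int i..real_of_int i + 1}. norm (?f x) \<le> norm (?f q))"
    proof
      fix i
      have "continuous_on {real_of_int i..real_of_int i + 1} (\<lambda>x. norm (?f x))"
        by (intro continuous_on_norm cont)
      from continuous_attains_sup[OF _ _ this]
      show "\<exists>q. q \<in> {real_of_int i..real_of_int i + 1} \<and>
        (\<forall>x\<in>{real_of_int i..real_of_int i + 1}. norm (?f x) \<le> norm (?f q))" by auto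
    qed
    then obtain q where q: "\<And>i. q i \<in> {real_of_int i..real_of_int i + 1}"
      "\<And>i x. x \<in> {real_of_int i..real_of_int i + 1} \<Longrightarrow> norm (?f x) \<le> norm (?f (q i))"
      by metis
    have cells: "cells 1 q" using q(1) by (auto simp: cells_def)
    have cF: "continuous_on UNIV (\<lambda>x. norm (?f x) powr P)"
      using P by (intro continuous_on_powr' continuous_on_norm cont continuous_on_const) auto
    have "integrable lborel (\<lambda>x. norm (?f x) powr P)"
         "(LINT x|lborel. norm (?f x) powr P) \<le> C * (\<Sum>\<^sub>\<infinity>k. norm (c k) powr P)"
      by (rule integral_le_unit_cells[OF cF _ _ C(2)[OF cells c]]; use P q in \<open>auto intro: powr_mono2\<close>)+
    moreover have "?f \<in> borel_measurable lborel"
      using cont[of UNIV] by (simp add: borel_measurable_continuous_onI)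
    ultimately show ?thesis by (simp add: in_Lp_def Lp_norm_pow_def)
  qed
  then show ?thesis using C(1) by blast
qed

end

section \<open>Essential suprema of continuous functions\<close>

lemma norm_le_Linf_norm:
  assumes "continuous_on UNIV f"
  shows "ereal (norm (f x)) \<le> Linf_norm f"
proof (rule ccontr)
  assume "\<not> ?thesis"
  then have lt: "Linf_norm f < ereal (norm (f x))" by simp
  let ?S = "{y. Linf_norm f < ereal (norm (f y))}"
  have meas: "f \<in> borel_measurable lborel" using assms by (simp add: borel_measurable_continuous_onI)
  have "AE y in lborel. ereal (norm (f y)) \<le> Linf_norm f"
    unfolding Linf_norm_def by (rule esssup_AE)
  then have null: "emeasure lborel ?S = 0"
    using meas by (subst (asm) AE_iff_measurable[where N = ?S]) (auto simp: not_le)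
  \<comment> \<open>An open set containing \<open>x\<close> contains a ball of positive measure,
    although \<open>?S\<close> is null.\<close>
  have "open ?S"
  proof -
    have "continuous_on UNIV (\<lambda>y. ereal (norm (f y)))"
      by (intro continuous_intros assms)
    then show ?thesis using open_Collect_less[of "\<lambda>_. Linf_norm f" "\<lambda>y. ereal (norm (f y))"] by (simp add: continuous_on_const)
  qed
  then obtain e where e: "e > 0" "ball x e \<subseteq> ?S" using lt openE by blast
  have "emeasure lborel (ball x e) \<le> emeasure lborel ?S"
    using \<open>open ?S\<close> by (intro emeasure_mono e) auto
  then have "emeasure lborel (ball x e) = 0" using null by simp
  moreover have "emeasure lborel (ball x e) = ennreal (2 * e)"
    using e(1) by (simp add: ball_eq_greaterThanLessThan)
  ultimately show False using e(1) by simp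
qed

lemma Linf_norm_le:
  assumes "f \<in> borel_measurable lborel" "\<And>x. norm (f x) \<le> B"
  shows "Linf_norm f \<le> ereal B"
  unfolding Linf_norm_def by (rule esssup_I) (use assms in auto)

section \<open>Totally positive functions of Gaussian type\<close>

lemma integrable_abs_power_gaussian:
  fixes c :: real
  assumes "c > 0"
  shows "integrable lborel (\<lambda>\<xi>. \<bar>\<xi>\<bar> ^ j * exp (- c * \<xi>\<^sup>2))"
proof -
  \<comment> \<open>\<open>r\<close> makes
    \<open>(r * \<xi>)\<^sup>2 / 2 = c * \<xi>\<^sup>2\<close>, which reduces the claim to a moment
    of the standard normal density.\<close>
  define r where "r = sqrt (2 * c)"
  have r: "r > 0" "r\<^sup>2 = 2 * c" using assms by (auto simp: r_def)
  have "integrable lborel (\<lambda>\<xi>. std_normal_density (0 + r * \<xi>) * \<bar>0 + r * \<xi>\<bar> ^ j)"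
    by (rule lborel_integrable_real_affine[OF integrable_std_normal_moment_abs]) (use r in auto)
  then have "integrable lborel (\<lambda>\<xi>. (sqrt (2 * pi) / r ^ j) * (std_normal_density (0 + r * \<xi>) * \<bar>0 + r * \<xi>\<bar> ^ j))"
    by (rule integrable_mult_right)
  moreover have "(sqrt (2 * pi) / r ^ j) * (std_normal_density (0 + r * \<xi>) * \<bar>0 + r * \<xi>\<bar> ^ j) = \<bar>\<xi>\<bar> ^ j * exp (- c * \<xi>\<^sup>2)" for \<xi>
    using r by (simp add: std_normal_density_def power_mult_distrib abs_mult field_simps)
  ultimately show ?thesis by simp
qed

text \<open>This is the characteristic function of the standard normal law at \<open>t\<close>,
  after the substitution \<open>y = r * \<xi>\<close>.\<close>

lemma gaussian_fourier_integral:
  fixes c x :: real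
  assumes "c > 0"
  shows "(LINT \<xi>|lborel. complex_of_real (exp (- c * \<xi>\<^sup>2)) * iexp (2 * pi * x * \<xi>)) =
    complex_of_real (sqrt (pi / c) * exp (- (pi\<^sup>2 / c) * x\<^sup>2))"
proof -
  define r where "r = sqrt (2 * c)"
  have r: "r > 0" "r\<^sup>2 = 2 * c" using assms by (auto simp: r_def)
  define t where "t = 2 * pi * x / r"
  have "complex_of_real (exp (- (t\<^sup>2) / 2)) = char std_normal_distribution t"
    by (simp add: char_std_normal_distribution)
  also have "\<dots> = (LINT y|lborel. std_normal_density y *\<^sub>R iexp (t * y))"
    unfolding char_def by (subst integral_density) auto
  also have "\<dots> = \<bar>r\<bar> *\<^sub>R (LINT \<xi>|lborel. std_normal_density (0 + r * \<xi>) *\<^sub>R iexp (t * (0 + r * \<xi>)))"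
    using r by (intro lborel_integral_real_affine) auto
  also have "(\<lambda>\<xi>. std_normal_density (0 + r * \<xi>) *\<^sub>R iexp (t * (0 + r * \<xi>))) =
     (\<lambda>\<xi>. complex_of_real (1 / sqrt (2 * pi)) * (complex_of_real (exp (- c * \<xi>\<^sup>2)) * iexp (2 * pi * x * \<xi>)))"
  proof
    fix \<xi>
    have "std_normal_density (0 + r * \<xi>) = 1 / sqrt (2 * pi) * exp (- c * \<xi>\<^sup>2)"
      using r by (simp add: std_normal_density_def power_mult_distrib)
    moreover have "t * (0 + r * \<xi>) = 2 * pi * x * \<xi>" using r by (simp add: t_def)
    ultimately show "std_normal_density (0 + r * \<xi>) *\<^sub>R iexp (t * (0 + r * \<xi>)) =
      complex_of_real (1 / sqrt (2 * pi)) * (complex_of_real (exp (- c * \<xi>\<^sup>2)) * iexp (2 * pi * x * \<xi>))"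
      by (simp only: scaleR_conv_of_real of_real_mult mult.assoc)
  qed
  also have "\<bar>r\<bar> *\<^sub>R (LINT \<xi>|lborel. complex_of_real (1 / sqrt (2 * pi)) * (complex_of_real (exp (- c * \<xi>\<^sup>2)) * iexp (2 * pi * x * \<xi>)))
     = complex_of_real (r / sqrt (2 * pi)) * (LINT \<xi>|lborel. complex_of_real (exp (- c * \<xi>\<^sup>2)) * iexp (2 * pi * x * \<xi>))"
    using r by (subst integral_mult_right_zero) (simp add: scaleR_conv_of_real)
  finally have eq: "complex_of_real (exp (- (t\<^sup>2) / 2)) =
     complex_of_real (r / sqrt (2 * pi)) * (LINT \<xi>|lborel. complex_of_real (exp (- c * \<xi>\<^sup>2)) * iexp (2 * pi * x * \<xi>))" .
  have "sqrt (2 * pi) / r = sqrt (pi / c)" using assms by (simp add: r_def real_sqrt_divide real_sqrt_mult)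
  moreover have "- (t\<^sup>2) / 2 = - (pi\<^sup>2 / c) * x\<^sup>2"
    using r assms by (simp add: t_def power_divide power_mult_distrib)
  moreover have "complex_of_real (sqrt (2 * pi) / r) * complex_of_real (r / sqrt (2 * pi)) = 1"
    using r by (simp flip: of_real_mult)
  ultimately show ?thesis using arg_cong[OF eq, of "\<lambda>z. complex_of_real (sqrt (2 * pi) / r) * z"]
    by (simp only: of_real_mult mult.assoc[symmetric] mult_1_left)
qed

lemma norm_one_plus_imaginary_inverse_le: "norm (inverse (1 + 2 * pi * \<i> * complex_of_real s)) \<le> 1"
proof -
  have "1 \<le> norm (1 + 2 * pi * \<i> * complex_of_real s)"
    using abs_Re_le_cmod[of "1 + 2 * pi * \<i> * complex_of_real s"] by simp
  then show ?thesis by (simp add: norm_inverse inverse_le_1_iff)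
qed

lemma one_plus_imaginary_nonzero: "1 + 2 * pi * \<i> * complex_of_real s \<noteq> 0"
  by (simp add: complex_eq_iff)

text \<open>The Fourier transform of the j-th derivative of the function that keeps the factors from
  \<open>i\<close> on; the power in front expresses differentiation.\<close>

definition chain_symbol :: "nat \<Rightarrow> (nat \<Rightarrow> real) \<Rightarrow> real \<Rightarrow> nat \<Rightarrow> nat \<Rightarrow> real \<Rightarrow> complex" where
  "chain_symbol n \<delta> c i j \<xi> = (\<i> * complex_of_real (2 * pi * \<xi>)) ^ j *
     (\<Prod>l\<in>{i..<n}. inverse (1 + 2 * pi * \<i> * complex_of_real (\<delta> l * \<xi>))) * complex_of_real (exp (- c * \<xi>\<^sup>2))"

definition chain_function :: "nat \<Rightarrow> (nat \<Rightarrow> real) \<Rightarrow> real \<Rightarrow> nat \<Rightarrow> nat \<Rightarrow> real \<Rightarrow> complex" where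
  "chain_function n \<delta> c i j x = (LINT \<xi>|lborel. chain_symbol n \<delta> c i j \<xi> * iexp (2 * pi * x * \<xi>))"

context
  fixes n :: nat and \<delta> :: "nat \<Rightarrow> real" and c :: real
  assumes c: "c > 0"
begin

lemma chain_symbol_le: "norm (chain_symbol n \<delta> c i j \<xi>) \<le> (2 * pi) ^ j * (\<bar>\<xi>\<bar> ^ j * exp (- c * \<xi>\<^sup>2))"
proof -
  have "norm (\<Prod>l\<in>{i..<n}. inverse (1 + 2 * pi * \<i> * complex_of_real (\<delta> l * \<xi>))) \<le> 1"
    unfolding prod_norm[symmetric] by (intro prod_le_1 conjI norm_one_plus_imaginary_inverse_le norm_ge_zero)
  then have "(2 * pi * \<bar>\<xi>\<bar>) ^ j * norm (\<Prod>l\<in>{i..<n}. inverse (1 + 2 * pi * \<i> * complex_of_real (\<delta> l * \<xi>))) * exp (- c * \<xi>\<^sup>2)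
     \<le> (2 * pi * \<bar>\<xi>\<bar>) ^ j * 1 * exp (- c * \<xi>\<^sup>2)"
    by (intro mult_right_mono mult_left_mono) auto
  then show ?thesis
    by (simp add: chain_symbol_def norm_mult norm_power abs_mult power_mult_distrib mult.assoc)
qed

lemma chain_symbol_measurable[measurable]: "chain_symbol n \<delta> c i j \<in> borel_measurable borel"
  unfolding chain_symbol_def by measurable

lemma chain_symbol_integrable: "integrable lborel (chain_symbol n \<delta> c i j)"
proof (rule Bochner_Integration.integrable_bound)
  show "integrable lborel (\<lambda>\<xi>. (2 * pi) ^ j * (\<bar>\<xi>\<bar> ^ j * exp (- c * \<xi>\<^sup>2)))"
    by (rule integrable_mult_right[OF integrable_abs_power_gaussian[OF c]])
  show "AE \<xi> in lborel. norm (chain_symbol n \<delta> c i j \<xi>) \<le> norm ((2 * pi) ^ j * (\<bar>\<xi>\<bar> ^ j * exp (- c * \<xi>\<^sup>2)))"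
    using chain_symbol_le by (intro AE_I2) (simp add: abs_mult)
qed simp

lemma chain_integrand_integrable: "integrable lborel (\<lambda>\<xi>. chain_symbol n \<delta> c i j \<xi> * iexp (2 * pi * x * \<xi>))"
  by (rule Bochner_Integration.integrable_bound[OF chain_symbol_integrable[of i j]])
     (auto simp: norm_mult)

lemma chain_function_bounded: "norm (chain_function n \<delta> c i j x) \<le> (LINT \<xi>|lborel. norm (chain_symbol n \<delta> c i j \<xi>))"
proof -
  have "norm (chain_function n \<delta> c i j x) \<le> (LINT \<xi>|lborel. norm (chain_symbol n \<delta> c i j \<xi> * iexp (2 * pi * x * \<xi>)))"
    unfolding chain_function_def by (rule integral_norm_bound)
  then show ?thesis by (simp add: norm_mult)
qed

text \<open>The remainder of \<open>iexp\<close> after its linear term is at most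
  \<open>s\<^sup>2\<close>, and in modulus \<open>s\<^sup>2\<close> times the symbol of order
  \<open>j\<close> is \<open>t\<^sup>2\<close> times the integrable symbol of order
  \<open>j + 2\<close>.\<close>

lemma chain_function_has_vector_derivative:
  "(chain_function n \<delta> c i j has_vector_derivative chain_function n \<delta> c i (Suc j) x) (at x)"
proof (rule has_vector_derivative_quadraticI)
  fix t :: real
  let ?S = "chain_symbol n \<delta> c i j" and ?S1 = "chain_symbol n \<delta> c i (Suc j)" and ?S2 = "chain_symbol n \<delta> c i (Suc (Suc j))"
  have eq: "chain_function n \<delta> c i j (x + t) - chain_function n \<delta> c i j x - t *\<^sub>R chain_function n \<delta> c i (Suc j) x =
    (LINT \<xi>|lborel. ?S \<xi> * iexp (2 * pi * (x + t) * \<xi>) - ?S \<xi> * iexp (2 * pi * x * \<xi>) - t *\<^sub>R (?S1 \<xi> * iexp (2 * pi * x * \<xi>)))"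
    unfolding chain_function_def
    by (simp only: Bochner_Integration.integral_diff Bochner_Integration.integrable_diff integrable_scaleR_right
          chain_integrand_integrable integral_scaleR_right)
  have "norm (LINT \<xi>|lborel. ?S \<xi> * iexp (2 * pi * (x + t) * \<xi>) - ?S \<xi> * iexp (2 * pi * x * \<xi>) - t *\<^sub>R (?S1 \<xi> * iexp (2 * pi * x * \<xi>)))
    \<le> (LINT \<xi>|lborel. t\<^sup>2 * norm (?S2 \<xi>))"
  proof (rule order_trans[OF integral_norm_bound integral_mono[OF integrable_norm]])
    show "integrable lborel (\<lambda>\<xi>. ?S \<xi> * iexp (2 * pi * (x + t) * \<xi>) - ?S \<xi> * iexp (2 * pi * x * \<xi>) - t *\<^sub>R (?S1 \<xi> * iexp (2 * pi * x * \<xi>)))"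
      by (intro Bochner_Integration.integrable_diff integrable_scaleR_right chain_integrand_integrable)
    show "integrable lborel (\<lambda>\<xi>. t\<^sup>2 * norm (?S2 \<xi>))"
      by (intro integrable_mult_right integrable_norm chain_symbol_integrable)
    fix \<xi>
    define s where "s = 2 * pi * t * \<xi>"
    have S1: "?S1 \<xi> = (\<i> * complex_of_real (2 * pi * \<xi>)) * ?S \<xi>" and S2: "?S2 \<xi> = (\<i> * complex_of_real (2 * pi * \<xi>))\<^sup>2 * ?S \<xi>"
      by (simp_all add: chain_symbol_def power2_eq_square mult_ac)
    have ex: "iexp (2 * pi * (x + t) * \<xi>) = iexp (2 * pi * x * \<xi>) * iexp s"
      by (simp add: s_def algebra_simps flip: exp_add)
    have st: "t *\<^sub>R (?S1 \<xi> * iexp (2 * pi * x * \<xi>)) = ?S \<xi> * iexp (2 * pi * x * \<xi>) * (\<i> * s)"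
      by (simp add: S1 s_def scaleR_conv_of_real mult_ac)
    have "?S \<xi> * iexp (2 * pi * (x + t) * \<xi>) - ?S \<xi> * iexp (2 * pi * x * \<xi>) - t *\<^sub>R (?S1 \<xi> * iexp (2 * pi * x * \<xi>)) =
      ?S \<xi> * iexp (2 * pi * x * \<xi>) * (iexp s - (1 + \<i> * s))"
      unfolding ex st by (simp add: algebra_simps)
    also have "norm \<dots> = norm (?S \<xi>) * norm (iexp s - (1 + \<i> * s))" by (simp add: norm_mult)
    also have "\<dots> \<le> norm (?S \<xi>) * s\<^sup>2"
    proof (intro mult_left_mono)
      have "norm (iexp s - (1 + \<i> * s)) \<le> s\<^sup>2 / 2" using iexp_approx1[of s 1] by (simp add: numeral_2_eq_2)
      then show "norm (iexp s - (1 + \<i> * s)) \<le> s\<^sup>2" by (smt (verit) zero_le_power2 field_sum_of_halves)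
    qed auto
    also have "\<dots> = t\<^sup>2 * norm (?S2 \<xi>)"
      by (simp add: S2 s_def norm_mult norm_power power_mult_distrib mult_ac)
    finally show "norm (?S \<xi> * iexp (2 * pi * (x + t) * \<xi>) - ?S \<xi> * iexp (2 * pi * x * \<xi>) - t *\<^sub>R (?S1 \<xi> * iexp (2 * pi * x * \<xi>))) \<le> t\<^sup>2 * norm (?S2 \<xi>)" .
  qed
  then show "norm (chain_function n \<delta> c i j (x + t) - chain_function n \<delta> c i j x - t *\<^sub>R chain_function n \<delta> c i (Suc j) x)
     \<le> (LINT \<xi>|lborel. norm (?S2 \<xi>)) * t\<^sup>2"
    unfolding eq integral_mult_right_zero by (simp only: mult.commute)
qed

text \<open>The operator multiplies the symbol by
  \<open>1 + 2 * pi * \<i> * \<delta> i * \<xi>\<close>, which cancels the factor of index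
  \<open>i\<close>.\<close>

lemma chain_function_step:
  assumes "i < n"
  shows "chain_function n \<delta> c i j x + complex_of_real (\<delta> i) * chain_function n \<delta> c i (Suc j) x = chain_function n \<delta> c (Suc i) j x"
proof -
  have "chain_function n \<delta> c i j x + complex_of_real (\<delta> i) * chain_function n \<delta> c i (Suc j) x =
    (LINT \<xi>|lborel. chain_symbol n \<delta> c i j \<xi> * iexp (2 * pi * x * \<xi>) + complex_of_real (\<delta> i) * (chain_symbol n \<delta> c i (Suc j) \<xi> * iexp (2 * pi * x * \<xi>)))"
    unfolding chain_function_def
    by (simp only: Bochner_Integration.integral_add integrable_mult_right chain_integrand_integrable integral_mult_right_zero)
  also have "\<dots> = chain_function n \<delta> c (Suc i) j x"
    unfolding chain_function_def
  proof (intro Bochner_Integration.integral_cong refl)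
    fix \<xi>
    let ?D = "1 + 2 * pi * \<i> * complex_of_real (\<delta> i * \<xi>)"
    have "{i..<n} = insert i {Suc i..<n}" using assms by auto
    then have pr: "(\<Prod>l\<in>{i..<n}. inverse (1 + 2 * pi * \<i> * complex_of_real (\<delta> l * \<xi>))) =
       inverse ?D * (\<Prod>l\<in>{Suc i..<n}. inverse (1 + 2 * pi * \<i> * complex_of_real (\<delta> l * \<xi>)))" by simp
    have "chain_symbol n \<delta> c i j \<xi> + complex_of_real (\<delta> i) * chain_symbol n \<delta> c i (Suc j) \<xi> = ?D * chain_symbol n \<delta> c i j \<xi>"
      by (simp add: chain_symbol_def algebra_simps)
    also have "\<dots> = (?D * inverse ?D) * chain_symbol n \<delta> c (Suc i) j \<xi>"
      unfolding chain_symbol_def pr by (simp only: mult_ac)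
    also have "\<dots> = chain_symbol n \<delta> c (Suc i) j \<xi>"
      using one_plus_imaginary_nonzero[of "\<delta> i * \<xi>"] by simp
    finally show "chain_symbol n \<delta> c i j \<xi> * iexp (2 * pi * x * \<xi>) + complex_of_real (\<delta> i) * (chain_symbol n \<delta> c i (Suc j) \<xi> * iexp (2 * pi * x * \<xi>))
      = chain_symbol n \<delta> c (Suc i) j \<xi> * iexp (2 * pi * x * \<xi>)"
      by (simp only: mult.assoc[symmetric] distrib_right[symmetric])
  qed
  finally show ?thesis .
qed

lemma chain_function_gaussian:
  "chain_function n \<delta> c n 0 x = complex_of_real (sqrt (pi / c) * exp (- (pi\<^sup>2 / c) * x\<^sup>2))"
  using gaussian_fourier_integral[OF c, of x] by (simp add: chain_function_def chain_symbol_def)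

end

section \<open>Exponential decay along the chain\<close>

lemma poly_gaussian_decay:
  fixes p :: "real poly"
  assumes "a > 0"
  shows "\<exists>C. \<forall>x. \<bar>poly p x * exp (- a * x\<^sup>2)\<bar> \<le> C * exp (- \<beta> * \<bar>x\<bar>)"
proof (induction p arbitrary: \<beta> rule: pCons_induct)
  case 0
  then show ?case by (intro exI[of _ 0]) auto
next
  case (pCons r p)
  \<comment> \<open>A factor \<open>x\<close> costs one unit of exponential rate, so the induction
    runs over all rates and its hypothesis is used at \<open>\<beta> + 1\<close>.\<close>
  obtain C where C: "\<And>x. \<bar>poly p x * exp (- a * x\<^sup>2)\<bar> \<le> C * exp (- (\<beta> + 1) * \<bar>x\<bar>)" using pCons.IH by blast
  have C0: "0 \<le> C" using C[of 0] by simp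
  define E where "E = exp (\<beta>\<^sup>2 / (4 * a))"
  have g: "exp (- a * x\<^sup>2) \<le> E * exp (- \<beta> * \<bar>x\<bar>)" for x
  proof -
    have "0 \<le> a * (\<bar>x\<bar> - \<beta> / (2 * a))\<^sup>2" using assms by simp
    also have "\<dots> = a * x\<^sup>2 - \<beta> * \<bar>x\<bar> + \<beta>\<^sup>2 / (4 * a)"
      using assms by (simp add: power2_diff power_divide field_simps power2_eq_square)
    finally show ?thesis by (simp add: E_def flip: exp_add)
  qed
  have "\<bar>poly (pCons r p) x * exp (- a * x\<^sup>2)\<bar> \<le> (\<bar>r\<bar> * E + C) * exp (- \<beta> * \<bar>x\<bar>)" for x
  proof -
    have "\<bar>x\<bar> \<le> exp \<bar>x\<bar>" using exp_ge_add_one_self[of "\<bar>x\<bar>"] by linarith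
    then have "\<bar>x\<bar> * \<bar>poly p x * exp (- a * x\<^sup>2)\<bar> \<le> exp \<bar>x\<bar> * (C * exp (- (\<beta> + 1) * \<bar>x\<bar>))"
      by (intro mult_mono C) auto
    also have "\<dots> = C * exp (- \<beta> * \<bar>x\<bar>)" by (simp add: algebra_simps flip: exp_add)
    finally have 1: "\<bar>x\<bar> * \<bar>poly p x * exp (- a * x\<^sup>2)\<bar> \<le> C * exp (- \<beta> * \<bar>x\<bar>)" .
    have 2: "\<bar>r\<bar> * exp (- a * x\<^sup>2) \<le> \<bar>r\<bar> * (E * exp (- \<beta> * \<bar>x\<bar>))" by (intro mult_left_mono g) auto
    have "poly (pCons r p) x * exp (- a * x\<^sup>2) = r * exp (- a * x\<^sup>2) + x * (poly p x * exp (- a * x\<^sup>2))"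
      by (simp add: algebra_simps)
    then have "\<bar>poly (pCons r p) x * exp (- a * x\<^sup>2)\<bar> \<le> \<bar>r\<bar> * exp (- a * x\<^sup>2) + \<bar>x\<bar> * \<bar>poly p x * exp (- a * x\<^sup>2)\<bar>"
      using abs_triangle_ineq[of "r * exp (- a * x\<^sup>2)" "x * (poly p x * exp (- a * x\<^sup>2))"] by (simp add: abs_mult)
    then show ?thesis using 1 2 by (simp add: distrib_right mult.assoc)
  qed
  then show ?case by blast
qed

text \<open>Every derivative is a polynomial times the Gaussian; differentiation replaces
  \<open>p\<close> by \<open>p' - 2 * a * x * p\<close>.\<close>

lemma gaussian_derivatives_decay:
  fixes g :: "nat \<Rightarrow> real \<Rightarrow> complex"
  assumes a: "a > 0" and d: "\<And>j x. (g j has_vector_derivative g (Suc j) x) (at x)"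
    and g0: "\<And>x. g 0 x = complex_of_real (A * exp (- a * x\<^sup>2))"
  shows "\<exists>C. \<forall>x. norm (g j x) \<le> C * exp (- \<beta> * \<bar>x\<bar>)"
proof -
  have "\<exists>p. \<forall>x. g j x = complex_of_real (poly p x * exp (- a * x\<^sup>2))"
  proof (induction j)
    case 0
    show ?case by (intro exI[of _ "[:A:]"]) (simp add: g0)
  next
    case (Suc j)
    then obtain p where p: "\<And>x. g j x = complex_of_real (poly p x * exp (- a * x\<^sup>2))" by blast
    have "g (Suc j) x = complex_of_real (poly (pderiv p + [:0, - 2 * a:] * p) x * exp (- a * x\<^sup>2))" for x
    proof -
      have "((\<lambda>x. poly p x * exp (- a * x\<^sup>2)) has_real_derivative poly (pderiv p + [:0, - 2 * a:] * p) x * exp (- a * x\<^sup>2)) (at x)"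
        by (auto intro!: derivative_eq_intros poly_DERIV simp: algebra_simps)
      then have "((\<lambda>x. complex_of_real (poly p x * exp (- a * x\<^sup>2))) has_vector_derivative
          complex_of_real (poly (pderiv p + [:0, - 2 * a:] * p) x * exp (- a * x\<^sup>2))) (at x)"
        unfolding has_real_derivative_iff_has_vector_derivative
        by (rule bounded_linear.has_vector_derivative[OF bounded_linear_of_real])
      moreover have "(\<lambda>x. complex_of_real (poly p x * exp (- a * x\<^sup>2))) = g j" using p by auto
      ultimately show ?thesis using d vector_derivative_unique_at by metis
    qed
    then show ?case by blast
  qed
  then obtain p where p: "\<And>x. g j x = complex_of_real (poly p x * exp (- a * x\<^sup>2))" by blast
  show ?thesis using poly_gaussian_decay[OF a, of p \<beta>] by (simp add: p del: of_real_mult)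
qed

text \<open>The integrating factor is \<open>exp (x / \<delta>)\<close>. For
  \<open>x \<le> 0\<close> integration starts at minus infinity, where boundedness of
  \<open>h\<close> excludes the homogeneous solution \<open>exp (- x / \<delta>)\<close>; for
  \<open>x > 0\<close> it starts at 0, and \<open>b * \<delta> < 1\<close> makes the exponent
  \<open>1 / \<delta> - b\<close> positive.\<close>

lemma ode_decay_pos:
  fixes h k :: "real \<Rightarrow> complex"
  assumes d: "\<And>x. (h has_vector_derivative h' x) (at x)" and ode: "\<And>x. h x + complex_of_real \<delta> * h' x = k x"
    and H: "\<And>x. norm (h x) \<le> H" and C: "\<And>x. norm (k x) \<le> C * exp (- b * \<bar>x\<bar>)"
    and b: "b > 0" and \<delta>: "\<delta> > 0" "b * \<delta> < 1"
  shows "norm (h x) \<le> (H + C / (1 - b * \<delta>)) * exp (- b * \<bar>x\<bar>)"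
proof -
  define F where "F x = exp (x / \<delta>) *\<^sub>R h x" for x
  have F: "(F has_vector_derivative (exp (x / \<delta>) / \<delta>) *\<^sub>R k x) (at x)" for x
  proof -
    have "((\<lambda>x. exp (x / \<delta>)) has_real_derivative exp (x / \<delta>) / \<delta>) (at x)"
      using \<delta> by (auto intro!: derivative_eq_intros)
    then have "(F has_vector_derivative exp (x / \<delta>) *\<^sub>R h' x + (exp (x / \<delta>) / \<delta>) *\<^sub>R h x) (at x)"
      unfolding F_def by (rule has_vector_derivative_scaleR[OF _ d])
    moreover have "exp (x / \<delta>) *\<^sub>R h' x + (exp (x / \<delta>) / \<delta>) *\<^sub>R h x = (exp (x / \<delta>) / \<delta>) *\<^sub>R k x"
      using \<delta> by (simp add: ode[symmetric] scaleR_conv_of_real field_simps)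
    ultimately show ?thesis by simp
  qed
  have Fc: "continuous_on X F" for X
    using F by (meson continuous_at_imp_continuous_on has_vector_derivative_continuous)
  have C0: "0 \<le> C" using C[of 0] order_trans[OF norm_ge_zero] by force
  have H0: "0 \<le> H" using H[of 0] norm_ge_zero order_trans by blast
  \<comment> \<open>One estimate for both half lines: on each,
    \<open>t / \<delta> - b * \<bar>t\<bar>\<close> is linear, of the form
    \<open>s * t\<close>.\<close>
  have bnd: "norm (F y - F z) \<le> C / \<delta> / s * exp (s * y) - C / \<delta> / s * exp (s * z)"
    if zy: "z < y" and s: "s > 0" and e: "\<And>t. z < t \<Longrightarrow> t < y \<Longrightarrow> t / \<delta> - b * \<bar>t\<bar> \<le> s * t" for y z s
  proof (rule differentiable_bound_general[OF zy Fc _ F])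
    show "continuous_on {z..y} (\<lambda>t. C / \<delta> / s * exp (s * t))" by (intro continuous_intros)
    fix t assume t: "z < t" "t < y"
    show "((\<lambda>t. C / \<delta> / s * exp (s * t)) has_vector_derivative C / \<delta> * exp (s * t)) (at t)"
      unfolding has_real_derivative_iff_has_vector_derivative[symmetric]
      using s \<delta> by (auto intro!: derivative_eq_intros)
    have "norm ((exp (t / \<delta>) / \<delta>) *\<^sub>R k t) \<le> exp (t / \<delta>) / \<delta> * (C * exp (- b * \<bar>t\<bar>))"
    proof -
      have "norm ((exp (t / \<delta>) / \<delta>) *\<^sub>R k t) = exp (t / \<delta>) / \<delta> * norm (k t)" using \<delta> by simp
      also have "\<dots> \<le> exp (t / \<delta>) / \<delta> * (C * exp (- b * \<bar>t\<bar>))" using \<delta> by (intro mult_left_mono C) auto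
      finally show ?thesis .
    qed
    also have "\<dots> = C / \<delta> * exp (t / \<delta> - b * \<bar>t\<bar>)"
      by (simp add: diff_conv_add_uminus exp_add del: add_uminus_conv_diff)
    also have "\<dots> \<le> C / \<delta> * exp (s * t)" using e[OF t] C0 \<delta> by (intro mult_left_mono) auto
    finally show "norm ((exp (t / \<delta>) / \<delta>) *\<^sub>R k t) \<le> C / \<delta> * exp (s * t)" .
  qed
  have hF: "norm (h x) = exp (- x / \<delta>) * norm (F x)" for x
    by (simp add: F_def mult.assoc[symmetric] flip: exp_add)
  have bd: "1 - b * \<delta> > 0" using \<delta> by simp
  show ?thesis
  proof (cases "x \<le> 0")
    case True
    define s where "s = 1 / \<delta> + b"
    have s: "s > 0" using b \<delta> by (simp add: s_def add_pos_pos)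
    have "norm (F x) \<le> H * exp (y / \<delta>) + C / \<delta> / s * exp (s * x)" if "y < x" for y
    proof -
      have "norm (F x - F y) \<le> C / \<delta> / s * exp (s * x) - C / \<delta> / s * exp (s * y)"
        by (rule bnd[OF that s]) (use True in \<open>auto simp: s_def algebra_simps\<close>)
      moreover have "0 \<le> C / \<delta> / s * exp (s * y)" using C0 \<delta> s by simp
      moreover have "norm (F y) \<le> H * exp (y / \<delta>)" using H[of y] by (simp add: F_def mult.commute mult_right_mono)
      ultimately show ?thesis using norm_triangle_sub[of "F x" "F y"] by linarith
    qed
    then have "\<forall>\<^sub>F y in at_bot. norm (F x) \<le> H * exp (y / \<delta>) + C / \<delta> / s * exp (s * x)"
      by (intro eventually_mono[OF eventually_gt_at_bot[of x]])
    moreover have "((\<lambda>y. H * exp (y / \<delta>) + C / \<delta> / s * exp (s * x)) \<longlongrightarrow> H * 0 + C / \<delta> / s * exp (s * x)) at_bot"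
    proof (intro tendsto_intros)
      show "((\<lambda>y. exp (y / \<delta>)) \<longlongrightarrow> 0) at_bot" using \<delta> by real_asymp
    qed
    ultimately have "norm (F x) \<le> H * 0 + C / \<delta> / s * exp (s * x)"
      by (intro tendsto_lowerbound[where F = at_bot]) auto
    then have Fx: "norm (F x) \<le> C / \<delta> / s * exp (s * x)" by simp
    have "norm (h x) \<le> exp (- x / \<delta>) * (C / \<delta> / s * exp (s * x))" unfolding hF by (intro mult_left_mono Fx) auto
    also have "\<dots> = C / (\<delta> * s) * exp (b * x)"
    proof -
      have "exp (- x / \<delta>) * exp (s * x) = exp (b * x)" by (simp add: s_def algebra_simps flip: exp_add)
      then show ?thesis by (simp add: mult.left_commute)
    qed
    also have "\<dots> \<le> C / (1 - b * \<delta>) * exp (b * x)"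
    proof (intro mult_right_mono divide_left_mono)
      have "\<delta> * s = 1 + b * \<delta>" using \<delta> by (simp add: s_def distrib_left mult.commute)
      moreover have "0 < b * \<delta>" using b \<delta> by simp
      ultimately show "1 - b * \<delta> \<le> \<delta> * s" by linarith
    qed (use C0 \<delta> s bd in auto)
    also have "\<dots> \<le> (H + C / (1 - b * \<delta>)) * exp (b * x)" using H0 by (intro mult_right_mono) auto
    finally show ?thesis using True by simp
  next
    case False
    define s where "s = 1 / \<delta> - b"
    have s: "s > 0" using \<delta> by (simp add: s_def field_simps)
    have "norm (F x - F 0) \<le> C / \<delta> / s * exp (s * x) - C / \<delta> / s * exp (s * 0)"
      by (rule bnd) (use False s in \<open>auto simp: s_def algebra_simps\<close>)
    moreover have "0 \<le> C / \<delta> / s" using C0 \<delta> s by simp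
    moreover have "norm (F 0) \<le> H" using H[of 0] by (simp add: F_def)
    ultimately have Fx: "norm (F x) \<le> H + C / \<delta> / s * exp (s * x)"
      using norm_triangle_sub[of "F x" "F 0"] by auto
    have "norm (h x) \<le> exp (- x / \<delta>) * (H + C / \<delta> / s * exp (s * x))" unfolding hF by (intro mult_left_mono Fx) auto
    also have "\<dots> = H * exp (- x / \<delta>) + C / (\<delta> * s) * exp (- b * x)"
    proof -
      have "exp (- x / \<delta>) * exp (s * x) = exp (- b * x)" by (simp add: s_def algebra_simps flip: exp_add)
      then show ?thesis by (simp add: distrib_left mult.left_commute mult.commute[of H])
    qed
    also have "\<delta> * s = 1 - b * \<delta>" using \<delta> by (simp add: s_def right_diff_distrib mult.commute)
    also have "H * exp (- x / \<delta>) \<le> H * exp (- b * x)"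
    proof (intro mult_left_mono H0)
      have "b * x \<le> 1 / \<delta> * x" using s False by (intro mult_right_mono) (auto simp: s_def)
      then show "exp (- x / \<delta>) \<le> exp (- b * x)" by simp
    qed
    finally show ?thesis using False by (simp add: distrib_right)
  qed
qed

text \<open>Negative \<open>\<delta>\<close> reduces to the positive case by reflection at the
  origin.\<close>

lemma ode_decay:
  fixes h k :: "real \<Rightarrow> complex"
  assumes d: "\<And>x. (h has_vector_derivative h' x) (at x)" and ode: "\<And>x. h x + complex_of_real \<delta> * h' x = k x"
    and H: "\<And>x. norm (h x) \<le> H" and C: "\<And>x. norm (k x) \<le> C * exp (- b * \<bar>x\<bar>)"
    and b: "b > 0" and \<delta>: "b * \<bar>\<delta>\<bar> < 1"
  shows "\<exists>C'. \<forall>x. norm (h x) \<le> C' * exp (- b * \<bar>x\<bar>)"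
proof -
  consider "\<delta> = 0" | "\<delta> > 0" | "\<delta> < 0" by linarith
  then show ?thesis
  proof cases
    case 1
    then show ?thesis using ode C by auto
  next
    case 2
    then show ?thesis using ode_decay_pos[OF d ode H C b] \<delta> by auto
  next
    case 3
    have "((\<lambda>x. h (- x)) has_vector_derivative - h' (- x)) (at x)" for x
    proof -
      have "(uminus has_vector_derivative - 1) (at x)"
        by (auto intro!: derivative_eq_intros simp flip: has_real_derivative_iff_has_vector_derivative)
      from vector_diff_chain_at[OF this d[of "- x"]] show ?thesis by (simp add: o_def)
    qed
    moreover have "h (- x) + complex_of_real (- \<delta>) * - h' (- x) = k (- x)" for x using ode[of "- x"] by simp
    moreover have "norm (k (- x)) \<le> C * exp (- b * \<bar>x\<bar>)" for x using C[of "- x"] by simp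
    ultimately have "norm (h (- x)) \<le> (H + C / (1 - b * (- \<delta>))) * exp (- b * \<bar>x\<bar>)" for x
      using 3 \<delta> by (intro ode_decay_pos[where h = "\<lambda>x. h (- x)" and h' = "\<lambda>x. - h' (- x)" and k = "\<lambda>x. k (- x)" and \<delta> = "- \<delta>"] H b) auto
    from this[of "- x" for x] show ?thesis by auto
  qed
qed

text \<open>The rate \<open>b\<close> satisfies \<open>b * \<bar>\<delta> i\<bar> < 1\<close> for
  all factors at once, so one rate serves the whole chain. Decay starts at the Gaussian end and
  descends through the equations; each member is bounded because its symbol is integrable.\<close>

lemma chain_function_gaussian_chain:
  fixes n :: nat and \<delta> :: "nat \<Rightarrow> real" and c :: real
  assumes c: "c > 0"
  shows "gaussian_chain (chain_function n \<delta> c) n \<delta> (pi\<^sup>2 / c) (sqrt (pi / c)) (1 / (1 + (\<Sum>l<n. \<bar>\<delta> l\<bar>)))"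
proof
  define b where "b = 1 / (1 + (\<Sum>l<n. \<bar>\<delta> l\<bar>))"
  have s0: "0 \<le> (\<Sum>l<n. \<bar>\<delta> l\<bar>)" by (intro sum_nonneg) auto
  have "0 < 1 + (\<Sum>l<n. \<bar>\<delta> l\<bar>)" using s0 by linarith
  then show b: "0 < 1 / (1 + (\<Sum>l<n. \<bar>\<delta> l\<bar>))" by simp
  note b = b[folded b_def]
  show "pi\<^sup>2 / c > 0" "sqrt (pi / c) > 0" using c by auto
  show "(chain_function n \<delta> c i j has_vector_derivative chain_function n \<delta> c i (Suc j) x) (at x)" for i j x
    by (rule chain_function_has_vector_derivative[OF c])
  show "chain_function n \<delta> c i j x + complex_of_real (\<delta> i) * chain_function n \<delta> c i (Suc j) x = chain_function n \<delta> c (Suc i) j x"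
    if "i < n" for i j x by (rule chain_function_step[OF c that])
  show "chain_function n \<delta> c n 0 x = complex_of_real (sqrt (pi / c) * exp (- (pi\<^sup>2 / c) * x\<^sup>2))" for x
    by (rule chain_function_gaussian[OF c])
  show "\<exists>C. \<forall>x. norm (chain_function n \<delta> c i j x) \<le> C * exp (- (1 / (1 + (\<Sum>l<n. \<bar>\<delta> l\<bar>))) * \<bar>x\<bar>)" if "i \<le> n" for i j
    unfolding b_def[symmetric] using that
  proof (induction i arbitrary: j rule: inc_induct)
    case base
    show ?case
      by (rule gaussian_derivatives_decay[where g = "chain_function n \<delta> c n" and a = "pi\<^sup>2 / c" and A = "sqrt (pi / c)"])
         (use c chain_function_has_vector_derivative[OF c] chain_function_gaussian[OF c] in auto)
  next
    case (step i)
    obtain C where C: "\<And>x. norm (chain_function n \<delta> c (Suc i) j x) \<le> C * exp (- b * \<bar>x\<bar>)" using step.IH by blast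
    have "\<bar>\<delta> i\<bar> \<le> (\<Sum>l<n. \<bar>\<delta> l\<bar>)" using step.hyps by (intro member_le_sum) auto
    then have "b * \<bar>\<delta> i\<bar> < 1" using s0 by (simp add: b_def field_simps)
    then show ?case
      by (rule ode_decay[OF chain_function_has_vector_derivative[OF c] chain_function_step[OF c step.hyps(2)]
            chain_function_bounded[OF c] C b])
  qed
qed

section \<open>Fourier inversion for continuous integrable functions\<close>

lemma fourier_gaussian_regularised:
  fixes g :: "real \<Rightarrow> complex" and s y :: real
  assumes g: "integrable lborel g" and s: "s > 0"
  shows "(LINT \<xi>|lborel. fourier_transform g \<xi> * iexp (2 * pi * y * \<xi>) * complex_of_real (exp (- (2 * pi\<^sup>2 * s\<^sup>2) * \<xi>\<^sup>2))) =
    (LINT x|lborel. g x * complex_of_real (std_normal_density ((x - y) / s) / s))"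
proof -
  \<comment> \<open>With this \<open>c\<close> the inverse transform of the damping factor is
    exactly the normal density of standard deviation \<open>s\<close>. The damping also makes the
    double integral absolutely convergent.\<close>
  define c where "c = 2 * pi\<^sup>2 * s\<^sup>2"
  have c: "c > 0" using s by (simp add: c_def)
  define f where "f x \<xi> = g x * (complex_of_real (exp (- c * \<xi>\<^sup>2)) * iexp (2 * pi * (y - x) * \<xi>))" for x \<xi>
  have gm[measurable]: "g \<in> borel_measurable borel" using g by (auto dest: borel_measurable_integrable)
  have e: "integrable lborel (\<lambda>\<xi>. exp (- c * \<xi>\<^sup>2))" using integrable_abs_power_gaussian[OF c, of 0] by simp
  have nf: "norm (f x \<xi>) = norm (g x) * exp (- c * \<xi>\<^sup>2)" for x \<xi> by (simp add: f_def norm_mult)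
  have fi: "integrable (lborel \<Otimes>\<^sub>M lborel) (case_prod f)"
  proof (rule lborel_pair.Fubini_integrable)
    show "case_prod f \<in> borel_measurable (lborel \<Otimes>\<^sub>M lborel)"
      unfolding f_def by measurable
    show "integrable lborel (\<lambda>x. LINT \<xi>|lborel. norm (case_prod f (x, \<xi>)))"
      using g by (simp add: nf)
    show "AE x in lborel. integrable lborel (\<lambda>\<xi>. case_prod f (x, \<xi>))"
    proof (intro AE_I2)
      fix x
      show "integrable lborel (\<lambda>\<xi>. case_prod f (x, \<xi>))"
      proof (rule Bochner_Integration.integrable_bound)
        show "integrable lborel (\<lambda>\<xi>. norm (g x) * exp (- c * \<xi>\<^sup>2))" by (intro integrable_mult_right e)
        show "(\<lambda>\<xi>. case_prod f (x, \<xi>)) \<in> borel_measurable lborel" unfolding f_def by simp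
        show "AE \<xi> in lborel. norm (case_prod f (x, \<xi>)) \<le> norm (norm (g x) * exp (- c * \<xi>\<^sup>2))"
          by (intro AE_I2) (simp add: nf)
      qed
    qed
  qed
  have L: "fourier_transform g \<xi> * iexp (2 * pi * y * \<xi>) * complex_of_real (exp (- c * \<xi>\<^sup>2)) = (LINT x|lborel. f x \<xi>)" for \<xi>
  proof -
    have "f x \<xi> = (g x * exp (- (2 * pi * \<i> * complex_of_real (x * \<xi>)))) * (iexp (2 * pi * y * \<xi>) * complex_of_real (exp (- c * \<xi>\<^sup>2)))" for x
    proof -
      have "iexp (2 * pi * (y - x) * \<xi>) = exp (- (2 * pi * \<i> * complex_of_real (x * \<xi>))) * iexp (2 * pi * y * \<xi>)"
        by (simp add: algebra_simps flip: exp_add)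
      then show ?thesis by (simp only: f_def mult_ac)
    qed
    then show ?thesis unfolding fourier_transform_def by (simp only: integral_mult_left_zero mult.assoc[symmetric])
  qed
  have R: "(LINT \<xi>|lborel. f x \<xi>) = g x * complex_of_real (std_normal_density ((x - y) / s) / s)" for x
  proof -
    have "(LINT \<xi>|lborel. f x \<xi>) = g x * complex_of_real (sqrt (pi / c) * exp (- (pi\<^sup>2 / c) * (y - x)\<^sup>2))"
      unfolding f_def integral_mult_right_zero gaussian_fourier_integral[OF c] ..
    moreover have "sqrt (pi / c) * exp (- (pi\<^sup>2 / c) * (y - x)\<^sup>2) = std_normal_density ((x - y) / s) / s"
    proof -
      have "pi / c = 1 / (2 * pi * s\<^sup>2)" by (simp add: c_def power2_eq_square)
      then have "sqrt (pi / c) = 1 / (sqrt (2 * pi) * s)" using s by (simp add: real_sqrt_divide real_sqrt_mult)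
      moreover have "- (pi\<^sup>2 / c) * (y - x)\<^sup>2 = - ((x - y) / s)\<^sup>2 / 2"
        by (simp add: c_def power_divide power2_commute[of x y])
      ultimately show ?thesis by (simp add: std_normal_density_def)
    qed
    ultimately show ?thesis by (simp only:)
  qed
  show ?thesis
    using lborel_pair.Fubini_integral[OF fi] unfolding L[unfolded c_def, symmetric] R .
qed

text \<open>\<open>g\<close> may be unbounded, so it is cut at distance 1 from \<open>y\<close>. The
  near part is bounded and yields to dominated convergence after rescaling; off that interval the
  kernel is uniformly tiny and integrability of \<open>g\<close> suffices.\<close>

lemma gaussian_approximate_identity:
  fixes g :: "real \<Rightarrow> complex"
  assumes g: "integrable lborel g" and cont: "continuous_on UNIV g"
  shows "(\<lambda>m. LINT x|lborel. g x * complex_of_real (std_normal_density ((x - y) / (1 / real (Suc m))) / (1 / real (Suc m)))) \<longlonglongrightarrow> g y"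
proof -
  define s where "s m = 1 / real (Suc m)" for m
  have s: "s m > 0" for m by (simp add: s_def)
  have s0: "s \<longlonglongrightarrow> 0" unfolding s_def by real_asymp
  define D where "D m x = std_normal_density ((x - y) / s m) / s m" for m x
  have gm[measurable]: "g \<in> borel_measurable borel" using g by (auto dest: borel_measurable_integrable)
  have Dm[measurable]: "D m \<in> borel_measurable borel" for m unfolding D_def by measurable
  define g1 where "g1 x = indicator {y - 1..y + 1} x *\<^sub>R g x" for x
  have g1m[measurable]: "g1 \<in> borel_measurable borel" unfolding g1_def by measurable
  have g1i: "integrable lborel g1"
    unfolding g1_def by (rule borel_integrable_compact) (auto intro: continuous_on_subset[OF cont])
  obtain B where B: "\<And>x. norm (g1 x) \<le> B"
  proof -
    have "bounded (g ` {y - 1..y + 1})"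
      by (intro compact_imp_bounded compact_continuous_image continuous_on_subset[OF cont]) auto
    then obtain B where "\<And>x. x \<in> {y - 1..y + 1} \<Longrightarrow> norm (g x) \<le> B" unfolding bounded_iff by (auto simp del: atLeastAtMost_iff)
    then have "norm (g1 x) \<le> max B 0" for x by (cases "x \<in> {y - 1..y + 1}") (auto simp: g1_def le_max_iff_disj)
    then show thesis by (rule that)
  qed
  have D0: "0 \<le> D m x" for m x using s[of m] by (simp add: D_def)
  have "1 \<le> sqrt (2 * pi)" by (rule real_le_rsqrt) (use pi_ge_two in simp)
  then have norm_const: "1 / sqrt (2 * pi) \<le> 1" by (simp add: divide_le_eq)
  have Dle: "D m x \<le> 1 / s m" for m x
  proof -
    have "std_normal_density ((x - y) / s m) \<le> 1"
      unfolding std_normal_density_def by (rule mult_le_one[OF norm_const]) auto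
    then show ?thesis unfolding D_def using s[of m] by (intro divide_right_mono) auto
  qed
  have bi: "integrable lborel (\<lambda>x. h x * complex_of_real (D m x))" if h: "integrable lborel h" for h m
  proof (rule Bochner_Integration.integrable_bound)
    show "integrable lborel (\<lambda>x. norm (h x) * (1 / s m))" by (intro integrable_mult_left integrable_norm h)
    show "(\<lambda>x. h x * complex_of_real (D m x)) \<in> borel_measurable lborel"
      using borel_measurable_integrable[OF h] by simp
    show "AE x in lborel. norm (h x * complex_of_real (D m x)) \<le> norm (norm (h x) * (1 / s m))"
    proof (intro AE_I2)
      fix x
      have "norm (h x) * D m x \<le> norm (h x) * (1 / s m)" by (intro mult_left_mono Dle) auto
      then show "norm (h x * complex_of_real (D m x)) \<le> norm (norm (h x) * (1 / s m))"
        using D0[of m x] s[of m] by (simp add: norm_mult)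
    qed
  qed
  have lim1: "(\<lambda>m. LINT x|lborel. g1 x * complex_of_real (D m x)) \<longlonglongrightarrow> g y"
  proof -
    have eq: "(LINT x|lborel. g1 x * complex_of_real (D m x)) = (LINT t|lborel. std_normal_density t *\<^sub>R g1 (y + s m * t))" for m
    proof -
      have "(LINT x|lborel. g1 x * complex_of_real (D m x)) = \<bar>s m\<bar> *\<^sub>R (LINT t|lborel. g1 (y + s m * t) * complex_of_real (D m (y + s m * t)))"
        using s[of m] by (intro lborel_integral_real_affine) auto
      also have "\<dots> = (LINT t|lborel. \<bar>s m\<bar> *\<^sub>R (g1 (y + s m * t) * complex_of_real (D m (y + s m * t))))"
        by simp
      also have "\<dots> = (LINT t|lborel. std_normal_density t *\<^sub>R g1 (y + s m * t))"
        using s[of m] by (intro Bochner_Integration.integral_cong refl) (simp add: D_def scaleR_conv_of_real)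
      finally show ?thesis .
    qed
    have "(\<lambda>m. LINT t|lborel. std_normal_density t *\<^sub>R g1 (y + s m * t)) \<longlonglongrightarrow> (LINT t|lborel. std_normal_density t *\<^sub>R g y)"
    proof (rule integral_dominated_convergence[where w = "\<lambda>t. std_normal_density t * B"])
      show "integrable lborel (\<lambda>t. std_normal_density t * B)" by simp
      show "AE t in lborel. (\<lambda>m. std_normal_density t *\<^sub>R g1 (y + s m * t)) \<longlonglongrightarrow> std_normal_density t *\<^sub>R g y"
      proof (intro AE_I2 tendsto_scaleR tendsto_const)
        fix t
        have z: "(\<lambda>m. y + s m * t) \<longlonglongrightarrow> y" using tendsto_add[OF tendsto_const tendsto_mult_left_zero[OF s0, of t], of y] by simp
        then have "(\<lambda>m. g (y + s m * t)) \<longlonglongrightarrow> g y"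
          using cont by (intro isCont_tendsto_compose[of y g]) (auto simp: continuous_on_eq_continuous_at)
        moreover have "\<forall>\<^sub>F m in sequentially. g (y + s m * t) = g1 (y + s m * t)"
        proof -
          have "\<forall>\<^sub>F m in sequentially. dist (y + s m * t) y < 1" by (rule tendstoD[OF z]) simp
          then show ?thesis by eventually_elim (auto simp: g1_def dist_real_def indicator_def)
        qed
        ultimately show "(\<lambda>m. g1 (y + s m * t)) \<longlonglongrightarrow> g y" by (rule Lim_transform_eventually)
      qed
      show "AE t in lborel. norm (std_normal_density t *\<^sub>R g1 (y + s m * t)) \<le> std_normal_density t * B" for m
        using B by (intro AE_I2) (simp add: mult_left_mono)
    qed auto
    then show ?thesis unfolding eq by simp
  qed
  have lim2: "(\<lambda>m. LINT x|lborel. (g x - g1 x) * complex_of_real (D m x)) \<longlonglongrightarrow> 0"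
  proof (rule Lim_null_comparison)
    let ?E = "\<lambda>m. exp (- ((1 / s m)\<^sup>2 / 2)) / s m"
    show "\<forall>\<^sub>F m in sequentially. norm (LINT x|lborel. (g x - g1 x) * complex_of_real (D m x)) \<le> (LINT x|lborel. norm (g x)) * ?E m"
    proof (intro always_eventually allI)
      fix m
      have "norm (LINT x|lborel. (g x - g1 x) * complex_of_real (D m x)) \<le> (LINT x|lborel. norm ((g x - g1 x) * complex_of_real (D m x)))"
        by (rule integral_norm_bound)
      also have "\<dots> \<le> (LINT x|lborel. norm (g x) * ?E m)"
      proof (rule integral_mono)
        show "integrable lborel (\<lambda>x. norm ((g x - g1 x) * complex_of_real (D m x)))"
          by (intro integrable_norm bi Bochner_Integration.integrable_diff g g1i)
        show "integrable lborel (\<lambda>x. norm (g x) * ?E m)" by (intro integrable_mult_left integrable_norm g)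
        fix x
        show "norm ((g x - g1 x) * complex_of_real (D m x)) \<le> norm (g x) * ?E m"
        proof (cases "x \<in> {y - 1..y + 1}")
          case True
          then show ?thesis using s[of m] by (simp add: g1_def)
        next
          case False
          then have "1 \<le> \<bar>x - y\<bar>" by (auto simp: abs_if)
          then have "1 / s m \<le> \<bar>(x - y) / s m\<bar>" using s[of m] by (simp add: abs_divide divide_right_mono)
          then have "(1 / s m)\<^sup>2 \<le> ((x - y) / s m)\<^sup>2" using s[of m] by (subst abs_le_square_iff[symmetric]) auto
          then have "exp (- ((x - y) / s m)\<^sup>2 / 2) \<le> exp (- ((1 / s m)\<^sup>2 / 2))" by simp
          then have "1 / sqrt (2 * pi) * exp (- ((x - y) / s m)\<^sup>2 / 2) \<le> 1 * exp (- ((1 / s m)\<^sup>2 / 2))"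
            by (intro mult_mono norm_const) auto
          then have "D m x \<le> ?E m" using s[of m] unfolding D_def std_normal_density_def by (intro divide_right_mono) auto
          then have "norm (g x) * D m x \<le> norm (g x) * ?E m" by (rule mult_left_mono) simp
          then show ?thesis using False D0[of m x] by (simp add: g1_def norm_mult)
        qed
      qed
      also have "\<dots> = (LINT x|lborel. norm (g x)) * ?E m" by (rule integral_mult_left_zero)
      finally show "norm (LINT x|lborel. (g x - g1 x) * complex_of_real (D m x)) \<le> (LINT x|lborel. norm (g x)) * ?E m" .
    qed
    have "?E \<longlonglongrightarrow> 0" unfolding s_def by real_asymp
    then show "(\<lambda>m. (LINT x|lborel. norm (g x)) * ?E m) \<longlonglongrightarrow> 0" by (rule tendsto_mult_right_zero)
  qed
  have "(LINT x|lborel. g1 x * complex_of_real (D m x)) + (LINT x|lborel. (g x - g1 x) * complex_of_real (D m x)) =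
     (LINT x|lborel. g x * complex_of_real (D m x))" for m
    by (subst Bochner_Integration.integral_add[symmetric])
       (auto intro!: bi g g1i Bochner_Integration.integrable_diff simp: algebra_simps)
  then have "(\<lambda>m. LINT x|lborel. g x * complex_of_real (D m x)) \<longlonglongrightarrow> g y + 0"
    using tendsto_add[OF lim1 lim2] by simp
  then show ?thesis by (simp add: D_def s_def)
qed

text \<open>The damping tends to 1 on the Fourier side, and the smoothed function tends to
  \<open>g y\<close>. Continuity gives the identity at every point, as pointwise samples
  require.\<close>

lemma fourier_inversion:
  fixes g :: "real \<Rightarrow> complex"
  assumes g: "integrable lborel g" and cont: "continuous_on UNIV g" and ft: "integrable lborel (fourier_transform g)"
  shows "g y = (LINT \<xi>|lborel. fourier_transform g \<xi> * iexp (2 * pi * y * \<xi>))"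
proof -
  let ?e = "\<lambda>m \<xi>. exp (- (2 * pi\<^sup>2 * (1 / real (Suc m))\<^sup>2) * \<xi>\<^sup>2)"
  have [measurable]: "fourier_transform g \<in> borel_measurable borel" using ft by (auto dest: borel_measurable_integrable)
  have "(\<lambda>m. LINT \<xi>|lborel. fourier_transform g \<xi> * iexp (2 * pi * y * \<xi>) * complex_of_real (?e m \<xi>)) \<longlonglongrightarrow>
    (LINT \<xi>|lborel. fourier_transform g \<xi> * iexp (2 * pi * y * \<xi>) * complex_of_real 1)"
  proof (rule integral_dominated_convergence[where w = "\<lambda>\<xi>. norm (fourier_transform g \<xi>)"])
    show "integrable lborel (\<lambda>\<xi>. norm (fourier_transform g \<xi>))" by (rule integrable_norm[OF ft])
    show "AE \<xi> in lborel. (\<lambda>m. fourier_transform g \<xi> * iexp (2 * pi * y * \<xi>) * complex_of_real (?e m \<xi>)) \<longlonglongrightarrow>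
        fourier_transform g \<xi> * iexp (2 * pi * y * \<xi>) * complex_of_real 1"
    proof (intro AE_I2 tendsto_mult tendsto_const tendsto_of_real)
      fix \<xi> :: real
      have "(\<lambda>m. - (2 * pi\<^sup>2 * (1 / real (Suc m))\<^sup>2) * \<xi>\<^sup>2) \<longlonglongrightarrow> - (2 * pi\<^sup>2 * 0\<^sup>2) * \<xi>\<^sup>2"
        by (intro tendsto_intros LIMSEQ_Suc[OF lim_1_over_n])
      from tendsto_exp[OF this] show "(\<lambda>m. ?e m \<xi>) \<longlonglongrightarrow> 1" by simp
    qed
    show "AE \<xi> in lborel. norm (fourier_transform g \<xi> * iexp (2 * pi * y * \<xi>) * complex_of_real (?e m \<xi>)) \<le> norm (fourier_transform g \<xi>)" for m
      by (intro AE_I2) (simp add: norm_mult mult_left_le)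
  qed auto
  moreover have "(LINT \<xi>|lborel. fourier_transform g \<xi> * iexp (2 * pi * y * \<xi>) * complex_of_real (?e m \<xi>)) =
      (LINT x|lborel. g x * complex_of_real (std_normal_density ((x - y) / (1 / real (Suc m))) / (1 / real (Suc m))))" for m
    by (rule fourier_gaussian_regularised[OF g]) simp
  ultimately have "(\<lambda>m. LINT x|lborel. g x * complex_of_real (std_normal_density ((x - y) / (1 / real (Suc m))) / (1 / real (Suc m)))) \<longlonglongrightarrow>
      (LINT \<xi>|lborel. fourier_transform g \<xi> * iexp (2 * pi * y * \<xi>) * complex_of_real 1)"
    by (simp only:)
  from LIMSEQ_unique[OF gaussian_approximate_identity[OF g cont] this] show ?thesis by simp
qed

lemma tp_gaussian_chain:
  assumes "tp_gaussian g"
  shows "\<exists>G n \<delta> a A b. gaussian_chain G n \<delta> a A b \<and> G 0 0 = g"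
proof -
  obtain n :: nat and \<delta> :: "nat \<Rightarrow> real" and c :: real where g: "integrable lborel g" "continuous_on UNIV g" and c: "c > 0"
    and ft: "\<And>\<xi>. fourier_transform g \<xi> = (\<Prod>j<n. inverse (1 + 2 * pi * \<i> * complex_of_real (\<delta> j * \<xi>))) * complex_of_real (exp (- c * \<xi>\<^sup>2))"
    using assms unfolding tp_gaussian_def by blast
  have ft': "fourier_transform g = chain_symbol n \<delta> c 0 0"
    by (rule ext) (simp add: ft chain_symbol_def atLeast0LessThan)
  have "g y = chain_function n \<delta> c 0 0 y" for y
    using fourier_inversion[OF g] chain_symbol_integrable[OF c] unfolding ft' chain_function_def by blast
  then have "chain_function n \<delta> c 0 0 = g" by auto
  then show ?thesis using chain_function_gaussian_chain[OF c, of n \<delta>] by blast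
qed

section \<open>Sampling sets and density\<close>

text \<open>Gaussian elimination: an equation with a nonzero entry at \<open>k0\<close> is solved
  for that unknown, and \<open>a'\<close> is the system left for the others.\<close>

lemma underdetermined_system:
  fixes a :: "'e \<Rightarrow> 'k \<Rightarrow> 'f::field"
  assumes "finite E" "finite K" "card E < card K"
  shows "\<exists>c. (\<exists>k\<in>K. c k \<noteq> 0) \<and> (\<forall>k. k \<notin> K \<longrightarrow> c k = 0) \<and> (\<forall>e\<in>E. (\<Sum>k\<in>K. a e k * c k) = 0)"
  using assms
proof (induction E arbitrary: K a rule: finite_induct)
  case empty
  then obtain k where "k \<in> K" by fastforce
  then show ?case by (intro exI[of _ "\<lambda>i. if i = k then 1 else 0"]) auto
next
  case (insert e E)
  show ?case
  proof (cases "\<forall>k\<in>K. a e k = 0")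
    case True
    have "card E < card K" using insert by simp
    from insert.IH[OF insert.prems(1) this, of a] obtain c where
      "\<exists>k\<in>K. c k \<noteq> 0" "\<forall>k. k \<notin> K \<longrightarrow> c k = 0" "\<forall>e\<in>E. (\<Sum>k\<in>K. a e k * c k) = 0" by blast
    then show ?thesis using True by (intro exI[of _ c]) simp
  next
    case False
    then obtain k0 where k0: "k0 \<in> K" "a e k0 \<noteq> 0" by blast
    define K' where "K' = K - {k0}"
    define a' where "a' e' k = a e' k - a e' k0 * a e k / a e k0" for e' k
    have K': "finite K'" "card E < card K'" "k0 \<notin> K'" "K = Set.insert k0 K'"
      using insert k0 by (auto simp: K'_def)
    from insert.IH[OF K'(1,2), of a'] obtain c where
      c: "\<exists>k\<in>K'. c k \<noteq> 0" "\<forall>k. k \<notin> K' \<longrightarrow> c k = 0" "\<forall>e\<in>E. (\<Sum>k\<in>K'. a' e k * c k) = 0" by blast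
    define s where "s = - (\<Sum>k\<in>K'. a e k * c k) / a e k0"
    define c' where "c' = c(k0 := s)"
    have cong: "(\<Sum>k\<in>K'. u k * c' k) = (\<Sum>k\<in>K'. u k * c k)" for u
      by (intro sum.cong refl) (use K'(3) in \<open>auto simp: c'_def\<close>)
    have eq: "(\<Sum>k\<in>K. a f k * c' k) = a f k0 * s + (\<Sum>k\<in>K'. a f k * c k)" for f
      using K' cong[of "a f"] by (simp add: c'_def)
    have "(\<Sum>k\<in>K. a e k * c' k) = 0" unfolding eq using k0 by (simp add: s_def)
    moreover have "(\<Sum>k\<in>K. a f k * c' k) = 0" if "f \<in> E" for f
    proof -
      have "0 = (\<Sum>k\<in>K'. a' f k * c k)" using c(3) that by simp
      also have "\<dots> = (\<Sum>k\<in>K'. a f k * c k) - a f k0 / a e k0 * (\<Sum>k\<in>K'. a e k * c k)"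
      proof -
        have "a' f k * c k = a f k * c k - a f k0 / a e k0 * (a e k * c k)" for k
          by (simp add: a'_def left_diff_distrib)
        then show ?thesis by (simp only: sum_subtractf sum_distrib_left)
      qed
      finally show ?thesis unfolding eq using k0 by (simp add: s_def)
    qed
    moreover have "\<exists>k\<in>K. c' k \<noteq> 0" using c(1) K' by (auto simp: c'_def)
    moreover have "\<forall>k. k \<notin> K \<longrightarrow> c' k = 0" using c(2) K' by (auto simp: c'_def)
    ultimately show ?thesis by blast
  qed
qed

text \<open>A dictionary between the set, over which sampling sums run, and the cell enumeration
  used for compactness. The index of \<open>l\<close> is that of its cell,
  \<open>\<lfloor>l * real Q\<rfloor>\<close>.\<close>

locale encoded_samples =
  fixes \<Lambda> :: "real set" and m :: "real \<Rightarrow> nat" and Q M :: nat and d :: real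
    and p :: "int \<Rightarrow> real" and \<mu> :: "int \<Rightarrow> nat"
  assumes Q: "Q > 0" and d: "d > 0" and cells: "cells Q p" and \<mu>M: "\<mu> i \<le> M"
    and sep: "i \<noteq> i' \<Longrightarrow> 0 < \<mu> i \<Longrightarrow> 0 < \<mu> i' \<Longrightarrow> d \<le> \<bar>p i - p i'\<bar>"
    and enc: "0 < \<mu> i \<Longrightarrow> p i \<in> \<Lambda>" "0 < \<mu> i \<Longrightarrow> \<mu> i = m (p i)"
    and dec: "l \<in> \<Lambda> \<Longrightarrow> p \<lfloor>l * real Q\<rfloor> = l" "l \<in> \<Lambda> \<Longrightarrow> \<mu> \<lfloor>l * real Q\<rfloor> = m l"
    and m1: "l \<in> \<Lambda> \<Longrightarrow> m l \<ge> 1"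

lemma separated_encode:
  fixes \<Lambda> :: "real set" and m :: "real \<Rightarrow> nat"
  assumes sep: "\<And>a b. a \<in> \<Lambda> \<Longrightarrow> b \<in> \<Lambda> \<Longrightarrow> a \<noteq> b \<Longrightarrow> d \<le> \<bar>a - b\<bar>"
    and Q: "Q > 0" "1 / real Q < d" and M: "\<And>l. l \<in> \<Lambda> \<Longrightarrow> m l \<le> M"
    and d: "d > 0" and m1: "\<And>l. l \<in> \<Lambda> \<Longrightarrow> m l \<ge> 1"
  shows "\<exists>p \<mu>. encoded_samples \<Lambda> m Q M d p \<mu>"
proof -
  define occ where "occ i \<longleftrightarrow> (\<exists>l\<in>\<Lambda>. \<lfloor>l * real Q\<rfloor> = i)" for i
  \<comment> \<open>\<open>1 / Q < d\<close> leaves at most one point per cell. An empty cell gets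
    its left end as a dummy point, which \<open>\<mu>\<close> gives multiplicity 0.\<close>
  define p where "p i = (if occ i then SOME l. l \<in> \<Lambda> \<and> \<lfloor>l * real Q\<rfloor> = i else real_of_int i / real Q)" for i
  define \<mu> where "\<mu> i = (if occ i then m (p i) else 0)" for i
  have p: "p i \<in> \<Lambda>" "\<lfloor>p i * real Q\<rfloor> = i" if "occ i" for i
    using someI_ex[of "\<lambda>l. l \<in> \<Lambda> \<and> \<lfloor>l * real Q\<rfloor> = i"] that unfolding p_def occ_def by auto
  have uniq: "l = l'" if "l \<in> \<Lambda>" "l' \<in> \<Lambda>" "\<lfloor>l * real Q\<rfloor> = \<lfloor>l' * real Q\<rfloor>" for l l'
  proof (rule ccontr)
    assume "l \<noteq> l'"
    have "\<bar>l * real Q - l' * real Q\<bar> < 1" using that(3) by linarith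
    then have "\<bar>l - l'\<bar> * real Q < 1" by (simp add: left_diff_distrib[symmetric] abs_mult)
    then have "\<bar>l - l'\<bar> < 1 / real Q" using Q by (simp add: pos_less_divide_eq)
    then show False using sep[OF that(1,2) \<open>l \<noteq> l'\<close>] Q(2) by linarith
  qed
  have cell: "real_of_int i / real Q \<le> p i \<and> p i \<le> (real_of_int i + 1) / real Q" for i
  proof (cases "occ i")
    case True
    have "real_of_int i \<le> p i * real Q" "p i * real Q \<le> real_of_int i + 1" using p(2)[OF True] by linarith+
    then show ?thesis using Q by (simp add: pos_divide_le_eq pos_le_divide_eq)
  next
    case False
    then show ?thesis using Q by (simp add: p_def divide_right_mono)
  qed
  have occ: "occ i" if "0 < \<mu> i" for i using that by (auto simp: \<mu>_def split: if_splits)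
  have dec: "p \<lfloor>l * real Q\<rfloor> = l" "\<mu> \<lfloor>l * real Q\<rfloor> = m l" if "l \<in> \<Lambda>" for l
  proof -
    have o: "occ \<lfloor>l * real Q\<rfloor>" using that by (auto simp: occ_def)
    show "p \<lfloor>l * real Q\<rfloor> = l" by (rule uniq[OF p(1)[OF o] that p(2)[OF o]])
    then show "\<mu> \<lfloor>l * real Q\<rfloor> = m l" using o by (simp add: \<mu>_def)
  qed
  have "encoded_samples \<Lambda> m Q M d p \<mu>"
  proof
    show "cells Q p" using cell by (simp add: cells_def)
    show "\<mu> i \<le> M" for i using p M by (simp add: \<mu>_def)
    show "d \<le> \<bar>p i - p i'\<bar>" if "i \<noteq> i'" "0 < \<mu> i" "0 < \<mu> i'" for i i'
      using p[OF occ[OF that(2)]] p[OF occ[OF that(3)]] that(1) by (intro sep) auto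
    show "p i \<in> \<Lambda>" "\<mu> i = m (p i)" if "0 < \<mu> i" for i
      using p[OF occ[OF that]] occ[OF that] by (auto simp: \<mu>_def)
  qed (use Q d dec m1 in auto)
  then show ?thesis by blast
qed

lemma shift_series_eq_shift_sum: "shift_series g c f \<Longrightarrow> f = shift_sum g c"
  by (auto simp: shift_series_def shift_sum_def)

context encoded_samples
begin

lemma inj_p: "inj_on p {i. 0 < \<mu> i}"
proof (rule inj_onI, rule ccontr)
  fix i i' assume "i \<in> {i. 0 < \<mu> i}" "i' \<in> {i. 0 < \<mu> i}" "p i = p i'" "i \<noteq> i'"
  then show False using sep[of i i'] d by simp
qed

lemma sum_samples_decode:
  assumes "finite I"
  shows "(\<Sum>i\<in>I. \<Sum>j<\<mu> i. \<psi> j (p i)) = (\<Sum>l\<in>p ` (I \<inter> {i. 0 < \<mu> i}). \<Sum>j<m l. \<psi> j l)"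
proof -
  have "(\<Sum>i\<in>I. \<Sum>j<\<mu> i. \<psi> j (p i)) = (\<Sum>i\<in>I \<inter> {i. 0 < \<mu> i}. \<Sum>j<\<mu> i. \<psi> j (p i))"
    using assms by (intro sum.mono_neutral_right) auto
  also have "\<dots> = (\<Sum>i\<in>I \<inter> {i. 0 < \<mu> i}. \<Sum>j<m (p i). \<psi> j (p i))"
    by (intro sum.cong) (auto simp: enc(2)[symmetric])
  also have "\<dots> = (\<Sum>l\<in>p ` (I \<inter> {i. 0 < \<mu> i}). \<Sum>j<m l. \<psi> j l)"
    by (subst sum.reindex) (auto intro: inj_on_subset[OF inj_p])
  finally show ?thesis .
qed

lemma sum_samples_encode:
  assumes "\<Lambda>' \<subseteq> \<Lambda>"
  shows "(\<Sum>l\<in>\<Lambda>'. \<Sum>j<m l. \<psi> j l) = (\<Sum>i\<in>(\<lambda>l. \<lfloor>l * real Q\<rfloor>) ` \<Lambda>'. \<Sum>j<\<mu> i. \<psi> j (p i))"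
proof -
  have "inj_on (\<lambda>l. \<lfloor>l * real Q\<rfloor>) \<Lambda>'"
    by (rule inj_on_inverseI[where g = p]) (use dec assms in auto)
  then show ?thesis
    using assms by (subst sum.reindex) (auto intro!: sum.cong simp: dec subset_iff)
qed

lemma count_encode: "(\<Sum>i | p i \<in> {x..y}. \<mu> i) = (\<Sum>l\<in>\<Lambda> \<inter> {x..y}. m l)"
proof -
  let ?I = "{i. p i \<in> {x..y}}"
  have fin: "finite ?I"
  proof (rule finite_subset)
    show "?I \<subseteq> {\<lfloor>real Q * x\<rfloor> - 1..\<lceil>real Q * y\<rceil>}"
      using cell_indices_bounded[OF Q] cells unfolding cells_def by blast
  qed auto
  have "p ` (?I \<inter> {i. 0 < \<mu> i}) = \<Lambda> \<inter> {x..y}"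
  proof (intro subset_antisym subsetI)
    fix l assume "l \<in> \<Lambda> \<inter> {x..y}"
    then show "l \<in> p ` (?I \<inter> {i. 0 < \<mu> i})"
      using dec[of l] m1[of l] by (intro image_eqI[of _ _ "\<lfloor>l * real Q\<rfloor>"]) auto
  qed (use enc in auto)
  then show ?thesis using sum_samples_decode[OF fin, of "\<lambda>_ _. 1 :: nat"] by simp
qed

lemma encoded_sample_class:
  assumes "\<And>x. N \<le> (\<Sum>l\<in>\<Lambda> \<inter> {x..x + L}. m l)"
  shows "sample_class Q M d L N p \<mu>"
  using cells \<mu>M sep assms unfolding sample_class_def cells_def count_encode by auto

end

section \<open>Sampling inequalities and the necessary density\<close>

locale chain_samples = gaussian_chain + encoded_samples
begin

lemma nderiv_shift_sum:
  assumes "\<And>k. norm (c k) \<le> B"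
  shows "nderiv j (shift_sum (G 0 0) c) = shift_sum (G 0 j) c"
proof (induction j)
  case 0
  show ?case by (simp add: nderiv_def)
next
  case (Suc j)
  have "nderiv (Suc j) (shift_sum (G 0 0) c) = (\<lambda>x. vector_derivative (nderiv j (shift_sum (G 0 0) c)) (at x))"
    by (simp add: nderiv_def)
  then show ?case unfolding Suc.IH
    using vector_derivative_at[OF chain_has_vector_derivative[OF _ assms]] by auto
qed

text \<open>Raising all multiplicities to the common bound \<open>M\<close> leaves one sum over
  cells for each order of derivative.\<close>

lemma finite_sample_sum_le:
  assumes C: "\<And>q j I. cells Q q \<Longrightarrow> j < M \<Longrightarrow> finite I \<Longrightarrow> (\<Sum>i\<in>I. \<psi> j (q i)) \<le> C"
    and pos: "\<And>j x. (0::real) \<le> \<psi> j x" and \<Lambda>': "finite \<Lambda>'" "\<Lambda>' \<subseteq> \<Lambda>"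
  shows "(\<Sum>l\<in>\<Lambda>'. \<Sum>j<m l. \<psi> j l) \<le> real M * C"
proof -
  let ?I = "(\<lambda>l. \<lfloor>l * real Q\<rfloor>) ` \<Lambda>'"
  have "(\<Sum>l\<in>\<Lambda>'. \<Sum>j<m l. \<psi> j l) = (\<Sum>i\<in>?I. \<Sum>j<\<mu> i. \<psi> j (p i))" by (rule sum_samples_encode[OF \<Lambda>'(2)])
  also have "\<dots> \<le> (\<Sum>i\<in>?I. \<Sum>j<M. \<psi> j (p i))"
    using \<mu>M by (intro sum_mono sum_mono2) (auto simp: pos order.strict_trans2)
  also have "\<dots> = (\<Sum>j<M. \<Sum>i\<in>?I. \<psi> j (p i))" by (rule sum.swap)
  also have "\<dots> \<le> (\<Sum>j<M. C)" by (intro sum_mono C cells) (use \<Lambda>' in auto)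
  finally show ?thesis by simp
qed

lemma sampling_set_p:
  assumes N: "\<And>x. N \<le> (\<Sum>l\<in>\<Lambda> \<inter> {x..x + L}. m l)" and L: "0 \<le> L" "L < real N" and P: "P \<ge> 1"
  shows "sampling_set_p P (G 0 0) \<Lambda> m"
proof -
  obtain C1 where C1: "C1 > 0" "\<And>j q c I. j < M \<Longrightarrow> cells Q q \<Longrightarrow> in_lp P c \<Longrightarrow> finite I \<Longrightarrow>
    (\<Sum>i\<in>I. norm (shift_sum (G 0 j) c (q i)) powr P) \<le> C1 * (\<Sum>\<^sub>\<infinity>k. norm (c k) powr P)"
    using samples_upper[OF Q P, of M] by blast
  obtain C2 where C2: "C2 > 0" "\<And>p \<mu> c Y. sample_class Q M d L N p \<mu> \<Longrightarrow> in_lp P c \<Longrightarrow>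
    (\<forall>I. finite I \<longrightarrow> (\<Sum>i\<in>I. \<Sum>j<\<mu> i. norm (shift_sum (G 0 j) c (p i)) powr P) \<le> Y) \<Longrightarrow>
    (\<Sum>\<^sub>\<infinity>k. norm (c k) powr P) \<le> C2 * Y"
    using coefficients_le_samples[OF Q d L P, of M] by blast
  obtain C3 where C3: "C3 > 0" "\<And>c. in_lp P c \<Longrightarrow> in_Lp P (shift_sum (G 0 0) c) \<Longrightarrow>
     (\<Sum>\<^sub>\<infinity>k. norm (c k) powr P) \<le> C3 * Lp_norm_pow P (shift_sum (G 0 0) c)"
    using coefficients_le_Lp[OF P] by blast
  obtain C4 where C4: "C4 > 0" "\<And>c. in_lp P c \<Longrightarrow> Lp_norm_pow P (shift_sum (G 0 0) c) \<le> C4 * (\<Sum>\<^sub>\<infinity>k. norm (c k) powr P)"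
    using Lp_le_coefficients[OF P] by blast
  show ?thesis
    unfolding sampling_set_p_def
  \<comment> \<open>Norm and samples are both compared with the coefficients: \<open>C4\<close> and
    \<open>C2\<close> bound the norm by the samples, \<open>C1\<close> and \<open>C3\<close> the
    samples by the norm. \<open>real M + 1\<close> keeps the constant positive even if
    \<open>M = 0\<close>.\<close>
  proof (rule exI[of _ "1 / (C4 * C2)"], intro conjI exI[of _ "(real M + 1) * (C1 * C3)"] ballI)
    show "0 < 1 / (C4 * C2)" "0 < (real M + 1) * (C1 * C3)" using C1 C2 C3 C4 by (auto intro!: mult_pos_pos add_nonneg_pos)
    fix f assume "f \<in> Vp P (G 0 0)"
    then obtain c where fL: "in_Lp P f" and c: "in_lp P c" and f: "f = shift_sum (G 0 0) c"
      unfolding Vp_def using shift_series_eq_shift_sum by blast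
    note cb = in_lp_bounded[OF c P]
    let ?T = "\<Sum>\<^sub>\<infinity>k. norm (c k) powr P"
    let ?\<phi> = "\<lambda>l. \<Sum>j<m l. norm (nderiv j f l) powr P"
    have nd: "nderiv j f = shift_sum (G 0 j) c" for j unfolding f by (rule nderiv_shift_sum[OF cb])
    have fin: "sum ?\<phi> \<Lambda>' \<le> real M * (C1 * ?T)" if "finite \<Lambda>'" "\<Lambda>' \<subseteq> \<Lambda>" for \<Lambda>'
      unfolding nd by (rule finite_sample_sum_le[where \<psi> = "\<lambda>j x. norm (shift_sum (G 0 j) c x) powr P"])
        (use C1(2) c that in auto)
    have \<phi>0: "0 \<le> ?\<phi> l" for l by (intro sum_nonneg) auto
    show sm: "?\<phi> summable_on \<Lambda>"
      by (rule nonneg_bounded_partial_sums_imp_summable_on[where C = "real M * (C1 * ?T)"])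
         (use \<phi>0 fin in \<open>auto intro!: eventually_finite_subsets_at_top_weakI\<close>)
    have T0: "0 \<le> ?T" by (intro infsum_nonneg) auto
    have T3: "?T \<le> C3 * Lp_norm_pow P f" unfolding f by (rule C3(2)[OF c]) (use fL f in simp)
    have "infsum ?\<phi> \<Lambda> \<le> real M * (C1 * ?T)" by (rule infsum_le_finite_sums[OF sm fin])
    also have "\<dots> \<le> (real M + 1) * (C1 * (C3 * Lp_norm_pow P f))"
      using T0 T3 C1(1) by (intro mult_mono mult_left_mono) auto
    finally show "infsum ?\<phi> \<Lambda> \<le> (real M + 1) * (C1 * C3) * Lp_norm_pow P f" by (simp add: mult.assoc)
    have "?T \<le> C2 * infsum ?\<phi> \<Lambda>"
    proof (rule C2(2)[OF encoded_sample_class[OF N] c], intro allI impI)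
      fix I :: "int set" assume I: "finite I"
      have "(\<Sum>i\<in>I. \<Sum>j<\<mu> i. norm (shift_sum (G 0 j) c (p i)) powr P) = (\<Sum>l\<in>p ` (I \<inter> {i. 0 < \<mu> i}). ?\<phi> l)"
        unfolding nd by (rule sum_samples_decode[OF I])
      also have "\<dots> \<le> infsum ?\<phi> \<Lambda>"
        using I enc \<phi>0 by (intro finite_sum_le_infsum sm) auto
      finally show "(\<Sum>i\<in>I. \<Sum>j<\<mu> i. norm (shift_sum (G 0 j) c (p i)) powr P) \<le> infsum ?\<phi> \<Lambda>" .
    qed
    then have "C4 * ?T \<le> C4 * (C2 * infsum ?\<phi> \<Lambda>)" using C4(1) by (intro mult_left_mono) auto
    then have "Lp_norm_pow P f \<le> C4 * (C2 * infsum ?\<phi> \<Lambda>)" using C4(2)[OF c] f by simp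
    then show "1 / (C4 * C2) * Lp_norm_pow P f \<le> infsum ?\<phi> \<Lambda>" using C2(1) C4(1) by (simp add: field_simps)
  qed
qed

lemma sampling_set_inf:
  assumes N: "\<And>x. N \<le> (\<Sum>l\<in>\<Lambda> \<inter> {x..x + L}. m l)" and L: "0 \<le> L" "L < real N"
  shows "sampling_set_inf (G 0 0) \<Lambda> m"
proof -
  \<comment> \<open>\<open>Suc M\<close> ensures that order 0, which controls \<open>f\<close>
    itself, is included.\<close>
  obtain C0 where C0: "C0 \<ge> 0" "\<And>j x. j < Suc M \<Longrightarrow> norm (G 0 j x) \<le> C0 * exp (- b * \<bar>x\<bar>)"
    using decay_uniform[of "Suc M"] by blast
  define K where "K = C0 * exp_sum_bound b + 1"
  have K: "K > 0" using C0(1) exp_sum_bound_pos[OF b_pos] by (simp add: K_def add_nonneg_pos)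
  have upper: "norm (shift_sum (G 0 j) c x) \<le> K * B" if "j < Suc M" "\<And>k. norm (c k) \<le> B" for j c x B
  proof -
    have "0 \<le> B" using that(2)[of 0] norm_ge_zero order_trans by blast
    then show ?thesis using shift_sum_norm_le[of b "G 0 j" C0 c B x, OF b_pos C0(2)[OF that(1)] that(2)] by (simp add: K_def algebra_simps)
  qed
  obtain C1 where C1: "C1 > 0" "\<And>p \<mu> c B k. sample_class Q M d L N p \<mu> \<Longrightarrow> (\<forall>k. norm (c k) \<le> B) \<Longrightarrow>
    \<exists>i j. j < \<mu> i \<and> norm (c k) \<le> C1 * norm (shift_sum (G 0 j) c (p i))"
    using coefficients_le_samples_sup[OF Q d L, of M] by blast
  \<comment> \<open>A fixed pattern, later the half-integers, recovers the coefficients from the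
    supremum of \<open>f\<close>.\<close>
  obtain C2 where C2: "C2 > 0" "\<And>p \<mu> c B k. sample_class 2 1 (1 / 4) 5 6 p \<mu> \<Longrightarrow> (\<forall>k. norm (c k) \<le> B) \<Longrightarrow>
    \<exists>i j. j < \<mu> i \<and> norm (c k) \<le> C2 * norm (shift_sum (G 0 j) c (p i))"
  proof -
    have "(0::nat) < 2" "(0::real) < 1 / 4" "(0::real) \<le> 5" "(5::real) < real 6" by auto
    from coefficients_le_samples_sup[OF this, of 1] show thesis using that by blast
  qed
  show ?thesis
    unfolding sampling_set_inf_def
  proof (rule exI[of _ "1 / (K * C1)"], intro conjI exI[of _ "K * C2"] ballI)
    show "0 < 1 / (K * C1)" "0 < K * C2" using K C1 C2 by auto
    fix f assume "f \<in> Vinf (G 0 0)"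
    then obtain c where fL: "in_Linf f" and c: "in_linf c" and f: "f = shift_sum (G 0 0) c"
      unfolding Vinf_def using shift_series_eq_shift_sum by blast
    obtain B where B: "\<And>k. norm (c k) \<le> B" using c unfolding in_linf_def bounded_iff by auto
    have nd: "nderiv j f = shift_sum (G 0 j) c" for j unfolding f by (rule nderiv_shift_sum[OF B])
    have cont: "continuous_on UNIV f" unfolding f by (rule shift_sum_continuous[OF B])
    let ?S = "SUP l\<in>\<Lambda>. SUP j\<in>{..<m l}. ereal (norm (nderiv j f l))"
    have Sle: "?S \<le> ereal (K * B')" if "\<And>k. norm (c k) \<le> B'" for B'
    proof (intro SUP_least)
      fix l j assume lj: "l \<in> \<Lambda>" "j \<in> {..<m l}"
      have "m l \<le> M" using dec(2)[OF lj(1)] \<mu>M by metis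
      then show "ereal (norm (nderiv j f l)) \<le> ereal (K * B')"
        unfolding nd using upper[where j = j and c = c and x = l, OF _ that] lj by simp
    qed
    have inS: "ereal (norm (shift_sum (G 0 j) c (p i))) \<le> ?S" if "j < \<mu> i" for i j
    proof -
      have "p i \<in> \<Lambda>" "j < m (p i)" using enc[of i] that by auto
      then have "ereal (norm (nderiv j f (p i))) \<le> (SUP j\<in>{..<m (p i)}. ereal (norm (nderiv j f (p i))))"
        by (intro SUP_upper) auto
      also have "\<dots> \<le> ?S" using \<open>p i \<in> \<Lambda>\<close> by (intro SUP_upper)
      finally show ?thesis by (simp add: nd)
    qed
    have cl: "sample_class Q M d L N p \<mu>" by (rule encoded_sample_class[OF N])
    \<comment> \<open>In \<open>ereal\<close> an empty supremum is minus infinity; an actual sample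
      shows that \<open>?S\<close> is nonnegative.\<close>
    obtain i0 j0 where "j0 < \<mu> i0" using C1(2)[OF cl, of c B 0] B by blast
    from inS[OF this] have S0: "0 \<le> ?S" using order_trans[of 0 "ereal (norm (shift_sum (G 0 j0) c (p i0)))"] by simp
    have "?S \<noteq> \<infinity>" using Sle[OF B] by auto
    then obtain \<sigma> where \<sigma>: "?S = ereal \<sigma>" using S0 by (cases ?S) auto
    have c\<sigma>: "norm (c k) \<le> C1 * \<sigma>" for k
    proof -
      obtain i j where ij: "j < \<mu> i" "norm (c k) \<le> C1 * norm (shift_sum (G 0 j) c (p i))"
        using C1(2)[OF cl, of c B k] B by blast
      have "norm (shift_sum (G 0 j) c (p i)) \<le> \<sigma>" using inS[OF ij(1)] unfolding \<sigma> by simp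
      then have "C1 * norm (shift_sum (G 0 j) c (p i)) \<le> C1 * \<sigma>" using C1(1) by (intro mult_left_mono) auto
      then show ?thesis using ij(2) by linarith
    qed
    have "Linf_norm f \<le> ereal (K * (C1 * \<sigma>))"
      unfolding f by (rule Linf_norm_le)
        (use cont f upper[where j = 0 and c = c, OF _ c\<sigma>] in \<open>auto simp: borel_measurable_continuous_onI\<close>)
    then have "ereal (1 / (K * C1)) * Linf_norm f \<le> ereal (1 / (K * C1)) * ereal (K * (C1 * \<sigma>))"
      using K C1(1) by (intro ereal_mult_left_mono) auto
    also have "\<dots> = ereal \<sigma>" using K C1(1) by simp
    finally show "ereal (1 / (K * C1)) * Linf_norm f \<le> ?S" unfolding \<sigma> .
    have "Linf_norm f \<noteq> \<infinity>" using fL by (simp add: in_Linf_def)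
    moreover have "0 \<le> Linf_norm f" using order_trans[OF _ norm_le_Linf_norm[OF cont, of 0], of 0] by simp
    ultimately obtain s where s: "Linf_norm f = ereal s" by (cases "Linf_norm f") auto
    have "norm (c k) \<le> C2 * s" for k
    proof -
      have "sample_class 2 1 (1 / 4) 5 6 (\<lambda>i. real_of_int i / 2) (\<lambda>i. 1)"
        by (rule quarter_cells_sample_class) auto
      then obtain i where i: "norm (c k) \<le> C2 * norm (f (real_of_int i / 2))"
        using C2(2)[of "\<lambda>i. real_of_int i / 2" "\<lambda>i. 1" c B k] B f by auto
      have "norm (f (real_of_int i / 2)) \<le> s" using norm_le_Linf_norm[OF cont, of "real_of_int i / 2"] unfolding s by simp
      then have "C2 * norm (f (real_of_int i / 2)) \<le> C2 * s" using C2(1) by (intro mult_left_mono) auto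
      then show ?thesis using i by linarith
    qed
    from Sle[OF this] show "?S \<le> ereal (K * C2) * Linf_norm f" unfolding s by (simp add: mult.assoc)
  qed
qed

text \<open>In a window with fewer than \<open>D * (2 * r)\<close> conditions, the integers at
  distance at least \<open>\<rho> * r\<close> from both ends still outnumber them. Samples outside
  are at least \<open>\<rho> * r\<close> away from the support of \<open>c\<close>: half the decay
  rate yields the small factor \<open>\<eta>\<close>, the other half bounds the sum over all samples
  by the coefficient norm.\<close>

lemma sampling_set_density:
  assumes S: "sampling_set_p 2 (G 0 0) \<Lambda> m"
    and low: "\<And>R. \<exists>r\<ge>R. \<exists>x. real (\<Sum>l\<in>\<Lambda> \<inter> {x - r..x + r}. m l) < D * (2 * r)" and D: "D < 1"
  shows False
proof -
  obtain A where A: "A > 0" "\<And>f. f \<in> Vp 2 (G 0 0) \<Longrightarrow>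
     A * Lp_norm_pow 2 f \<le> (\<Sum>\<^sub>\<infinity>l\<in>\<Lambda>. \<Sum>j<m l. norm (nderiv j f l) powr 2)"
     "\<And>f. f \<in> Vp 2 (G 0 0) \<Longrightarrow> (\<lambda>l. \<Sum>j<m l. norm (nderiv j f l) powr 2) summable_on \<Lambda>"
    using S unfolding sampling_set_p_def by blast
  obtain C0 where C0: "C0 \<ge> 0" "\<And>j x. j < M \<Longrightarrow> norm (G 0 j x) \<le> C0 * exp (- b * \<bar>x\<bar>)"
    using decay_uniform[of M] by blast
  have b2: "b / 2 > 0" using b_pos by simp
  obtain C1 where C1: "C1 > 0" "\<And>q c I. cells Q q \<Longrightarrow> in_lp 2 c \<Longrightarrow> finite I \<Longrightarrow>
    (\<Sum>i\<in>I. (\<Sum>\<^sub>\<infinity>k. norm (c k) * exp (- (b / 2) * \<bar>q i - real_of_int k\<bar>)) powr 2) \<le> C1 * (\<Sum>\<^sub>\<infinity>k. norm (c k) powr 2)"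
    using exp_weighted_samples_le[OF b2 Q, of 2] by auto
  obtain C3 where C3: "C3 > 0" "\<And>c. in_lp 2 c \<Longrightarrow> in_Lp 2 (shift_sum (G 0 0) c) \<Longrightarrow>
     (\<Sum>\<^sub>\<infinity>k. norm (c k) powr 2) \<le> C3 * Lp_norm_pow 2 (shift_sum (G 0 0) c)"
    using coefficients_le_Lp[of 2] by auto
  have inL: "in_Lp 2 (shift_sum (G 0 0) c)" if "in_lp 2 c" for c
    using Lp_le_coefficients[of 2] that by auto
  \<comment> \<open>With \<open>D = 1 - 4 * \<rho>\<close> there are fewer than
    \<open>2 * r - 8 * \<rho> * r\<close> conditions, while at least
    \<open>2 * r - 2 * \<rho> * r - 1\<close> integers remain after trimming.\<close>
  define \<rho> where "\<rho> = (1 - D) / 4"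
  have \<rho>: "\<rho> > 0" using D by (simp add: \<rho>_def)
  define \<kappa> where "\<kappa> = real M * ((C0 + 1) powr 2 * C1)"
  have \<kappa>0: "0 \<le> \<kappa>" using C1(1) by (simp add: \<kappa>_def)
  have "((\<lambda>r. C3 * \<kappa> * exp (- (b / 2 * \<rho>) * r)) \<longlongrightarrow> 0) at_top"
    using b_pos \<rho> by real_asymp
  then have "\<forall>\<^sub>F r in at_top. C3 * \<kappa> * exp (- (b / 2 * \<rho>) * r) < A" using A(1) by (rule order_tendstoD)
  \<comment> \<open>The constants are fixed before the window, so \<open>r\<close> can be taken
    large enough to beat \<open>A\<close>.\<close>
  then obtain R where R: "\<And>r. r \<ge> R \<Longrightarrow> C3 * \<kappa> * exp (- (b / 2 * \<rho>) * r) < A"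
    by (auto simp: eventually_at_top_linorder)
  obtain r x where r: "r \<ge> max R (1 / \<rho>)" and rx: "real (\<Sum>l\<in>\<Lambda> \<inter> {x - r..x + r}. m l) < D * (2 * r)"
    using low by blast
  have r\<rho>: "1 \<le> r * \<rho>" using r \<rho> by (simp add: pos_divide_le_eq)
  have r0: "r > 0" using r \<rho> by (smt (verit) divide_pos_pos max.bounded_iff)
  define K where "K = {\<lceil>x - (1 - \<rho>) * r\<rceil>..\<lfloor>x + (1 - \<rho>) * r\<rfloor>}"
  have cardK: "real (card K) > D * (2 * r)"
  proof -
    have "D * (2 * r) = 2 * r - 8 * (r * \<rho>)" by (simp add: \<rho>_def field_simps)
    moreover have "real (card K) \<ge> 2 * ((1 - \<rho>) * r) - 1" unfolding K_def card_atLeastAtMost_int by linarith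
    moreover have "2 * ((1 - \<rho>) * r) = 2 * r - 2 * (r * \<rho>)" by (simp add: algebra_simps)
    ultimately show ?thesis using r\<rho> by linarith
  qed
  have finL: "finite (\<Lambda> \<inter> {x - r..x + r})"
  proof (rule finite_imageD[where f = "\<lambda>l. \<lfloor>l * real Q\<rfloor>"])
    show "inj_on (\<lambda>l. \<lfloor>l * real Q\<rfloor>) (\<Lambda> \<inter> {x - r..x + r})"
      by (rule inj_on_inverseI[where g = p]) (use dec in auto)
    have "(\<lambda>l. \<lfloor>l * real Q\<rfloor>) ` (\<Lambda> \<inter> {x - r..x + r}) \<subseteq> {\<lfloor>(x - r) * real Q\<rfloor>..\<lfloor>(x + r) * real Q\<rfloor>}"
      by (auto intro!: floor_mono mult_right_mono)
    then show "finite ((\<lambda>l. \<lfloor>l * real Q\<rfloor>) ` (\<Lambda> \<inter> {x - r..x + r}))" by (rule finite_subset) auto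
  qed
  define E where "E = (SIGMA l : \<Lambda> \<inter> {x - r..x + r}. {..<m l})"
  have "card E = (\<Sum>l\<in>\<Lambda> \<inter> {x - r..x + r}. m l)" unfolding E_def using finL by (subst card_SigmaI) auto
  then have "real (card E) < real (card K)" using rx cardK by simp
  then have "card E < card K" by simp
  moreover have "finite E" unfolding E_def using finL by auto
  ultimately obtain c where c: "\<exists>k\<in>K. c k \<noteq> 0" "\<And>k. k \<notin> K \<Longrightarrow> c k = 0"
      "\<And>e. e \<in> E \<Longrightarrow> (\<Sum>k\<in>K. G 0 (snd e) (fst e - of_int k) * c k) = 0"
    using underdetermined_system[of E K "\<lambda>e k. G 0 (snd e) (fst e - of_int k)"] by (auto simp: K_def)
  have finK: "finite K" by (simp add: K_def)
  have clp: "in_lp 2 c" unfolding in_lp_def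
    by (rule finite_nonzero_values_imp_summable_on) (rule finite_subset[OF _ finK], use c(2) in force)
  note cb = in_lp_bounded[OF clp, simplified]
  define f where "f = shift_sum (G 0 0) c"
  have fV: "f \<in> Vp 2 (G 0 0)"
  proof -
    have "shift_series (G 0 0) c f"
      using has_sum_imp_summable[OF chain_has_sum[OF le0 cb]] by (simp add: shift_series_def f_def shift_sum_def)
    then show ?thesis using inL[OF clp] clp unfolding Vp_def f_def by blast
  qed
  have nd: "nderiv j f = shift_sum (G 0 j) c" for j unfolding f_def by (rule nderiv_shift_sum[OF cb])
  let ?T = "\<Sum>\<^sub>\<infinity>k. norm (c k) powr 2"
  let ?E = "\<lambda>l. \<Sum>\<^sub>\<infinity>k. norm (c k) * exp (- (b / 2) * \<bar>l - real_of_int k\<bar>)"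
  define \<eta> where "\<eta> = exp (- (b / 2 * \<rho>) * r)"
  have \<eta>: "0 < \<eta>" "\<eta> \<le> 1" using b_pos \<rho> r0 by (auto simp: \<eta>_def)
  have smE: "(\<lambda>k. norm (c k) * exp (- \<beta> * \<bar>l - real_of_int k\<bar>)) summable_on UNIV" for l \<beta>
    by (rule finite_nonzero_values_imp_summable_on) (rule finite_subset[OF _ finK], use c(2) in force)
  have small: "norm (shift_sum (G 0 j) c l) powr 2 \<le> (C0 + 1) powr 2 * \<eta> * ?E l powr 2"
    if l: "l \<in> \<Lambda>" and j: "j < m l" for l j
  proof (cases "l \<in> {x - r..x + r}")
    case True
    have "shift_sum (G 0 j) c l = (\<Sum>k\<in>K. c k * G 0 j (l - of_int k))"
    proof -
      have "shift_sum (G 0 j) c l = (\<Sum>\<^sub>\<infinity>k\<in>K. c k * G 0 j (l - of_int k))"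
        unfolding shift_sum_def by (rule infsum_cong_neutral) (use c(2) in auto)
      then show ?thesis using finK by simp
    qed
    also have "\<dots> = 0" using c(3)[of "(l, j)"] l j True by (simp add: E_def mult.commute)
    finally show ?thesis using \<eta> by simp
  next
    case False
    have "m l \<le> M" using dec(2)[OF l] \<mu>M by metis
    then have jM: "j < M" using j by simp
    have E0: "0 \<le> ?E l" by (intro infsum_nonneg) auto
    have "norm (shift_sum (G 0 j) c l) \<le> C0 * (\<Sum>\<^sub>\<infinity>k. norm (c k) * exp (- b * \<bar>l - real_of_int k\<bar>))"
      by (rule shift_sum_le_exp_weighted[OF C0(2)[OF jM] cb])
    also have "\<dots> \<le> C0 * (\<Sum>\<^sub>\<infinity>k. \<eta> * (norm (c k) * exp (- (b / 2) * \<bar>l - real_of_int k\<bar>)))"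
    proof (intro mult_left_mono C0(1) infsum_mono smE summable_on_cmult_right)
      fix k :: int
      show "norm (c k) * exp (- b * \<bar>l - real_of_int k\<bar>) \<le> \<eta> * (norm (c k) * exp (- (b / 2) * \<bar>l - real_of_int k\<bar>))"
      proof (cases "k \<in> K")
        case True
        have "x - (1 - \<rho>) * r \<le> real_of_int k" "real_of_int k \<le> x + (1 - \<rho>) * r"
          using True unfolding K_def by (auto simp: ceiling_le_iff le_floor_iff)
        then have "\<rho> * r \<le> \<bar>l - real_of_int k\<bar>" using False by (auto simp: algebra_simps)
        then have "b / 2 * (\<rho> * r) \<le> b / 2 * \<bar>l - real_of_int k\<bar>" using b2 by (intro mult_left_mono) auto
        then have "exp (- b * \<bar>l - real_of_int k\<bar>) \<le> \<eta> * exp (- (b / 2) * \<bar>l - real_of_int k\<bar>)"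
          by (simp add: \<eta>_def mult.assoc flip: exp_add)
        then have "norm (c k) * exp (- b * \<bar>l - real_of_int k\<bar>) \<le> norm (c k) * (\<eta> * exp (- (b / 2) * \<bar>l - real_of_int k\<bar>))"
          by (rule mult_left_mono) simp
        then show ?thesis by (simp add: mult.left_commute)
      qed (use c(2) in simp)
    qed
    also have "\<dots> = C0 * (\<eta> * ?E l)" by (simp only: infsum_cmult_right')
    also have "\<dots> \<le> (C0 + 1) * (\<eta> * ?E l)" using \<eta> E0 by (intro mult_right_mono) auto
    finally have "norm (shift_sum (G 0 j) c l) powr 2 \<le> ((C0 + 1) * (\<eta> * ?E l)) powr 2"
      by (intro powr_mono2) auto
    also have "\<dots> = (C0 + 1) powr 2 * (\<eta> powr 2 * ?E l powr 2)" using C0(1) \<eta> E0 by (simp add: powr_mult)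
    also have "\<dots> \<le> (C0 + 1) powr 2 * (\<eta> * ?E l powr 2)"
    proof -
      have "\<eta> powr 2 \<le> \<eta> powr 1" using \<eta> by (intro powr_mono') auto
      then show ?thesis using \<eta> by (intro mult_left_mono mult_right_mono) auto
    qed
    finally show ?thesis by (simp add: mult.assoc)
  qed
  have "(\<Sum>\<^sub>\<infinity>l\<in>\<Lambda>. \<Sum>j<m l. norm (nderiv j f l) powr 2) \<le> \<kappa> * \<eta> * ?T"
  proof (rule infsum_le_finite_sums[OF A(3)[OF fV]])
    fix \<Lambda>' assume \<Lambda>': "finite \<Lambda>'" "\<Lambda>' \<subseteq> \<Lambda>"
    have "(\<Sum>l\<in>\<Lambda>'. \<Sum>j<m l. norm (nderiv j f l) powr 2) \<le> (\<Sum>l\<in>\<Lambda>'. \<Sum>j<m l. (C0 + 1) powr 2 * \<eta> * ?E l powr 2)"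
      unfolding nd by (intro sum_mono small) (use \<Lambda>' in auto)
    also have "\<dots> \<le> real M * ((C0 + 1) powr 2 * \<eta> * (C1 * ?T))"
    proof (rule finite_sample_sum_le[where \<psi> = "\<lambda>j l. (C0 + 1) powr 2 * \<eta> * ?E l powr 2", OF _ _ \<Lambda>'])
      fix q :: "int \<Rightarrow> real" and j and I :: "int set" assume q: "cells Q q" "finite I"
      show "(\<Sum>i\<in>I. (C0 + 1) powr 2 * \<eta> * ?E (q i) powr 2) \<le> (C0 + 1) powr 2 * \<eta> * (C1 * ?T)"
        unfolding sum_distrib_left[symmetric] using \<eta> by (intro mult_left_mono C1(2) q clp) auto
    qed (use \<eta> in auto)
    also have "\<dots> = \<kappa> * \<eta> * ?T" by (simp add: \<kappa>_def mult_ac)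
    finally show "(\<Sum>l\<in>\<Lambda>'. \<Sum>j<m l. norm (nderiv j f l) powr 2) \<le> \<kappa> * \<eta> * ?T" .
  qed
  with A(2)[OF fV] have AT: "A * Lp_norm_pow 2 f \<le> \<kappa> * \<eta> * ?T" by linarith
  have "A * ?T \<le> A * (C3 * Lp_norm_pow 2 f)"
    using C3(2)[OF clp inL[OF clp]] A(1) unfolding f_def by (intro mult_left_mono) auto
  also have "\<dots> = C3 * (A * Lp_norm_pow 2 f)" by simp
  also have "\<dots> \<le> C3 * (\<kappa> * \<eta> * ?T)" using AT C3(1) by (intro mult_left_mono) auto
  finally have "A * ?T \<le> (C3 * \<kappa> * \<eta>) * ?T" by (simp add: mult_ac)
  moreover have "?T > 0"
  proof -
    obtain k where "c k \<noteq> 0" using c(1) by blast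
    then have "0 < norm (c k) powr 2" by simp
    also have "\<dots> = (\<Sum>k\<in>{k}. norm (c k) powr 2)" by simp
    also have "\<dots> \<le> ?T" using clp unfolding in_lp_def by (intro finite_sum_le_infsum) auto
    finally show ?thesis .
  qed
  ultimately have "A \<le> C3 * \<kappa> * \<eta>" by simp
  then show False using R[of r] r by (simp add: \<eta>_def)
qed

end

theorem theorem1p1:
  fixes g :: "real \<Rightarrow> complex" and \<Lambda> :: "real set" and m :: "real \<Rightarrow> nat"
  assumes "tp_gaussian g"
    and "separated \<Lambda>"
    and "\<forall>l\<in>\<Lambda>. m l \<ge> 1"
    and "\<exists>M. \<forall>l\<in>\<Lambda>. m l \<le> M"
  shows "(lower_density \<Lambda> m > 1 \<longrightarrow>
            (\<forall>p::real. p \<ge> 1 \<longrightarrow> sampling_set_p p g \<Lambda> m) \<and> sampling_set_inf g \<Lambda> m)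
       \<and> (sampling_set_p 2 g \<Lambda> m \<longrightarrow> lower_density \<Lambda> m \<ge> 1)"
proof -
  obtain G n \<delta> a A b where chain: "gaussian_chain G n \<delta> a A b" and G: "G 0 0 = g"
    using tp_gaussian_chain[OF assms(1)] by blast
  obtain d where d: "d > 0" "\<And>a b. a \<in> \<Lambda> \<Longrightarrow> b \<in> \<Lambda> \<Longrightarrow> a \<noteq> b \<Longrightarrow> d \<le> \<bar>a - b\<bar>"
    using assms(2) unfolding separated_def by blast
  obtain M where M: "\<And>l. l \<in> \<Lambda> \<Longrightarrow> m l \<le> M" using assms(4) by blast
  obtain Q :: nat where Q: "1 / d < real Q" using reals_Archimedean2 by blast
  have Q0: "Q > 0" using Q d(1) by (cases Q) auto
  have Qd: "1 / real Q < d" using Q Q0 d(1) by (simp add: field_simps)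
  have "\<exists>p \<mu>. encoded_samples \<Lambda> m Q M d p \<mu>"
    by (rule separated_encode) (use d Q0 Qd M assms(3) in auto)
  then obtain p \<mu> where encoded: "encoded_samples \<Lambda> m Q M d p \<mu>" by blast
  interpret chain_samples G n \<delta> a A b \<Lambda> m Q M d p \<mu>
    by (rule chain_samples.intro[OF chain encoded])
  let ?cnt = "\<lambda>x r. \<Sum>l\<in>\<Lambda> \<inter> {x - r..x + r}. real (m l)"
  have "(\<forall>P::real. P \<ge> 1 \<longrightarrow> sampling_set_p P g \<Lambda> m) \<and> sampling_set_inf g \<Lambda> m" if dens: "lower_density \<Lambda> m > 1"
  proof -
    \<comment> \<open>A strict inequality for the lower limit holds with this \<open>D\<close> from
      some radius on, for all centres at once.\<close>
    obtain D where D: "1 < D" "ereal D < lower_density \<Lambda> m"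
      using ereal_dense2[OF dens] by (auto simp: one_ereal_def)
    then have "\<forall>\<^sub>F r in at_top. ereal D < (INF x. ereal (?cnt x r / (2 * r)))"
      unfolding lower_density_def by (intro less_LiminfD) auto
    then obtain R0 where R0: "\<And>r. r \<ge> R0 \<Longrightarrow> ereal D < (INF x. ereal (?cnt x r / (2 * r)))"
      by (auto simp: eventually_at_top_linorder)
    define R where "R = max R0 1"
    have R1: "R \<ge> 1" "R \<ge> R0" by (auto simp: R_def)
    define L where "L = 2 * R"
    \<comment> \<open>\<open>D * L > L\<close> bounds every count from below; counts are integers,
      so rounding up is legitimate.\<close>
    define N where "N = nat \<lceil>D * L\<rceil>"
    have L: "0 \<le> L" using R1 by (simp add: L_def)
    have "L < D * L" using D(1) R1 by (simp add: L_def)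
    also have "\<dots> \<le> real N" unfolding N_def by linarith
    finally have LN: "L < real N" .
    have cnt: "N \<le> (\<Sum>l\<in>\<Lambda> \<inter> {x..x + L}. m l)" for x
    proof -
      have "ereal D < ereal (?cnt (x + R) R / (2 * R))"
        using R0[OF R1(2)] by (rule less_INF_D) simp
      then have "D * L \<le> ?cnt (x + R) R" using R1 by (simp add: L_def pos_less_divide_eq)
      moreover have "x + R - R = x" "x + R + R = x + L" by (simp_all add: L_def)
      ultimately have "D * L \<le> real (\<Sum>l\<in>\<Lambda> \<inter> {x..x + L}. m l)" by (simp only: of_nat_sum)
      then show ?thesis unfolding N_def by linarith
    qed
    show ?thesis
      using sampling_set_p[OF cnt L LN] sampling_set_inf[OF cnt L LN] unfolding G by blast
  qed
  moreover have "lower_density \<Lambda> m \<ge> 1" if S: "sampling_set_p 2 g \<Lambda> m"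
  proof (rule ccontr)
    assume "\<not> ?thesis"
    then have "lower_density \<Lambda> m < 1" by simp
    then obtain D where D: "lower_density \<Lambda> m < ereal D" "D < 1"
      using ereal_dense2[of "lower_density \<Lambda> m" 1] by (auto simp: one_ereal_def)
    \<comment> \<open>Otherwise the normalised counts would be at least \<open>D\<close> for all
      large radii, and so would their lower limit.\<close>
    have "\<exists>r\<ge>R. \<exists>x. real (\<Sum>l\<in>\<Lambda> \<inter> {x - r..x + r}. m l) < D * (2 * r)" for R
    proof (rule ccontr)
      assume neg: "\<not> ?thesis"
      have "\<forall>\<^sub>F r in at_top. ereal D \<le> (INF x. ereal (?cnt x r / (2 * r)))"
        unfolding eventually_at_top_linorder
      proof (intro exI[of _ "max R 1"] allI impI INF_greatest)
        fix r x assume r: "max R 1 \<le> r"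
        then have "D * (2 * r) \<le> ?cnt x r" using neg by (auto simp: not_less)
        then show "ereal D \<le> ereal (?cnt x r / (2 * r))" using r by (simp add: pos_le_divide_eq)
      qed
      then have "ereal D \<le> lower_density \<Lambda> m" unfolding lower_density_def by (rule Liminf_bounded)
      then show False using D(1) by simp
    qed
    then show False using sampling_set_density[OF S[folded G] _ D(2)] by blast
  qed
  ultimately show ?thesis by blast
qed

end
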